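(* Let $P$ be a simple (not necessarily convex) hexagon with corners labeled $0,1,\dots,5$ cyclically, $[i]$ the angle at corner $i$, and $|\bar{i}|$ the length of the side $\bar i$ joining corners $i$ and $i+1$ (indices mod $6$). Suppose $[1]=[3]=[5]=\tfrac{2}{3}\pi$, $|\bar{0}|=|\bar{1}|$, $|\bar{2}|=|\bar{3}|$, $|\bar{4}|=|\bar{5}|$, and suppose moreover that $|\bar{0}|,|\bar{2}|,|\bar{4}|$ are pairwise distinct and $[0],[2],[4]\neq\tfrac{2}{3}\pi$. Then there is, up to isometry of the plane, exactly one side-to-side tiling of the Euclidean plane by congruent copies of $P$ in which every vertex has degree $3$. This tiling is isohedral and periodic, and it covers a minimal torus tiling consisting of three tiles.
   Context: Tiles are congruent copies of $P$ under isometries of the plane. A tiling is side-to-side if its vertices and edges coincide with corners and sides of tiles; the degree of a vertex is the number of tiles meeting there. Isohedral: the symmetry group of the tiling acts transitively on tiles. Periodic: invariant under two linearly independent translations. A plane tiling invariant under a lattice $\Lambda$ of translations induces a tiling of the flat torus $\mathbb{C}/\Lambda$, and for a sublattice $\Lambda'\subset\Lambda$ the induced tiling of $\mathbb{C}/\Lambda'$ covers that of $\mathbb{C}/\Lambda$; the plane tiling itself covers each such torus tiling. A torus tiling $\mathcal{T}$ is minimal if whenever $\mathcal{T}$ covers a torus tiling $\mathcal{T}'$, then $\mathcal{T}=\mathcal{T}'$. *)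

theory Defs
  imports "HOL-Analysis.Analysis"
begin

section \<open>Hexagons\<close>

text \<open>
  The plane is \<^typ>\<open>complex\<close>. A hexagon is given by its cyclic sequence of corners, indexed by the
  six-element numeral type \<^typ>\<open>6\<close>, whose arithmetic is arithmetic modulo 6. Either orientation is
  allowed.
\<close>

type_synonym hexagon = "6 \<Rightarrow> complex"

definition corners :: "hexagon \<Rightarrow> complex set" where
  "corners p = range p"

definition side :: "hexagon \<Rightarrow> 6 \<Rightarrow> complex set" where
  "side p i = closed_segment (p i) (p (i + 1))"

definition sides :: "hexagon \<Rightarrow> complex set set" where
  "sides p = range (side p)"

definition side_length :: "hexagon \<Rightarrow> 6 \<Rightarrow> real" where
  "side_length p i = dist (p i) (p (i + 1))"

definition boundary_path :: "hexagon \<Rightarrow> real \<Rightarrow> complex" where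
  "boundary_path p =
     linepath (p 0) (p 1) +++ linepath (p 1) (p 2) +++ linepath (p 2) (p 3) +++
     linepath (p 3) (p 4) +++ linepath (p 4) (p 5) +++ linepath (p 5) (p 0)"

definition simple_hexagon :: "hexagon \<Rightarrow> bool" where
  "simple_hexagon p \<longleftrightarrow> simple_path (boundary_path p)"

definition region :: "hexagon \<Rightarrow> complex set" where
  "region p = path_image (boundary_path p) \<union> inside (path_image (boundary_path p))"

text \<open>
  The interior angle at corner \<open>i\<close> is the opening, strictly between \<open>0\<close> and \<open>2\<pi>\<close>, of the circular
  sector with which the region coincides near that corner. It exists and is unique for every simple
  hexagon, may exceed \<open>\<pi>\<close>, and does not depend on the orientation of the labelling.
\<close>

definition interior_angle :: "hexagon \<Rightarrow> 6 \<Rightarrow> real" where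
  "interior_angle p i =
     (THE \<theta>. 0 < \<theta> \<and> \<theta> < 2 * pi \<and>
        (\<exists>u r. norm u = 1 \<and> r > 0 \<and>
           region p \<inter> ball (p i) r =
             {p i + of_real s * u * cis t | s t. 0 \<le> s \<and> s < r \<and> 0 \<le> t \<and> t \<le> \<theta>}))"


section \<open>Plane tilings\<close>

definition plane_isometry :: "(complex \<Rightarrow> complex) \<Rightarrow> bool" where
  "plane_isometry f \<longleftrightarrow> surj f \<and> (\<forall>x y. dist (f x) (f y) = dist x y)"

definition congruent_copy :: "hexagon \<Rightarrow> hexagon \<Rightarrow> bool" where
  "congruent_copy p q \<longleftrightarrow> (\<exists>f. plane_isometry f \<and> q = f \<circ> p)"

definition plane_tiling :: "complex set set \<Rightarrow> bool" where
  "plane_tiling T \<longleftrightarrow>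
     \<Union>T = UNIV \<and> pairwise (\<lambda>t t'. interior t \<inter> interior t' = {}) T"

text \<open>
  A tiling is a set of point sets. An angle \<open>\<pi>\<close> at a corner is not excluded, so the corners of a tile
  need not be determined by the tile as a point set; hence notions involving corners refer to a set
  \<open>Q\<close> of hexagons, one for each tile.
\<close>

definition tiling_by_copies :: "hexagon \<Rightarrow> hexagon set \<Rightarrow> bool" where
  "tiling_by_copies p Q \<longleftrightarrow>
     (\<forall>q\<in>Q. congruent_copy p q) \<and> inj_on region Q \<and> plane_tiling (region ` Q)"

text \<open>
  Side-to-side: two distinct tiles meet exactly in their common corners and common (entire) sides.
\<close>

definition side_to_side :: "hexagon set \<Rightarrow> bool" where
  "side_to_side Q \<longleftrightarrow>
     pairwise (\<lambda>q q'. region q \<inter> region q' =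
       (corners q \<inter> corners q') \<union> \<Union>(sides q \<inter> sides q')) Q"

definition vertices :: "hexagon set \<Rightarrow> complex set" where
  "vertices Q = \<Union>(corners ` Q)"

definition vertex_degree :: "complex set set \<Rightarrow> complex \<Rightarrow> nat" where
  "vertex_degree T v = card {t \<in> T. v \<in> t}"

definition side_to_side_degree_3_tiling :: "hexagon \<Rightarrow> complex set set \<Rightarrow> bool" where
  "side_to_side_degree_3_tiling p T \<longleftrightarrow>
     (\<exists>Q. T = region ` Q \<and> tiling_by_copies p Q \<and> side_to_side Q \<and>
          (\<forall>v\<in>vertices Q. vertex_degree T v = 3))"

definition move_tiling :: "(complex \<Rightarrow> complex) \<Rightarrow> complex set set \<Rightarrow> complex set set" where
  "move_tiling f T = (\<lambda>t. f ` t) ` T"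

definition symmetries :: "complex set set \<Rightarrow> (complex \<Rightarrow> complex) set" where
  "symmetries T = {f. plane_isometry f \<and> move_tiling f T = T}"

definition isohedral :: "complex set set \<Rightarrow> bool" where
  "isohedral T \<longleftrightarrow> (\<forall>t\<in>T. \<forall>t'\<in>T. \<exists>f\<in>symmetries T. f ` t = t')"

definition translation_invariant :: "complex set set \<Rightarrow> complex \<Rightarrow> bool" where
  "translation_invariant T w \<longleftrightarrow> move_tiling (\<lambda>z. z + w) T = T"

definition periodic :: "complex set set \<Rightarrow> bool" where
  "periodic T \<longleftrightarrow>
     (\<exists>v w. v \<noteq> w \<and> independent {v, w} \<and>
            translation_invariant T v \<and> translation_invariant T w)"


section \<open>Torus tilings\<close>

definition plane_lattice :: "complex set \<Rightarrow> bool" where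
  "plane_lattice L \<longleftrightarrow>
     (\<exists>v w. v \<noteq> w \<and> independent {v, w} \<and> L = {of_int m * v + of_int n * w | m n. True})"

text \<open>
  The tiling that a plane tiling \<open>T\<close> invariant under a lattice \<open>L\<close> induces on the flat torus
  \<open>\<complex>/L\<close> is represented by the pair \<open>(L, T)\<close>. The points of the torus are the cosets of \<open>L\<close>,
  and the tiles on the torus are the images of the tiles of \<open>T\<close> under the quotient map.
\<close>

type_synonym torus_tiling = "complex set \<times> complex set set"

definition is_torus_tiling :: "torus_tiling \<Rightarrow> bool" where
  "is_torus_tiling X \<longleftrightarrow>
     (case X of (L, T) \<Rightarrow>
        plane_lattice L \<and> plane_tiling T \<and> (\<forall>w\<in>L. translation_invariant T w))"

definition torus_proj :: "complex set \<Rightarrow> complex \<Rightarrow> complex set" where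
  "torus_proj L z = (\<lambda>w. z + w) ` L"

definition torus_tiles :: "torus_tiling \<Rightarrow> complex set set set" where
  "torus_tiles X = (case X of (L, T) \<Rightarrow> (\<lambda>t. torus_proj L ` t) ` T)"

definition torus_covers :: "torus_tiling \<Rightarrow> torus_tiling \<Rightarrow> bool" where
  "torus_covers X Y \<longleftrightarrow>
     is_torus_tiling X \<and> is_torus_tiling Y \<and> snd X = snd Y \<and> fst X \<subseteq> fst Y"

definition plane_covers :: "complex set set \<Rightarrow> torus_tiling \<Rightarrow> bool" where
  "plane_covers T X \<longleftrightarrow> is_torus_tiling X \<and> snd X = T"

definition minimal_torus_tiling :: "torus_tiling \<Rightarrow> bool" where
  "minimal_torus_tiling X \<longleftrightarrow>
     is_torus_tiling X \<and> (\<forall>Y. torus_covers X Y \<longrightarrow> X = Y)"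

end

theory Submission
  imports Defs "HOL-Complex_Analysis.Winding_Numbers" "HOL-Library.Groups_Big_Fun"
begin

text \<open>
  Equal sides enclosing an interior angle \<open>2\<pi>/3\<close> at the odd corners mean that the rotations by \<open>2\<pi>/3\<close>
  about these corners carry each side of the hexagon to an adjacent one. The odd corners form an equilateral triangle,
  and the three rotations generate a group of type p3. Summing over the group the winding numbers of
  the copies of the boundary around a generic point, cutting the hexagon into the triangle of its odd corners and
  three outer triangles, and regrouping the outer triangles around the even vertices replaces the hexagon by
  a fundamental parallelogram of a triangular lattice; hence every generic point lies in exactly one copy.
  Conversely, in a side-to-side tiling with vertices of degree three, the three side lengths determine which
  corners can meet: either three equal odd corners, or the corners 0, 2, 4, or an odd corner and twice the same
      even one,
  and the last case would make that even angle \<open>2\<pi>/3\<close>. So the neighbours of every tile are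
  its images under the rotations. A further translation symmetry would give the tile a threefold rotational
  symmetry permuting the odd corners, which would make the side lengths equal.
\<close>

section \<open>Hexagons and plane isometries\<close>

text \<open>Winding numbers are signed, and the cancellations survive. The price is that the winding
  number inside the hexagon must be known; it is computed at an odd corner, where the angle is
  given, and the same computation shows that the three rotations turn in the same sense, which
  angles and lengths at single corners leave open. The tile centres form a triangular lattice with
  one group element per lattice point: the index \<open>(m, n)\<close> gives the translation part,
  \<open>m + n\<close> modulo 3 the rotation part. So the translations have index 3 among the
  lattice points, whence three tiles on the torus. In the converse, copies may be reflected. The
  neighbour across a side can be placed wrongly in two ways: one makes an even corner meet its own
  label, the other makes two edges at the vertex coincide. A symmetry of the tiling only knows tiles
  as point sets, so the odd corners must be recovered from the region, as the points with a sector
  of angle 2/3 pi.\<close>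

lemma exhaust_6: "i = 0 \<or> i = 1 \<or> i = 2 \<or> i = 3 \<or> i = 4 \<or> i = (5::6)"
proof (cases i)
  case (of_int z)
  then have "z = 0 \<or> z = 1 \<or> z = 2 \<or> z = 3 \<or> z = 4 \<or> z = 5" by auto
  with of_int show ?thesis by auto
qed

lemma UNIV_6: "(UNIV :: 6 set) = {0, 1, 2, 3, 4, 5}"
  using exhaust_6 by auto

lemma numeral_6 [simp]: "(6::6) = 0" "(7::6) = 1" "(8::6) = 2"
  by simp_all

lemma boundary_path_loop [simp]:
  "path (boundary_path p)" "pathstart (boundary_path p) = p 0" "pathfinish (boundary_path p) = p 0"
  by (simp_all add: boundary_path_def)

lemma path_image_boundary_path: "path_image (boundary_path p) = (\<Union>i. side p i)"
  unfolding UNIV_6 by (simp add: boundary_path_def path_image_join side_def)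

text \<open>The join rules for simple paths peel off one side at a time, so each side is compared
  with the union of the later ones; only the first side meets that union at both ends, since the
  path is closed. Arbitrary pairs of sides follow by case analysis.\<close>

lemma simple_hexagon_corners_inj:
  assumes "simple_hexagon p"
  shows "inj p"
    and "i \<noteq> j \<Longrightarrow> z \<in> side p i \<Longrightarrow> z \<in> side p j \<Longrightarrow> j + 1 = i \<and> z = p i \<or> i + 1 = j \<and> z = p j"
proof -
  have arc_neq: "arc (linepath a b) \<Longrightarrow> a \<noteq> b" for a b :: complex
    by (metis arc_distinct_ends pathfinish_linepath pathstart_linepath)
  have side: "side p 0 = closed_segment (p 0) (p 1)" "side p 1 = closed_segment (p 1) (p 2)"
    "side p 2 = closed_segment (p 2) (p 3)" "side p 3 = closed_segment (p 3) (p 4)"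
    "side p 4 = closed_segment (p 4) (p 5)" "side p 5 = closed_segment (p 5) (p 0)"
    by (simp_all add: side_def)
  have simple: "simple_path (linepath (p 0) (p 1) +++ linepath (p 1) (p 2) +++ linepath (p 2) (p 3) +++
     linepath (p 3) (p 4) +++ linepath (p 4) (p 5) +++ linepath (p 5) (p 0))"
    using assms by (simp add: simple_hexagon_def boundary_path_def)
  have S: "side p 0 \<inter> (side p 1 \<union> (side p 2 \<union> (side p 3 \<union> (side p 4 \<union> side p 5)))) \<subseteq> {p 0, p 1}"
     "side p 1 \<inter> (side p 2 \<union> (side p 3 \<union> (side p 4 \<union> side p 5))) \<subseteq> {p 2}"
     "side p 2 \<inter> (side p 3 \<union> (side p 4 \<union> side p 5)) \<subseteq> {p 3}"
     "side p 3 \<inter> (side p 4 \<union> side p 5) \<subseteq> {p 4}"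
     "side p 4 \<inter> side p 5 \<subseteq> {p 5}"
    and n: "p 0 \<noteq> p 1" "p 1 \<noteq> p 2" "p 2 \<noteq> p 3" "p 3 \<noteq> p 4" "p 4 \<noteq> p 5" "p 5 \<noteq> p 0"
    using simple
    by (simp_all add: simple_path_join_loop_eq arc_join_eq path_image_join side arc_neq)
  have e: "p 0 \<in> side p 0" "p 1 \<in> side p 0" "p 1 \<in> side p 1" "p 2 \<in> side p 1" "p 2 \<in> side p 2" "p 3 \<in> side p 2"
    "p 3 \<in> side p 3" "p 4 \<in> side p 3" "p 4 \<in> side p 4" "p 5 \<in> side p 4" "p 5 \<in> side p 5" "p 0 \<in> side p 5"
    by (simp_all add: side_def)
  have M: "z \<in> side p 0 \<Longrightarrow> z \<in> side p 1 \<or> z \<in> side p 2 \<or> z \<in> side p 3 \<or> z \<in> side p 4 \<or> z \<in> side p 5 \<Longrightarrow> z = p 0 \<or> z =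
      p 1"
    "z \<in> side p 1 \<Longrightarrow> z \<in> side p 2 \<or> z \<in> side p 3 \<or> z \<in> side p 4 \<or> z \<in> side p 5 \<Longrightarrow> z = p 2"
    "z \<in> side p 2 \<Longrightarrow> z \<in> side p 3 \<or> z \<in> side p 4 \<or> z \<in> side p 5 \<Longrightarrow> z = p 3"
    "z \<in> side p 3 \<Longrightarrow> z \<in> side p 4 \<or> z \<in> side p 5 \<Longrightarrow> z = p 4"
    "z \<in> side p 4 \<Longrightarrow> z \<in> side p 5 \<Longrightarrow> z = p 5" for z
    using S by blast+
  have i0: "p 0 \<noteq> p 2" "p 0 \<noteq> p 3" "p 0 \<noteq> p 4" "p 1 \<noteq> p 3" "p 1 \<noteq> p 4" "p 1 \<noteq> p 5"
           "p 2 \<noteq> p 4" "p 2 \<noteq> p 5" "p 3 \<noteq> p 5"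
    by (metis e n M)+
  have "p i = p j \<longrightarrow> i = j" for i j
    using exhaust_6[of i] exhaust_6[of j] i0 n by (elim disjE) (auto dest: sym)
  then show "inj p" by (auto simp: inj_def)
  have d: "p 0 \<notin> side p 1" "p 0 \<notin> side p 2" "p 0 \<notin> side p 3" "p 0 \<notin> side p 4"
    "p 1 \<notin> side p 2" "p 1 \<notin> side p 3" "p 1 \<notin> side p 4" "p 1 \<notin> side p 5"
    "p 2 \<notin> side p 0" "p 2 \<notin> side p 3" "p 2 \<notin> side p 4" "p 2 \<notin> side p 5"
    "p 3 \<notin> side p 0" "p 3 \<notin> side p 1" "p 3 \<notin> side p 4" "p 3 \<notin> side p 5"
    "p 4 \<notin> side p 0" "p 4 \<notin> side p 1" "p 4 \<notin> side p 2" "p 4 \<notin> side p 5"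
    "p 5 \<notin> side p 0" "p 5 \<notin> side p 1" "p 5 \<notin> side p 2" "p 5 \<notin> side p 3"
    by (metis e n i0 M)+
  have K: "z \<in> side p 0 \<Longrightarrow> z \<in> side p 1 \<Longrightarrow> z = p 1" "z \<in> side p 0 \<Longrightarrow> z \<in> side p 2 \<Longrightarrow> False"
    "z \<in> side p 0 \<Longrightarrow> z \<in> side p 3 \<Longrightarrow> False" "z \<in> side p 0 \<Longrightarrow> z \<in> side p 4 \<Longrightarrow> False"
    "z \<in> side p 0 \<Longrightarrow> z \<in> side p 5 \<Longrightarrow> z = p 0" "z \<in> side p 1 \<Longrightarrow> z \<in> side p 2 \<Longrightarrow> z = p 2"
    "z \<in> side p 1 \<Longrightarrow> z \<in> side p 3 \<Longrightarrow> False" "z \<in> side p 1 \<Longrightarrow> z \<in> side p 4 \<Longrightarrow> False"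
    "z \<in> side p 1 \<Longrightarrow> z \<in> side p 5 \<Longrightarrow> False" "z \<in> side p 2 \<Longrightarrow> z \<in> side p 3 \<Longrightarrow> z = p 3"
    "z \<in> side p 2 \<Longrightarrow> z \<in> side p 4 \<Longrightarrow> False" "z \<in> side p 2 \<Longrightarrow> z \<in> side p 5 \<Longrightarrow> False"
    "z \<in> side p 3 \<Longrightarrow> z \<in> side p 4 \<Longrightarrow> z = p 4" "z \<in> side p 3 \<Longrightarrow> z \<in> side p 5 \<Longrightarrow> False"
    "z \<in> side p 4 \<Longrightarrow> z \<in> side p 5 \<Longrightarrow> z = p 5"
    by (metis d M)+
  assume "i \<noteq> j" "z \<in> side p i" "z \<in> side p j"
  then show "j + 1 = i \<and> z = p i \<or> i + 1 = j \<and> z = p j"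
    using exhaust_6[of i] exhaust_6[of j] by (elim disjE) (simp_all, (metis K)+)
qed

section \<open>Plane isometries and their action on hexagons\<close>

lemma plane_isometryI:
  assumes "norm A = 1"
  shows "plane_isometry (\<lambda>z. A * z + B)" "plane_isometry (\<lambda>z. A * cnj z + B)"
proof -
  have [simp]: "A \<noteq> 0" using assms by auto
  show "plane_isometry (\<lambda>z. A * z + B)"
    unfolding plane_isometry_def
  proof
    show "surj (\<lambda>z. A * z + B)"
      by (rule surjI[of _ "\<lambda>z. (z - B) / A"]) simp
    show "\<forall>x y. dist (A * x + B) (A * y + B) = dist x y"
      using assms by (simp add: dist_norm norm_mult flip: right_diff_distrib)
  qed
  show "plane_isometry (\<lambda>z. A * cnj z + B)"
    unfolding plane_isometry_def
  proof
    show "surj (\<lambda>z. A * cnj z + B)"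
      by (rule surjI[of _ "\<lambda>z. cnj ((z - B) / A)"]) simp
    show "\<forall>x y. dist (A * cnj x + B) (A * cnj y + B) = dist x y"
      using assms by (simp add: dist_norm norm_mult flip: right_diff_distrib complex_cnj_diff)
  qed
qed

text \<open>The linear part sends 1 and i to orthonormal vectors \<open>A\<close> and
  \<open>D\<close>. Orthonormality says that the sum of their complex squares vanishes, and this sum
  factors as \<open>(D - \<i> * A) * (D + \<i> * A)\<close>; the two factors are the direct and the
  opposite case.\<close>

lemma plane_isometry_cases:
  assumes "plane_isometry f"
  obtains A B where "norm A = 1" "f = (\<lambda>z. A * z + B)"
    | A B where "norm A = 1" "f = (\<lambda>z. A * cnj z + B)"
proof -
  define h where "h z = f z - f 0" for z
  have "orthogonal_transformation h"
    using assms by (simp add: orthogonal_transformation_isometry h_def plane_isometry_def dist_norm)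
  then have lin: "linear h" and inner: "\<And>v w. h v \<bullet> h w = v \<bullet> w"
    by (auto simp: orthogonal_transformation_def)
  have hz: "h z = of_real (Re z) * h 1 + of_real (Im z) * h \<i>" for z
  proof -
    have "z = Re z *\<^sub>R 1 + Im z *\<^sub>R \<i>" by (simp add: complex_eq_iff)
    then have "h z = h (Re z *\<^sub>R 1 + Im z *\<^sub>R \<i>)" by simp
    also have "\<dots> = Re z *\<^sub>R h 1 + Im z *\<^sub>R h \<i>"
      by (simp add: linear_add[OF lin] linear_scale[OF lin])
    finally show ?thesis by (simp add: scaleR_conv_of_real)
  qed
  define A where "A = h 1"
  define D where "D = h \<i>"
  have 1: "A \<bullet> A = 1" "D \<bullet> D = 1" "A \<bullet> D = 0"
    using inner[of 1 1] inner[of \<i> \<i>] inner[of 1 \<i>] by (simp_all add: A_def D_def inner_complex_def)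
  then have nA: "norm A = 1" by (simp add: norm_eq_sqrt_inner)
  have "(D - \<i> * A) * (D + \<i> * A) = D\<^sup>2 + A\<^sup>2"
    by (simp add: algebra_simps power2_eq_square)
  also have "\<dots> = 0"
  proof -
    obtain a b c d where *: "A = Complex a b" "D = Complex c d" by (metis complex.collapse)
    have e: "a\<^sup>2 + b\<^sup>2 = 1" "c\<^sup>2 + d\<^sup>2 = 1" "a * c + b * d = 0"
      using 1 by (simp_all add: * inner_complex_def power2_eq_square)
    have "c\<^sup>2 - d\<^sup>2 + a\<^sup>2 - b\<^sup>2 = 0 \<and> c * d + a * b = 0"
      using e by algebra
    then show ?thesis by (auto simp: * complex_eq_iff power2_eq_square algebra_simps)
  qed
  finally consider "D = \<i> * A" | "D = - \<i> * A" by (auto simp: eq_neg_iff_add_eq_0)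
  then show thesis
  proof cases
    case 1
    have "f = (\<lambda>z. A * z + f 0)"
    proof
      fix z
      have "f z = h z + f 0" by (simp add: h_def)
      also have "h z = A * (of_real (Re z) + \<i> * of_real (Im z))"
        using hz[of z] 1 by (simp add: A_def D_def algebra_simps)
      finally show "f z = A * z + f 0" by (simp flip: complex_eq)
    qed
    with nA that(1) show ?thesis by blast
  next
    case 2
    have "f = (\<lambda>z. A * cnj z + f 0)"
    proof
      fix z
      have "f z = h z + f 0" by (simp add: h_def)
      also have "h z = A * (of_real (Re z) - \<i> * of_real (Im z))"
        using hz[of z] 2 by (simp add: A_def D_def algebra_simps)
      also have "of_real (Re z) - \<i> * of_real (Im z) = cnj z" by (simp add: complex_eq_iff)
      finally show "f z = A * cnj z + f 0" .
    qed
    with nA that(2) show ?thesis by blast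
  qed
qed

lemma plane_isometry_bij: "plane_isometry f \<Longrightarrow> bij f"
  unfolding plane_isometry_def bij_def inj_def by (metis dist_eq_0_iff)

lemma plane_isometry_comp: "plane_isometry f \<Longrightarrow> plane_isometry g \<Longrightarrow> plane_isometry (f \<circ> g)"
  unfolding plane_isometry_def by (metis comp_apply comp_surj)

lemma plane_isometry_inv: "plane_isometry f \<Longrightarrow> plane_isometry (inv f)"
  using plane_isometry_bij[of f] unfolding plane_isometry_def
  by (metis bij_betw_def bij_imp_bij_inv surj_f_inv_f)

lemma plane_isometry_homeomorphism:
  assumes "plane_isometry f"
  shows "homeomorphism UNIV UNIV f (inv f)"
proof -
  have cont: "continuous_on UNIV h" if "plane_isometry h" for h
    using that by (auto simp: continuous_on_iff plane_isometry_def)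
  show ?thesis
    using plane_isometry_bij[OF assms] cont[OF assms] cont[OF plane_isometry_inv[OF assms]]
    by (auto simp: homeomorphism_def bij_def surj_f_inv_f surj_imp_inj_inv inj_imp_surj_inv)
qed

text \<open>\<open>inside\<close> consists of the bounded components of the complement, and an
  isometry carries components to components and preserves boundedness in both directions.\<close>

lemma inside_plane_isometry:
  assumes "plane_isometry f"
  shows "inside (f ` S) = f ` inside S"
proof -
  have b: "bij f" using plane_isometry_bij assms by blast
  have bd: "bounded (f ` X) \<longleftrightarrow> bounded X" for X
    using assms unfolding plane_isometry_def bounded_def
    by (metis (no_types, lifting) UNIV_I image_iff)
  have hom: "homeomorphism (- S) (- f ` S) f (inv f)"
    by (rule homeomorphism_of_subsets[OF plane_isometry_homeomorphism[OF assms]])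
      (simp_all add: bij_image_Compl_eq[OF b])
  have "f x \<in> inside (f ` S) \<longleftrightarrow> x \<in> inside S" for x
  proof (cases "x \<in> S")
    case False
    then show ?thesis
      using connected_component_set_homeomorphism[OF hom, of x] bd b
      by (auto simp: inside_def inj_image_mem_iff bij_is_inj)
  qed (auto simp: inside_def)
  then show ?thesis
    using bij_is_surj[OF b] by (metis (no_types, opaque_lifting) image_subset_iff subset_antisym subsetI imageI surjD)
qed

lemma linepath_plane_isometry:
  assumes "plane_isometry f"
  shows "linepath (f a) (f b) = f \<circ> linepath a b"
  using assms
proof (cases rule: plane_isometry_cases)
  case (1 A B)
  then show ?thesis by (simp add: linepath_def fun_eq_iff algebra_simps scaleR_conv_of_real)
next
  case (2 A B)
  then show ?thesis by (simp add: linepath_def fun_eq_iff algebra_simps scaleR_conv_of_real)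
qed

lemma boundary_path_plane_isometry:
  assumes "plane_isometry f"
  shows "boundary_path (f \<circ> p) = f \<circ> boundary_path p"
proof -
  note * = linepath_plane_isometry[OF assms]
  show ?thesis by (simp add: boundary_path_def * path_compose_join)
qed

lemma path_image_plane_isometry:
  assumes "plane_isometry f"
  shows "path_image (boundary_path (f \<circ> p)) = f ` path_image (boundary_path p)"
  by (simp add: boundary_path_plane_isometry[OF assms] path_image_compose)

lemma region_plane_isometry:
  assumes "plane_isometry f"
  shows "region (f \<circ> p) = f ` region p"
  by (simp add: region_def path_image_plane_isometry[OF assms] inside_plane_isometry[OF assms] image_Un)

lemma simple_hexagon_plane_isometry:
  assumes "plane_isometry f" "simple_hexagon p"
  shows "simple_hexagon (f \<circ> p)"
proof -
  have "inj f" "continuous_on UNIV f"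
    using plane_isometry_homeomorphism[OF assms(1)] plane_isometry_bij[OF assms(1)]
    by (auto simp: homeomorphism_def bij_def)
  then show ?thesis
    using assms(2) unfolding simple_hexagon_def boundary_path_plane_isometry[OF assms(1)]
    by (intro simple_path_continuous_image) (auto intro: continuous_on_subset inj_on_subset)
qed

section \<open>Sectors\<close>

text \<open>This is literally the set in the definition of \<open>interior_angle\<close>: both
  bounding rays belong to it but the outer arc does not, so it can equal the trace of a region on an
  open ball.\<close>

definition sector :: "complex \<Rightarrow> complex \<Rightarrow> real \<Rightarrow> real \<Rightarrow> complex set" where
  "sector z u \<theta> r = {z + of_real s * u * cis t | s t. 0 \<le> s \<and> s < r \<and> 0 \<le> t \<and> t \<le> \<theta>}"

definition open_sector :: "complex \<Rightarrow> complex \<Rightarrow> real \<Rightarrow> real \<Rightarrow> complex set" where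
  "open_sector z u \<theta> r = {z + of_real s * u * cis t | s t. 0 < s \<and> s < r \<and> 0 < t \<and> t < \<theta>}"

lemma cis_inj_2pi:
  assumes "cis t = cis t'" "0 \<le> t" "t < 2 * pi" "0 \<le> t'" "t' < 2 * pi"
  shows "t = t'"
  using assms Arg2pi_unique[of 1 t "cis t"] Arg2pi_unique[of 1 t' "cis t"]
  by (simp add: cis_conv_exp)

lemma cis_add_2pi: "cis (t + 2 * pi) = cis t"
  by (simp flip: cis_mult)

lemma polar_cases:
  assumes "norm u = 1" "w \<noteq> z"
  obtains s t where "s = dist z w" "0 < s" "0 \<le> t" "t < 2 * pi" "w = z + of_real s * u * cis t"
proof -
  have u: "u \<noteq> 0" using assms by auto
  define v where "v = (w - z) / u"
  have "v = of_real (norm v) * cis (Arg2pi v)"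
    using Arg2pi_eq[of v] by (simp add: cis_conv_exp)
  moreover have "norm v = dist z w"
    using assms by (simp add: v_def norm_divide dist_norm norm_minus_commute)
  ultimately have "w = z + of_real (dist z w) * u * cis (Arg2pi v)"
    using u by (simp add: v_def field_simps)
  with that[of "dist z w" "Arg2pi v"] assms show ?thesis
    using Arg2pi_ge_0[of v] Arg2pi_lt_2pi[of v] by auto
qed

lemma unit_polar_cases:
  assumes "norm u = 1" "norm v = 1"
  obtains t where "0 \<le> t" "t < 2 * pi" "v = u * cis t"
proof -
  have "v \<noteq> 0" using assms by auto
  then obtain s t where st: "s = dist 0 v" "0 \<le> t" "t < 2 * pi" and v: "v = 0 + of_real s * u * cis t"
    by (rule polar_cases[OF assms(1)])
  have "s = 1" using assms st by simp
  then have "v = u * cis t" by (subst v) simp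
  with st show thesis by (intro that)
qed

lemma polar_eq_iff:
  assumes "norm u = 1" "0 < s" "0 \<le> s'"
  shows "z + of_real s * u * cis t = z + of_real s' * u * cis t' \<longleftrightarrow> s = s' \<and> cis t = cis t'"
proof
  assume *: "z + of_real s * u * cis t = z + of_real s' * u * cis t'"
  then have "norm (of_real s * u * cis t) = norm (of_real s' * u * cis t')"
    by (simp only: add_left_cancel)
  then have "s = s'" using assms by (simp add: norm_mult)
  with * assms show "s = s' \<and> cis t = cis t'" by auto
qed auto

lemma mem_sector_iff:
  assumes "norm u = 1" "0 < s" "s < r" "0 \<le> t" "t < 2 * pi" "\<theta> < 2 * pi"
  shows "z + of_real s * u * cis t \<in> sector z u \<theta> r \<longleftrightarrow> t \<le> \<theta>"
proof
  assume "z + of_real s * u * cis t \<in> sector z u \<theta> r"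
  then obtain s' t' where *: "z + of_real s * u * cis t = z + of_real s' * u * cis t'"
    "0 \<le> s'" "0 \<le> t'" "t' \<le> \<theta>"
    unfolding sector_def by blast
  then have "cis t = cis t'" using polar_eq_iff[of u s s'] assms by blast
  then show "t \<le> \<theta>" using cis_inj_2pi[of t t'] * assms by auto
next
  assume "t \<le> \<theta>"
  with assms show "z + of_real s * u * cis t \<in> sector z u \<theta> r"
    unfolding sector_def by fastforce
qed

lemma mem_open_sector_iff:
  assumes "norm u = 1" "0 < s" "s < r" "0 \<le> t" "t < 2 * pi" "\<theta> < 2 * pi"
  shows "z + of_real s * u * cis t \<in> open_sector z u \<theta> r \<longleftrightarrow> 0 < t \<and> t < \<theta>"
proof
  assume "z + of_real s * u * cis t \<in> open_sector z u \<theta> r"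
  then obtain s' t' where *: "z + of_real s * u * cis t = z + of_real s' * u * cis t'"
    "0 < s'" "0 < t'" "t' < \<theta>"
    unfolding open_sector_def by blast
  then have "cis t = cis t'" using polar_eq_iff[of u s s'] assms by fastforce
  then show "0 < t \<and> t < \<theta>" using cis_inj_2pi[of t t'] * assms by auto
next
  assume "0 < t \<and> t < \<theta>"
  with assms show "z + of_real s * u * cis t \<in> open_sector z u \<theta> r"
    unfolding open_sector_def by fastforce
qed

lemma sector_Int_ball:
  assumes "norm u = 1" "r' \<le> r"
  shows "sector z u \<theta> r \<inter> ball z r' = sector z u \<theta> r'"
  using assms by (fastforce simp: sector_def dist_norm norm_mult)

lemma open_sector_Int_ball:
  assumes "norm u = 1" "r' \<le> r"
  shows "open_sector z u \<theta> r \<inter> ball z r' = open_sector z u \<theta> r'"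
  using assms by (fastforce simp: open_sector_def dist_norm norm_mult)

text \<open>A proper sector has only one first ray: just before it there are points outside the
  sector. Equality of the rays reduces equality of the angles to
  \<open>mem_sector_iff\<close>.\<close>

lemma sector_unique:
  assumes "norm u = 1" "norm u' = 1" "0 < \<theta>" "\<theta> < 2 * pi" "0 < \<theta>'" "\<theta>' < 2 * pi" "0 < r"
    and eq: "sector z u \<theta> r = sector z u' \<theta>' r"
  shows "u = u'" "\<theta> = \<theta>'"
proof -
  define s where "s = r / 2"
  have s: "0 < s" "s < r" using assms by (auto simp: s_def)
  have u0: "u \<noteq> 0" using assms by auto
  obtain \<tau> where tau: "0 \<le> \<tau>" "\<tau> < 2 * pi" "u' = u * cis \<tau>"
    using unit_polar_cases[OF assms(1,2)] .
  have pt: "z + of_real s * u' * cis t = z + of_real s * u * cis (\<tau> + t)" for t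
    by (simp add: tau(3) mult.assoc flip: cis_mult)
  have "\<tau> \<le> \<theta>"
  proof -
    have "z + of_real s * u' * cis 0 \<in> sector z u' \<theta>' r"
      by (subst mem_sector_iff) (use assms s in auto)
    then show ?thesis
      using mem_sector_iff[OF assms(1) s tau(1,2) assms(4), of z] by (simp add: eq pt del: cis_zero)
  qed
  have "\<tau> = 0"
  proof (rule ccontr)
    assume "\<tau> \<noteq> 0"
    \<comment> \<open>Turning back from the ray \<open>u'\<close> by \<open>e\<close> stays in the
      sector of \<open>u\<close> because \<open>e \<le> \<tau>\<close>. Measured from
      \<open>u'\<close> this is the angle \<open>2 * pi - e\<close>, which exceeds \<theta>' by the
      second bound.\<close>
    define e where "e = min \<tau> ((2 * pi - \<theta>') / 2)"
    have e: "0 < e" "e \<le> \<tau>" "\<theta>' < 2 * pi - e" using \<open>\<tau> \<noteq> 0\<close> tau assms by (auto simp: e_def min_def field_simps)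
    have "z + of_real s * u * cis (\<tau> - e) \<in> sector z u \<theta> r"
      by (subst mem_sector_iff) (use assms s e tau \<open>\<tau> \<le> \<theta>\<close> in auto)
    also have "cis (\<tau> - e) = cis (\<tau> + (2 * pi - e))"
      using cis_add_2pi[of "\<tau> - e"] by (simp add: algebra_simps)
    finally have "z + of_real s * u' * cis (2 * pi - e) \<in> sector z u' \<theta>' r"
      by (simp only: pt eq)
    then show False
      by (subst (asm) mem_sector_iff) (use assms s e tau in auto)
  qed
  then show "u = u'" using tau by simp
  have *: "t \<le> \<theta> \<longleftrightarrow> t \<le> \<theta>'" if "0 \<le> t" "t < 2 * pi" for t
    using mem_sector_iff[OF assms(1) s that, of \<theta> z] mem_sector_iff[OF assms(2) s that, of \<theta>' z] assms eq \<open>u = u'\<close>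
    by auto
  show "\<theta> = \<theta>'"
    using *[of \<theta>] *[of \<theta>'] assms by auto
qed

lemma sector_eq_rays:
  assumes "0 < \<theta>" "0 < r"
  shows "sector z u \<theta> r =
    {z + of_real s * e | s e. 0 \<le> s \<and> s < r \<and> e \<in> {u, u * cis \<theta>}} \<union> open_sector z u \<theta> r" (is "_ = ?R \<union> _")
proof (intro equalityI subsetI)
  fix w assume "w \<in> sector z u \<theta> r"
  then obtain s t where w: "w = z + of_real s * u * cis t" "0 \<le> s" "s < r" "0 \<le> t" "t \<le> \<theta>"
    unfolding sector_def by blast
  consider "s = 0" | "t = 0" | "t = \<theta>" | "0 < s" "0 < t" "t < \<theta>" using w by linarith
  then show "w \<in> ?R \<union> open_sector z u \<theta> r"
  proof cases
    case 4
    then show ?thesis using w(1,3) unfolding open_sector_def by blast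
  qed (use w assms in \<open>force simp: mult.assoc\<close>)+
next
  fix w assume "w \<in> ?R \<union> open_sector z u \<theta> r"
  then consider s where "w = z + of_real s * u * cis 0" "0 \<le> s" "s < r"
    | s where "w = z + of_real s * u * cis \<theta>" "0 \<le> s" "s < r" | "w \<in> open_sector z u \<theta> r"
    by (auto simp: mult.assoc)
  then show "w \<in> sector z u \<theta> r"
  proof cases
    case (1 s)
    then show ?thesis unfolding sector_def using assms by (intro CollectI exI[of _ s] exI[of _ 0]) auto
  next
    case (2 s)
    then show ?thesis unfolding sector_def using assms by (intro CollectI exI[of _ s] exI[of _ \<theta>]) auto
  next
    case 3
    then show ?thesis unfolding sector_def open_sector_def by (blast intro: less_imp_le)
  qed
qed

lemma closure_meets_ball:
  fixes z :: "'a::metric_space"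
  assumes "z \<in> closure S" "0 < r"
  shows "S \<inter> ball z r \<noteq> {}"
  using assms unfolding closure_approachable by (metis disjoint_iff dist_commute mem_ball)

lemma connected_open_sector: "connected (open_sector z u \<theta> r)"
proof -
  have "open_sector z u \<theta> r = (\<lambda>(s, t). z + of_real s * u * cis t) ` ({0<..<r} \<times> {0<..<\<theta>})"
    unfolding open_sector_def by (force simp del: mult_cancel_left mult_cancel_right)
  then show ?thesis
    by (auto simp: split_beta intro!: connected_continuous_image continuous_intros connected_Times)
qed

text \<open>
  Locally a simple closed curve with two straight germs splits the disc into two open sectors. Each is connected,
  hence inside or outside; by the Jordan curve theorem both kinds occur.
\<close>

lemma sector_of_inside:
  assumes c: "simple_path c" "pathfinish c = pathstart c"
    and d: "norm d = 1" "norm d' = 1" "d \<noteq> d'" and r: "0 < r"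
    and germ: "path_image c \<inter> ball z r = {z + of_real s * e | s e. 0 \<le> s \<and> s < r \<and> e \<in> {d, d'}}"
  obtains u \<theta> where "norm u = 1" "0 < \<theta>" "\<theta> < 2 * pi"
    "u = d \<and> u * cis \<theta> = d' \<or> u = d' \<and> u * cis \<theta> = d"
    "(path_image c \<union> inside (path_image c)) \<inter> ball z r = sector z u \<theta> r"
    "inside (path_image c) \<inter> ball z r = open_sector z u \<theta> r"
proof -
  note J = Jordan_inside_outside[OF c]
  let ?I = "inside (path_image c)" and ?O = "outside (path_image c)"
  have zc: "z \<in> path_image c" using germ r by force
  obtain \<phi> where phi: "0 \<le> \<phi>" "\<phi> < 2 * pi" "d' = d * cis \<phi>"
    using unit_polar_cases[OF d(1,2)] .
  have phi0: "0 < \<phi>" using phi d by (cases "\<phi> = 0") auto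
  have dd: "d' * cis (2 * pi - \<phi>) = d" by (simp add: phi mult.assoc cis_mult)
  have pol: "\<exists>s t. w = z + of_real s * d * cis t \<and> 0 < s \<and> s < r \<and> 0 \<le> t \<and> t < 2 * pi"
    if "w \<in> ball z r" "w \<noteq> z" for w
    using polar_cases[OF d(1) that(2)] that(1) by (metis mem_ball)
  have shift: "z + of_real s * d' * cis t = z + of_real s * d * cis (\<phi> + t)" for s t
    by (simp add: phi(3) mult.assoc flip: cis_mult)
  have curve: "z + of_real s * d * cis t \<in> path_image c \<longleftrightarrow> t = 0 \<or> t = \<phi>"
    if "0 < s" "s < r" "0 \<le> t" "t < 2 * pi" for s t
  proof -
    have "z + of_real s * d * cis t \<in> ball z r" using that d by (simp add: dist_norm norm_mult)
    then have "z + of_real s * d * cis t \<in> path_image c \<longleftrightarrow>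
        z + of_real s * d * cis t \<in> {z + of_real s * e | s e. 0 \<le> s \<and> s < r \<and> e \<in> {d, d'}}"
      using germ by blast
    also have "\<dots> \<longleftrightarrow> (\<exists>s'\<ge>0. s' < r \<and> (z + of_real s * d * cis t = z + of_real s' * d
         \<or> z + of_real s * d * cis t = z + of_real s' * d'))"
      by blast
    also have "\<dots> \<longleftrightarrow> (\<exists>s'\<ge>0. s' < r \<and> (z + of_real s * d * cis t = z + of_real s' * d * cis 0
         \<or> z + of_real s * d * cis t = z + of_real s' * d * cis \<phi>))"
      by (simp add: phi(3) mult.assoc)
    also have "\<dots> \<longleftrightarrow> cis t = cis 0 \<or> cis t = cis \<phi>"
      using that d by (metis less_eq_real_def polar_eq_iff)
    also have "\<dots> \<longleftrightarrow> t = 0 \<or> t = \<phi>"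
      using cis_inj_2pi[of t 0] cis_inj_2pi[of t \<phi>] that phi by auto
    finally show ?thesis .
  qed
  define A where "A = open_sector z d \<phi> r"
  \<comment> \<open>The complementary sector, running on from \<open>d'\<close> until it returns to
    \<open>d\<close>.\<close>
  define B where "B = open_sector z d' (2 * pi - \<phi>) r"
  have memA: "z + of_real s * d * cis t \<in> A \<longleftrightarrow> 0 < t \<and> t < \<phi>" if "0 < s" "s < r" "0 \<le> t" "t < 2 * pi" for s t
    unfolding A_def by (rule mem_open_sector_iff) (use that d phi in auto)
  have memB: "z + of_real s * d * cis t \<in> B \<longleftrightarrow> \<phi> < t" if "0 < s" "s < r" "0 \<le> t" "t < 2 * pi" for s t
  proof
    assume "z + of_real s * d * cis t \<in> B"
    then obtain s' t' where *: "z + of_real s * d * cis t = z + of_real s' * d * cis (\<phi> + t')"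
      "0 < s'" "0 < t'" "t' < 2 * pi - \<phi>"
      unfolding B_def open_sector_def by (auto simp: shift)
    then have "cis t = cis (\<phi> + t')" using polar_eq_iff[of d s s'] that d by fastforce
    then show "\<phi> < t" using cis_inj_2pi[of t "\<phi> + t'"] * that phi by auto
  next
    assume "\<phi> < t"
    then have "z + of_real s * d' * cis (t - \<phi>) \<in> B"
      unfolding B_def open_sector_def using that by fastforce
    then show "z + of_real s * d * cis t \<in> B" by (simp add: shift)
  qed
  have AB_ball: "A \<subseteq> ball z r" "B \<subseteq> ball z r"
    using d by (auto simp: A_def B_def open_sector_def dist_norm norm_mult)
  have z: "z \<notin> A" "z \<notin> B" using d by (auto simp: A_def B_def open_sector_def)
  have disj: "A \<inter> path_image c = {}" "B \<inter> path_image c = {}" "A \<inter> B = {}"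
  proof -
    have "(w \<in> A \<longrightarrow> w \<notin> path_image c \<and> w \<notin> B) \<and> (w \<in> B \<longrightarrow> w \<notin> path_image c)" for w
    proof (cases "w \<in> A \<union> B")
      case True
      then have "w \<in> ball z r" "w \<noteq> z" using AB_ball z by auto
      then obtain s t where *: "w = z + of_real s * d * cis t" "0 < s" "s < r" "0 \<le> t" "t < 2 * pi"
        using pol by metis
      show ?thesis
        using curve[OF *(2-5)] memA[OF *(2-5)] memB[OF *(2-5)] phi0 unfolding *(1)[symmetric] by auto
    qed auto
    then show "A \<inter> path_image c = {}" "B \<inter> path_image c = {}" "A \<inter> B = {}" by blast+
  qed
  have cover: "ball z r - path_image c \<subseteq> A \<union> B"
  proof
    fix w assume w: "w \<in> ball z r - path_image c"
    then obtain s t where *: "w = z + of_real s * d * cis t" "0 < s" "s < r" "0 \<le> t" "t < 2 * pi"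
      using pol zc by (metis Diff_iff)
    then have "t \<noteq> 0" "t \<noteq> \<phi>" using curve[of s t] w by auto
    then show "w \<in> A \<union> B" using memA[OF *(2-5)] memB[OF *(2-5)] * by auto
  qed
  have one: "S \<subseteq> ?I \<or> S \<subseteq> ?O" if "connected S" "S \<inter> path_image c = {}" for S
  proof -
    have sub: "S \<subseteq> ?I \<union> ?O" using J that(2) by auto
    moreover have "?I \<inter> ?O \<inter> S = {}" "open ?I" "open ?O" using J by auto
    ultimately have "?I \<inter> S = {} \<or> ?O \<inter> S = {}" using connectedD[OF that(1)] by metis
    with sub show ?thesis by blast
  qed
  have A: "A \<subseteq> ?I \<or> A \<subseteq> ?O" and B: "B \<subseteq> ?I \<or> B \<subseteq> ?O"
    using one disj connected_open_sector by (auto simp: A_def B_def)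
  have "z \<in> closure ?I" "z \<in> closure ?O" using J zc by (auto simp: frontier_def)
  then have ne: "?I \<inter> ball z r \<noteq> {}" "?O \<inter> ball z r \<noteq> {}"
    using r closure_meets_ball by blast+
  have IO: "?I \<inter> ?O = {}" "?I \<inter> path_image c = {}" "?O \<inter> path_image c = {}"
    using J by (auto simp: inside_def outside_def)
  have I: "?I \<inter> ball z r = A \<or> ?I \<inter> ball z r = B"
    using A
  proof
    assume AI: "A \<subseteq> ?I"
    then have "\<not> B \<subseteq> ?I" using cover IO ne(2) by blast
    then have "B \<subseteq> ?O" using B by blast
    then have "?I \<inter> ball z r = A" using AI cover IO(1,2) AB_ball(1) by blast
    then show ?thesis ..
  next
    assume AO: "A \<subseteq> ?O"
    then have "\<not> B \<subseteq> ?O" using cover IO ne(1) by blast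
    then have "B \<subseteq> ?I" using B by blast
    then have "?I \<inter> ball z r = B" using AO cover IO(1,2) AB_ball(2) by blast
    then show ?thesis ..
  qed
  have secA: "path_image c \<inter> ball z r \<union> A = sector z d \<phi> r"
    unfolding germ A_def sector_eq_rays[OF phi0 r] phi(3)[symmetric] ..
  have secB: "path_image c \<inter> ball z r \<union> B = sector z d' (2 * pi - \<phi>) r"
    using phi(2) r unfolding germ B_def by (subst sector_eq_rays) (auto simp: dd insert_commute)
  from I show thesis
  proof
    assume I: "?I \<inter> ball z r = A"
    then have "(path_image c \<union> ?I) \<inter> ball z r = sector z d \<phi> r" using secA by blast
    with that[of d \<phi>] d(1) phi phi0 I show thesis unfolding A_def by metis
  next
    assume I: "?I \<inter> ball z r = B"
    then have "(path_image c \<union> ?I) \<inter> ball z r = sector z d' (2 * pi - \<phi>) r" using secB by blast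
    moreover have "0 < 2 * pi - \<phi>" "2 * pi - \<phi> < 2 * pi" using phi phi0 by auto
    ultimately show thesis using that[of d' "2 * pi - \<phi>"] d(2) dd I unfolding B_def by metis
  qed
qed

section \<open>The region near a boundary point\<close>

abbreviation bd :: "hexagon \<Rightarrow> complex set" where
  "bd p \<equiv> path_image (boundary_path p)"

abbreviation open_region :: "hexagon \<Rightarrow> complex set" where
  "open_region p \<equiv> inside (bd p)"

lemma simple_hexagon_Jordan:
  assumes "simple_hexagon p"
  shows "open (open_region p)" "open_region p \<noteq> {}" "bounded (open_region p)" "open_region p \<inter> bd p = {}"
    "frontier (open_region p) = bd p" "open_region p \<union> outside (bd p) = - bd p" "open_region p \<inter> outside (bd p) = {}"
    "frontier (outside (bd p)) = bd p"
  using Jordan_inside_outside[of "boundary_path p"] assms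
  by (auto simp: simple_hexagon_def)

lemma closure_open_region:
  assumes "simple_hexagon p"
  shows "closure (open_region p) = region p"
proof -
  have "closure (open_region p) = open_region p \<union> frontier (open_region p)" by (simp add: closure_Un_frontier)
  then show ?thesis
    unfolding region_def simple_hexagon_Jordan(5)[OF assms] by blast
qed

lemma region_closed_bounded:
  assumes "simple_hexagon p"
  shows "closed (region p)" "bounded (region p)" "compact (region p)"
  using closure_open_region[OF assms, symmetric] simple_hexagon_Jordan(3)[OF assms]
  by (simp_all add: bounded_closure compact_eq_bounded_closed)

lemma open_region_subset: "open_region p \<subseteq> region p" and bd_subset_region: "bd p \<subseteq> region p"
  by (auto simp: region_def)

text \<open>By the Jordan curve theorem each point of the curve is also a limit of outside points,
  so an open subset of the region cannot touch the curve.\<close>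

lemma interior_region:
  assumes "simple_hexagon p"
  shows "interior (region p) = open_region p"
proof (rule interior_unique)
  show "open_region p \<subseteq> region p" "open (open_region p)"
    using open_region_subset simple_hexagon_Jordan[OF assms] by auto
  fix S assume S: "S \<subseteq> region p" "open S"
  have "S \<inter> bd p = {}"
  proof (rule ccontr)
    assume "S \<inter> bd p \<noteq> {}"
    then obtain z where z: "z \<in> S" "z \<in> bd p" by blast
    then have "z \<in> closure (outside (bd p))"
      using simple_hexagon_Jordan(8)[OF assms] by (auto simp: frontier_def)
    then have "S \<inter> outside (bd p) \<noteq> {}"
      using S(2) z(1) open_Int_closure_eq_empty[of S "outside (bd p)"] by blast
    moreover have "outside (bd p) \<inter> bd p = {}" by (auto simp: outside_def)
    ultimately show False
      using S(1) simple_hexagon_Jordan(7)[OF assms] unfolding region_def by blast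
  qed
  then show "S \<subseteq> open_region p" using S by (auto simp: region_def)
qed

lemma open_region_Int_region_empty:
  assumes "simple_hexagon p" "simple_hexagon q" "open_region p \<inter> open_region q = {}"
  shows "open_region p \<inter> region q = {}"
  using open_Int_closure_eq_empty[of "open_region p" "open_region q"] closure_open_region[OF assms(2)]
    simple_hexagon_Jordan(1)[OF assms(1)] assms(3) by auto

lemma corner_in_side [simp, intro]: "p i \<in> side p i" "p (i + 1) \<in> side p i" "p i \<in> side p (i - 1)"
  by (simp_all add: side_def)

lemma side_subset_bd: "side p i \<subseteq> bd p"
  by (auto simp: path_image_boundary_path)

lemma corner_in_region: "p i \<in> region p"
  using side_subset_bd[of p i] bd_subset_region[of p] by blast

lemma add_1_neq_6 [simp]: "i + 1 \<noteq> i" "i - 1 \<noteq> i" "i \<noteq> i + 1" "i \<noteq> i - 1" "i + 1 \<noteq> i - 1" "i - 1 \<noteq> i + 1" for i :: 6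
  using exhaust_6[of i] by auto

lemma corner_of_side:
  assumes "simple_hexagon p" "p i \<in> side p j"
  shows "j = i \<or> j + 1 = i"
proof (rule ccontr)
  assume j: "\<not> ?thesis"
  then have "i + 1 = j \<and> p i = p j"
    using simple_hexagon_corners_inj(2)[OF assms(1), of i j "p i"] assms(2) by auto
  then have "i = j" using simple_hexagon_corners_inj(1)[OF assms(1)] by (auto dest: injD)
  with j show False by simp
qed

lemma open_side_unique:
  assumes "simple_hexagon p" "z \<in> side p i" "z \<noteq> p i" "z \<noteq> p (i + 1)" "z \<in> side p j"
  shows "j = i"
  using simple_hexagon_corners_inj(2)[OF assms(1), of i j z] assms by auto

text \<open>The bounds of \<open>R\<close> by the two side lengths make the adjacent sides full
  radii of the disc, as \<open>segment_germ\<close> requires.\<close>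

lemma corner_isolated:
  assumes "simple_hexagon p"
  obtains R where "0 < R" "bd p \<inter> ball (p i) R \<subseteq> side p i \<union> side p (i - 1)"
    "R \<le> dist (p i) (p (i + 1))" "R \<le> dist (p i) (p (i - 1))"
proof -
  let ?K = "\<Union>j\<in>UNIV - {i, i - 1}. side p j"
  have "closed ?K" by (auto simp: side_def)
  moreover have "p i \<notin> ?K"
    using corner_of_side[OF assms, of i] by (fastforce simp: eq_diff_eq)
  ultimately obtain e where e: "e > 0" "ball (p i) e \<subseteq> - ?K"
    by (metis ComplI open_Compl openE)
  have ne: "p i \<noteq> p (i + 1)" "p i \<noteq> p (i - 1)"
    using simple_hexagon_corners_inj(1)[OF assms] by (auto simp: inj_eq)
  define R where "R = min e (min (dist (p i) (p (i + 1))) (dist (p i) (p (i - 1))))"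
  show thesis
  proof
    show "0 < R" using e ne by (auto simp: R_def)
    show "bd p \<inter> ball (p i) R \<subseteq> side p i \<union> side p (i - 1)"
    proof
      fix w assume w: "w \<in> bd p \<inter> ball (p i) R"
      then obtain j where j: "w \<in> side p j" by (auto simp: path_image_boundary_path)
      have "w \<in> ball (p i) e" using w by (auto simp: R_def)
      then show "w \<in> side p i \<union> side p (i - 1)" using e(2) j by blast
    qed
  qed (auto simp: R_def)
qed

lemma segment_germ:
  fixes a b :: complex
  assumes "a \<noteq> b" "r \<le> dist a b"
  shows "closed_segment a b \<inter> ball a r = {a + of_real s * sgn (b - a) | s. 0 \<le> s \<and> s < r}"
proof (intro set_eqI iffI)
  let ?l = "norm (b - a)"
  have l: "?l > 0" using assms by simp
  have sg: "of_real s * sgn (b - a) = of_real (s / ?l) * (b - a)" for s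
    by (simp add: sgn_div_norm scaleR_conv_of_real divide_inverse mult_ac)
  fix w
  show "w \<in> {a + of_real s * sgn (b - a) | s. 0 \<le> s \<and> s < r}" if w: "w \<in> closed_segment a b \<inter> ball a r"
  proof -
    obtain x where x: "w = a + of_real x * (b - a)" "0 \<le> x" "x \<le> 1"
      using w by (auto simp: in_segment algebra_simps scaleR_conv_of_real)
    have "dist a w = x * ?l" using x by (simp add: dist_norm norm_mult)
    then have "x * ?l < r" using w by simp
    moreover have "w = a + of_real (x * ?l) * sgn (b - a)" using l x by (simp add: sg)
    ultimately show ?thesis using x l by (intro CollectI exI[of _ "x * ?l"]) auto
  qed
  show "w \<in> closed_segment a b \<inter> ball a r" if w: "w \<in> {a + of_real s * sgn (b - a) | s. 0 \<le> s \<and> s < r}"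
  proof -
    obtain s where s: "w = a + of_real (s / ?l) * (b - a)" "0 \<le> s" "s < r" using w by (auto simp: sg)
    have "s / ?l \<le> 1" using s l assms by (simp add: dist_norm norm_minus_commute)
    then have "w \<in> closed_segment a b"
      unfolding in_segment using s l
      by (intro exI[of _ "s / ?l"]) (simp add: scaleR_conv_of_real ring_distribs)
    moreover have "dist a w = s" using s l assms(1) by (simp add: dist_norm norm_mult norm_divide)
    ultimately show ?thesis using s by simp
  qed
qed

text \<open>Asking for all radii up to \<open>R\<close> allows the sectors of several hexagons at
  one point to be compared in a common disc. Region and interior are both recorded because overlap
  arguments play the interior of one tile against the closed region of another.\<close>

definition has_sector :: "hexagon \<Rightarrow> complex \<Rightarrow> complex \<Rightarrow> real \<Rightarrow> bool" where
  "has_sector p z u \<theta> \<longleftrightarrow> norm u = 1 \<and> 0 < \<theta> \<and> \<theta> < 2 * pi \<and>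
     (\<exists>R>0. \<forall>r. r \<le> R \<longrightarrow> region p \<inter> ball z r = sector z u \<theta> r \<and> open_region p \<inter> ball z r = open_sector z u \<theta> r)"

lemma has_sectorI:
  assumes "norm u = 1" "0 < \<theta>" "\<theta> < 2 * pi" "0 < R"
    "region p \<inter> ball z R = sector z u \<theta> R" "open_region p \<inter> ball z R = open_sector z u \<theta> R"
  shows "has_sector p z u \<theta>"
proof -
  have "region p \<inter> ball z r = sector z u \<theta> r \<and> open_region p \<inter> ball z r = open_sector z u \<theta> r" if "r \<le> R" for r
  proof -
    have "ball z r = ball z R \<inter> ball z r" using that by auto
    then show ?thesis
      using sector_Int_ball[OF assms(1) that, of z \<theta>] open_sector_Int_ball[OF assms(1) that, of z \<theta>] assms(5,6)
      by (metis inf_assoc)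
  qed
  with assms show ?thesis unfolding has_sector_def by blast
qed

lemma has_sector_unique:
  assumes "has_sector p z u \<theta>" "norm u' = 1" "0 < \<theta>'" "\<theta>' < 2 * pi" "0 < r" "region p \<inter> ball z r = sector z u' \<theta>' r"
  shows "u = u'" "\<theta> = \<theta>'"
proof -
  obtain R where R: "R > 0" "\<And>r. r \<le> R \<Longrightarrow> region p \<inter> ball z r = sector z u \<theta> r"
    and u: "norm u = 1" "0 < \<theta>" "\<theta> < 2 * pi"
    using assms(1) unfolding has_sector_def by blast
  define s where "s = min r R"
  have s: "0 < s" "s \<le> r" "s \<le> R" using R assms by (auto simp: s_def)
  have "region p \<inter> ball z s = sector z u' \<theta>' s"
    using sector_Int_ball[OF assms(2) s(2), of z \<theta>'] assms(6) s(2)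
    by (metis inf.absorb_iff2 inf_assoc subset_ball)
  then have "sector z u \<theta> s = sector z u' \<theta>' s" using R(2)[OF s(3)] by simp
  then show "u = u'" "\<theta> = \<theta>'"
    using sector_unique[OF u(1) assms(2) u(2,3) assms(3,4) s(1)] by blast+
qed

lemma has_sector_interior_angle:
  assumes "has_sector p (p i) u \<theta>"
  shows "interior_angle p i = \<theta>"
  unfolding interior_angle_def
proof (rule the_equality, unfold sector_def[symmetric])
  obtain R where "R > 0" "region p \<inter> ball (p i) R = sector (p i) u \<theta> R"
    and "norm u = 1" "0 < \<theta>" "\<theta> < 2 * pi"
    using assms unfolding has_sector_def by blast
  then show "0 < \<theta> \<and> \<theta> < 2 * pi \<and>
    (\<exists>u r. norm u = 1 \<and> r > 0 \<and> region p \<inter> ball (p i) r = sector (p i) u \<theta> r)" by blast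
next
  fix \<theta>' assume "0 < \<theta>' \<and> \<theta>' < 2 * pi \<and>
    (\<exists>u r. norm u = 1 \<and> r > 0 \<and> region p \<inter> ball (p i) r = sector (p i) u \<theta>' r)"
  then show "\<theta>' = \<theta>" using has_sector_unique(2)[OF assms] by metis
qed

lemma norm_sgn_diff: "a \<noteq> b \<Longrightarrow> norm (sgn (b - a)) = 1" for a b :: complex
  by (simp add: norm_sgn)

lemma has_sector_boundary:
  assumes "simple_hexagon p" "norm d = 1" "norm d' = 1" "d \<noteq> d'" "0 < r"
    "bd p \<inter> ball z r = {z + of_real s * e | s e. 0 \<le> s \<and> s < r \<and> e \<in> {d, d'}}"
  obtains u \<theta> where "has_sector p z u \<theta>" "u = d \<and> u * cis \<theta> = d' \<or> u = d' \<and> u * cis \<theta> = d"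
proof -
  have "simple_path (boundary_path p)" "pathfinish (boundary_path p) = pathstart (boundary_path p)"
    using assms(1) by (auto simp: simple_hexagon_def)
  from sector_of_inside[OF this assms(2-6)]
  obtain u \<theta> where *: "norm u = 1" "0 < \<theta>" "\<theta> < 2 * pi"
    "u = d \<and> u * cis \<theta> = d' \<or> u = d' \<and> u * cis \<theta> = d"
    "(bd p \<union> open_region p) \<inter> ball z r = sector z u \<theta> r" "open_region p \<inter> ball z r = open_sector z u \<theta> r" .
  show thesis
    by (rule that[OF has_sectorI[OF *(1-3) assms(5) _ *(6)] *(4)]) (use *(5) in \<open>simp add: region_def\<close>)
qed

text \<open>Equal directions would make the two sides overlap: the point at half the shorter length
  lies on both and is not the corner.\<close>

lemma corner_directions_distinct:
  assumes "simple_hexagon p"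
  shows "sgn (p (i + 1) - p i) \<noteq> sgn (p (i - 1) - p i)"
proof
  assume eq: "sgn (p (i + 1) - p i) = sgn (p (i - 1) - p i)"
  have ne: "p i \<noteq> p (i + 1)" "p i \<noteq> p (i - 1)"
    using simple_hexagon_corners_inj(1)[OF assms] by (auto simp: inj_eq)
  define r where "r = min (dist (p i) (p (i + 1))) (dist (p i) (p (i - 1)))"
  have r: "0 < r" "r \<le> dist (p i) (p (i + 1))" "r \<le> dist (p i) (p (i - 1))" using ne by (auto simp: r_def)
  define w where "w = p i + of_real (r / 2) * sgn (p (i + 1) - p i)"
  have "w \<in> closed_segment (p i) (p (i + 1))"
  proof -
    have "w \<in> {p i + of_real s * sgn (p (i + 1) - p i) | s. 0 \<le> s \<and> s < r}"
      unfolding w_def using r(1) by (intro CollectI exI[of _ "r / 2"]) auto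
    then show ?thesis using segment_germ[OF ne(1) r(2)] by blast
  qed
  moreover have "w \<in> closed_segment (p i) (p (i - 1))"
  proof -
    have "w \<in> {p i + of_real s * sgn (p (i - 1) - p i) | s. 0 \<le> s \<and> s < r}"
      unfolding w_def eq using r(1) by (intro CollectI exI[of _ "r / 2"]) auto
    then show ?thesis using segment_germ[OF ne(2) r(3)] by blast
  qed
  ultimately have "w = p i"
    using simple_hexagon_corners_inj(2)[OF assms, of i "i - 1" w]
    by (auto simp: side_def closed_segment_commute)
  then show False using r ne by (auto simp: w_def sgn_zero_iff)
qed

text \<open>Which ray comes first counterclockwise depends on the orientation of the labelling,
  which is arbitrary; hence the disjunction.\<close>

lemma corner_has_sector:
  assumes "simple_hexagon p"
  obtains u \<theta> where "has_sector p (p i) u \<theta>"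
    "u = sgn (p (i + 1) - p i) \<and> u * cis \<theta> = sgn (p (i - 1) - p i) \<or>
     u = sgn (p (i - 1) - p i) \<and> u * cis \<theta> = sgn (p (i + 1) - p i)"
proof -
  have ne: "p i \<noteq> p (i + 1)" "p i \<noteq> p (i - 1)"
    using simple_hexagon_corners_inj(1)[OF assms] by (auto simp: inj_eq)
  obtain R where R: "0 < R" "bd p \<inter> ball (p i) R \<subseteq> side p i \<union> side p (i - 1)"
    "R \<le> dist (p i) (p (i + 1))" "R \<le> dist (p i) (p (i - 1))"
    using corner_isolated[OF assms] by metis
  have "bd p \<inter> ball (p i) R = (closed_segment (p i) (p (i + 1)) \<inter> ball (p i) R) \<union> (closed_segment (p i) (p (i -
      1)) \<inter> ball (p i) R)"
    using R(2) side_subset_bd[of p i] side_subset_bd[of p "i - 1"]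
    by (auto simp: side_def closed_segment_commute)
  then have "bd p \<inter> ball (p i) R = {p i + of_real s * e | s e. 0 \<le> s \<and> s < R \<and> e \<in> {sgn (p (i + 1) - p i), sgn (p
      (i - 1) - p i)}}"
    unfolding segment_germ[OF ne(1) R(3)] segment_germ[OF ne(2) R(4)] by blast
  from has_sector_boundary[OF assms norm_sgn_diff[OF ne(1)] norm_sgn_diff[OF ne(2)] corner_directions_distinct[OF
      assms] R(1) this]
  show thesis using that by blast
qed

lemma segment_inner_germ:
  fixes a b z :: complex
  assumes "z \<in> closed_segment a b" "z \<noteq> a" "z \<noteq> b" "r \<le> dist z a" "r \<le> dist z b"
  shows "closed_segment a b \<inter> ball z r = {z + of_real s * e | s e. 0 \<le> s \<and> s < r \<and> e \<in> {sgn (b - a), - sgn (b - a)}}"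
proof -
  obtain x where x: "z = a + of_real x * (b - a)" "0 \<le> x" "x \<le> 1"
    using assms(1) by (auto simp: in_segment algebra_simps scaleR_conv_of_real)
  have x01: "0 < x" "x < 1" using x assms(2,3) by (auto simp: less_le)
  have "b - z = of_real (1 - x) * (b - a)" "a - z = - (of_real x * (b - a))" using x by (auto simp: algebra_simps)
  then have "sgn (b - z) = sgn (b - a)" "sgn (a - z) = - sgn (b - a)"
    using x01 by (simp_all add: sgn_mult sgn_of_real sgn_minus del: of_real_diff)
  moreover have "closed_segment a b = closed_segment z a \<union> closed_segment z b"
    using Un_closed_segment[OF assms(1)] by (simp add: closed_segment_commute)
  ultimately have "closed_segment a b \<inter> ball z r = {z + of_real s * - sgn (b - a) | s. 0 \<le> s \<and> s < r} \<union> {z +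
      of_real s * sgn (b - a) | s. 0 \<le> s \<and> s < r}"
    using segment_germ[OF assms(2) assms(4)] segment_germ[OF assms(3) assms(5)] by (simp add: Int_Un_distrib2)
  then show ?thesis by blast
qed

lemma cis_eq_minus_1D: "0 < t \<Longrightarrow> t < 2 * pi \<Longrightarrow> cis t = - 1 \<Longrightarrow> t = pi"
  using cis_inj_2pi[of t pi] by simp

lemma edge_has_sector:
  assumes "simple_hexagon p" "z \<in> side p i" "z \<noteq> p i" "z \<noteq> p (i + 1)"
  obtains u where "has_sector p z u pi" "u = sgn (p (i + 1) - p i) \<or> u = - sgn (p (i + 1) - p i)"
proof -
  let ?K = "\<Union>j\<in>UNIV - {i}. side p j" and ?d = "sgn (p (i + 1) - p i)"
  have "closed ?K" by (auto simp: side_def)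
  moreover have "z \<notin> ?K" using open_side_unique[OF assms] by auto
  ultimately obtain e where e: "e > 0" "ball z e \<subseteq> - ?K" by (metis ComplI open_Compl openE)
  define R where "R = min e (min (dist z (p i)) (dist z (p (i + 1))))"
  have R: "0 < R" "R \<le> dist z (p i)" "R \<le> dist z (p (i + 1))" "R \<le> e" using e assms by (auto simp: R_def)
  have "bd p = side p i \<union> ?K" by (auto simp: path_image_boundary_path)
  then have "bd p \<inter> ball z R = closed_segment (p i) (p (i + 1)) \<inter> ball z R"
    using e(2) R(4) subset_ball[OF R(4)] unfolding side_def by blast
  also have "\<dots> = {z + of_real s * e | s e. 0 \<le> s \<and> s < R \<and> e \<in> {?d, - ?d}}"
    by (rule segment_inner_germ) (use assms R in \<open>auto simp: side_def\<close>)
  finally have germ: "bd p \<inter> ball z R = {z + of_real s * e | s e. 0 \<le> s \<and> s < R \<and> e \<in> {?d, - ?d}}" .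
  have "p i \<noteq> p (i + 1)" using simple_hexagon_corners_inj(1)[OF assms(1)] by (auto simp: inj_eq)
  then have d: "norm ?d = 1" "norm (- ?d) = 1" "?d \<noteq> - ?d" by (auto simp: norm_sgn sgn_zero_iff)
  obtain u \<theta> where u: "has_sector p z u \<theta>" "u = ?d \<and> u * cis \<theta> = - ?d \<or> u = - ?d \<and> u * cis \<theta> = ?d"
    using has_sector_boundary[OF assms(1) d R(1) germ] .
  have "?d \<noteq> 0" using d by auto
  then have "cis \<theta> = - 1"
    using u(2) by (metis minus_mult_minus mult.right_neutral mult_cancel_left mult_minus_right neg_equal_0_iff_equal)
  moreover have "0 < \<theta>" "\<theta> < 2 * pi" using u(1) by (auto simp: has_sector_def)
  ultimately have "\<theta> = pi" using cis_eq_minus_1D by blast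
  with u that show thesis by blast
qed

section \<open>Tiles sharing a side or a vertex\<close>

lemma plane_isometry_image_ball:
  assumes "plane_isometry f"
  shows "f ` ball z r = ball (f z) r"
proof -
  have "w \<in> f ` ball z r" if "dist (f z) w < r" for w
  proof -
    obtain v where "w = f v" using assms unfolding plane_isometry_def by (metis surjD)
    with that assms show ?thesis by (auto simp: plane_isometry_def)
  qed
  then show ?thesis using assms by (auto simp: plane_isometry_def)
qed

lemma sector_image_direct:
  "(\<lambda>z. A * z + B) ` sector z u \<theta> r = sector (A * z + B) (A * u) \<theta> r"
  "(\<lambda>z. A * z + B) ` open_sector z u \<theta> r = open_sector (A * z + B) (A * u) \<theta> r"
proof -
  have *: "(A * z + B) + of_real s * (A * u) * cis t = A * (z + of_real s * u * cis t) + B" for s t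
    by (simp add: algebra_simps)
  show "(\<lambda>z. A * z + B) ` sector z u \<theta> r = sector (A * z + B) (A * u) \<theta> r"
    "(\<lambda>z. A * z + B) ` open_sector z u \<theta> r = open_sector (A * z + B) (A * u) \<theta> r"
    unfolding sector_def open_sector_def * by blast+
qed

text \<open>A reflection reverses the sense of rotation, so the last ray
  \<open>u * cis \<theta>\<close> is mapped to the first one and the angle \<open>t\<close> becomes
  \<open>\<theta> - t\<close>.\<close>

lemma sector_image_opposite:
  "(\<lambda>z. A * cnj z + B) ` sector z u \<theta> r = sector (A * cnj z + B) (A * cnj (u * cis \<theta>)) \<theta> r"
  "(\<lambda>z. A * cnj z + B) ` open_sector z u \<theta> r = open_sector (A * cnj z + B) (A * cnj (u * cis \<theta>)) \<theta> r"
proof -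
  have *: "A * cnj (z + of_real s * u * cis t) + B = (A * cnj z + B) + of_real s * (A * cnj (u * cis \<theta>)) * cis (\<theta>
      - t)" for s t
  proof -
    have "cnj (cis t) = cnj (cis \<theta>) * cis (\<theta> - t)" by (simp add: cis_cnj cis_mult)
    then show ?thesis by (simp add: algebra_simps)
  qed
  have 1: "(\<exists>s t. 0 \<le> s \<and> s < r \<and> 0 \<le> t \<and> t \<le> \<theta> \<and> Q s (\<theta> - t)) \<longleftrightarrow> (\<exists>s t. 0 \<le> s \<and> s < r \<and> 0 \<le> t \<and> t \<le> \<theta> \<and> Q s t)"
    and 2: "(\<exists>s t. 0 < s \<and> s < r \<and> 0 < t \<and> t < \<theta> \<and> Q s (\<theta> - t)) \<longleftrightarrow> (\<exists>s t. 0 < s \<and> s < r \<and> 0 < t \<and> t < \<theta> \<and> Q s t)"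
    for Q :: "real \<Rightarrow> real \<Rightarrow> bool"
  proof -
    have e: "t = \<theta> - (\<theta> - t)" for t by simp
    have r: "0 \<le> t \<and> t \<le> \<theta> \<longleftrightarrow> 0 \<le> \<theta> - t \<and> \<theta> - t \<le> \<theta>" "0 < t \<and> t < \<theta> \<longleftrightarrow> 0 < \<theta> - t \<and> \<theta> - t < \<theta>" for t by auto
    show "(\<exists>s t. 0 \<le> s \<and> s < r \<and> 0 \<le> t \<and> t \<le> \<theta> \<and> Q s (\<theta> - t)) \<longleftrightarrow> (\<exists>s t. 0 \<le> s \<and> s < r \<and> 0 \<le> t \<and> t \<le> \<theta> \<and> Q s t)"
      using r(1) by (metis e)
    show "(\<exists>s t. 0 < s \<and> s < r \<and> 0 < t \<and> t < \<theta> \<and> Q s (\<theta> - t)) \<longleftrightarrow> (\<exists>s t. 0 < s \<and> s < r \<and> 0 < t \<and> t < \<theta> \<and> Q s t)"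
      using r(2) by (metis e)
  qed
  show "(\<lambda>z. A * cnj z + B) ` sector z u \<theta> r = sector (A * cnj z + B) (A * cnj (u * cis \<theta>)) \<theta> r"
  proof (rule set_eqI)
    fix w
    have "w \<in> (\<lambda>z. A * cnj z + B) ` sector z u \<theta> r \<longleftrightarrow>
      (\<exists>s t. 0 \<le> s \<and> s < r \<and> 0 \<le> t \<and> t \<le> \<theta> \<and> w = (A * cnj z + B) + of_real s * (A * cnj (u * cis \<theta>)) * cis (\<theta> - t))"
      unfolding sector_def *[symmetric] by blast
    also have "\<dots> \<longleftrightarrow> w \<in> sector (A * cnj z + B) (A * cnj (u * cis \<theta>)) \<theta> r"
      unfolding 1[of "\<lambda>s t. w = (A * cnj z + B) + of_real s * (A * cnj (u * cis \<theta>)) * cis t"] sector_def by blast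
    finally show "w \<in> (\<lambda>z. A * cnj z + B) ` sector z u \<theta> r \<longleftrightarrow> w \<in> sector (A * cnj z + B) (A * cnj (u * cis \<theta>)) \<theta> r" .
  qed
  show "(\<lambda>z. A * cnj z + B) ` open_sector z u \<theta> r = open_sector (A * cnj z + B) (A * cnj (u * cis \<theta>)) \<theta> r"
  proof (rule set_eqI)
    fix w
    have "w \<in> (\<lambda>z. A * cnj z + B) ` open_sector z u \<theta> r \<longleftrightarrow>
      (\<exists>s t. 0 < s \<and> s < r \<and> 0 < t \<and> t < \<theta> \<and> w = (A * cnj z + B) + of_real s * (A * cnj (u * cis \<theta>)) * cis (\<theta> - t))"
      unfolding open_sector_def *[symmetric] by blast
    also have "\<dots> \<longleftrightarrow> w \<in> open_sector (A * cnj z + B) (A * cnj (u * cis \<theta>)) \<theta> r"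
      unfolding 2[of "\<lambda>s t. w = (A * cnj z + B) + of_real s * (A * cnj (u * cis \<theta>)) * cis t"] open_sector_def by blast
    finally show "w \<in> (\<lambda>z. A * cnj z + B) ` open_sector z u \<theta> r \<longleftrightarrow> w \<in> open_sector (A * cnj z + B) (A * cnj (u *
        cis \<theta>)) \<theta> r" .
  qed
qed

lemma has_sector_plane_isometry:
  assumes "plane_isometry f" "has_sector p z u \<theta>"
  obtains u' where "has_sector (f \<circ> p) (f z) u' \<theta>"
proof -
  obtain u' where u': "norm u' = 1" "\<And>r. f ` sector z u \<theta> r = sector (f z) u' \<theta> r"
    "\<And>r. f ` open_sector z u \<theta> r = open_sector (f z) u' \<theta> r"
    using assms(1)
  proof (cases rule: plane_isometry_cases)
    case (1 A B)
    then show thesis using that[of "A * u"] assms(2)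
      by (simp add: sector_image_direct norm_mult has_sector_def)
  next
    case (2 A B)
    then show thesis using that[of "A * cnj (u * cis \<theta>)"] assms(2)
      by (simp add: sector_image_opposite norm_mult has_sector_def del: complex_cnj_mult)
  qed
  obtain R where R: "R > 0" "region p \<inter> ball z R = sector z u \<theta> R" "open_region p \<inter> ball z R = open_sector z u \<theta> R"
    and u: "0 < \<theta>" "\<theta> < 2 * pi"
    using assms(2) unfolding has_sector_def by blast
  have inj: "inj f" using plane_isometry_bij[OF assms(1)] by (simp add: bij_def)
  have "region (f \<circ> p) \<inter> ball (f z) R = f ` (region p \<inter> ball z R)"
    by (simp add: region_plane_isometry[OF assms(1)] image_Int[OF inj] plane_isometry_image_ball[OF assms(1)])
  moreover have "open_region (f \<circ> p) \<inter> ball (f z) R = f ` (open_region p \<inter> ball z R)"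
    by (simp add: path_image_plane_isometry[OF assms(1)] inside_plane_isometry[OF assms(1)] image_Int[OF inj]
        plane_isometry_image_ball[OF assms(1)])
  ultimately show thesis
    using that[OF has_sectorI[OF u'(1) u R(1)]] R(2,3) u'(2,3) by metis
qed

lemma interior_angle_plane_isometry:
  assumes "plane_isometry f" "simple_hexagon p"
  shows "interior_angle (f \<circ> p) i = interior_angle p i"
proof -
  obtain u \<theta> where u: "has_sector p (p i) u \<theta>" using corner_has_sector[OF assms(2)] by metis
  then obtain u' where "has_sector (f \<circ> p) ((f \<circ> p) i) u' \<theta>"
    using has_sector_plane_isometry[OF assms(1)] by (metis comp_apply)
  with u show ?thesis using has_sector_interior_angle by metis
qed

lemma side_length_plane_isometry: "plane_isometry f \<Longrightarrow> side_length (f \<circ> p) i = side_length p i"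
  by (simp add: side_length_def plane_isometry_def)

lemma half_discs_cover: "norm u = 1 \<Longrightarrow> ball z r \<subseteq> sector z u pi r \<union> sector z (- u) pi r"
proof
  fix w assume u: "norm u = 1" and w: "w \<in> ball z r"
  show "w \<in> sector z u pi r \<union> sector z (- u) pi r"
  proof (cases "w = z")
    case True
    then show ?thesis using w unfolding sector_def by (auto intro!: exI[of _ 0])
  next
    case False
    then obtain s t where *: "s = dist z w" "0 < s" "0 \<le> t" "t < 2 * pi" "w = z + of_real s * u * cis t"
      using polar_cases[OF u] by metis
    show ?thesis
    proof (cases "t \<le> pi")
      case True
      then show ?thesis using * w unfolding sector_def by fastforce
    next
      case False
      have "w = z + of_real s * (- u) * cis (t - pi)" using *(5) by (simp add: cis_divide[symmetric])
      moreover have "0 \<le> s" "s < r" "0 \<le> t - pi" "t - pi \<le> pi" using False * w by auto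
      ultimately have "w \<in> sector z (- u) pi r" unfolding sector_def by blast
      then show ?thesis by blast
    qed
  qed
qed

lemma open_sector_nonempty:
  assumes "0 < \<theta>" "0 < r"
  shows "open_sector z u \<theta> r \<noteq> {}"
proof -
  have "0 < r / 2" "r / 2 < r" "0 < \<theta> / 2" "\<theta> / 2 < \<theta>" using assms by auto
  then show ?thesis unfolding open_sector_def by blast
qed

text \<open>Near an inner point of a side each hexagon is a half disc bounded by the same line. The
  same half disc twice would make the interiors overlap, so the two are opposite and fill the
  disc.\<close>

lemma shared_side_cover:
  assumes p: "simple_hexagon p" and q: "simple_hexagon q" and disj: "open_region p \<inter> open_region q = {}"
    and side: "side p i = side q j" and z: "z \<in> side p i" "z \<noteq> p i" "z \<noteq> p (i + 1)"
  obtains r where "0 < r" "ball z r \<subseteq> region p \<union> region q"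
proof -
  have ends: "{q j, q (j + 1)} = {p i, p (i + 1)}" using side by (simp add: side_def)
  let ?d = "sgn (p (i + 1) - p i)"
  obtain u where u: "has_sector p z u pi" "u = ?d \<or> u = - ?d" using edge_has_sector[OF p z] by metis
  have "z \<in> side q j" "z \<noteq> q j" "z \<noteq> q (j + 1)" using ends z side by auto
  then obtain v where v: "has_sector q z v pi" "v = sgn (q (j + 1) - q j) \<or> v = - sgn (q (j + 1) - q j)"
    using edge_has_sector[OF q] by metis
  have "sgn (q (j + 1) - q j) = ?d \<or> sgn (q (j + 1) - q j) = - ?d"
    using ends by (metis doubleton_eq_iff minus_diff_eq sgn_minus)
  then have v': "v = u \<or> v = - u" using u(2) v(2) by auto
  obtain R where R: "R > 0" "\<And>r. r \<le> R \<Longrightarrow> region p \<inter> ball z r = sector z u pi r \<and> open_region p \<inter> ball z r =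
      open_sector z u pi r"
    and nu: "norm u = 1"
    using u(1) unfolding has_sector_def by blast
  obtain R' where R': "R' > 0" "\<And>r. r \<le> R' \<Longrightarrow> region q \<inter> ball z r = sector z v pi r \<and> open_region q \<inter> ball z r =
      open_sector z v pi r"
    using v(1) unfolding has_sector_def by blast
  define r where "r = min R R'"
  have r: "0 < r" "r \<le> R" "r \<le> R'" using R R' by (auto simp: r_def)
  have "v \<noteq> u"
  proof
    assume "v = u"
    then have "open_sector z u pi r \<subseteq> open_region p \<inter> open_region q" using R(2)[OF r(2)] R'(2)[OF r(3)] by blast
    then show False using open_sector_nonempty[of pi r z u] r disj by auto
  qed
  then have "v = - u" using v' by simp
  then have "ball z r \<subseteq> region p \<union> region q" using half_discs_cover[OF nu, of z r] R(2)[OF r(2)] R'(2)[OF r(3)] by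
      blast
  with r that show thesis by blast
qed

text \<open>
  In a punctured disc around the vertex the union of the tiles is relatively closed, and it is relatively open
  because both sides of every edge are covered; the punctured disc is connected.
\<close>

lemma vertex_cover:
  assumes "finite F" "F \<noteq> {}" and simple: "\<And>q. q \<in> F \<Longrightarrow> simple_hexagon q"
    and disj: "\<And>q q'. q \<in> F \<Longrightarrow> q' \<in> F \<Longrightarrow> q \<noteq> q' \<Longrightarrow> open_region q \<inter> open_region q' = {}"
    and corner: "\<And>q. q \<in> F \<Longrightarrow> \<exists>i. v = q i \<and> (\<forall>j\<in>{i, i - 1}. \<exists>q'\<in>F. q' \<noteq> q \<and> side q j \<in> sides q')"
  obtains r where "0 < r" "ball v r \<subseteq> \<Union>(region ` F)"
proof -
  \<comment> \<open>Close to \<open>v\<close>, every boundary point of \<open>q\<close> other than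
    \<open>v\<close> is an inner point of one of the two sides ending at \<open>v\<close>, and these
    sides are shared, so \<open>shared_side_cover\<close> applies there.\<close>
  have "\<exists>R>0. \<forall>w. w \<in> bd q \<longrightarrow> w \<noteq> v \<longrightarrow> dist v w < R \<longrightarrow>
      (\<exists>j. w \<in> side q j \<and> w \<noteq> q j \<and> w \<noteq> q (j + 1) \<and> (\<exists>q'\<in>F. q' \<noteq> q \<and> side q j \<in> sides q'))" if q: "q \<in> F" for q
  proof -
    obtain i where i: "v = q i" "\<forall>j\<in>{i, i - 1}. \<exists>q'\<in>F. q' \<noteq> q \<and> side q j \<in> sides q'" using corner[OF q] by metis
    obtain R where R: "0 < R" "bd q \<inter> ball (q i) R \<subseteq> side q i \<union> side q (i - 1)"
      "R \<le> dist (q i) (q (i + 1))" "R \<le> dist (q i) (q (i - 1))" using corner_isolated[OF simple[OF q]] by metis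
    show ?thesis
    proof (intro exI[of _ R] conjI allI impI R(1))
      fix w assume w: "w \<in> bd q" "w \<noteq> v" "dist v w < R"
      then have "w \<in> side q i \<union> side q (i - 1)" using R(2) i(1) by auto
      moreover have "w \<noteq> q i" "w \<noteq> q (i + 1)" "w \<noteq> q (i - 1)" using w R(3,4) i(1) by auto
      ultimately show "\<exists>j. w \<in> side q j \<and> w \<noteq> q j \<and> w \<noteq> q (j + 1) \<and> (\<exists>q'\<in>F. q' \<noteq> q \<and> side q j \<in> sides q')"
        using i(2) by (metis UnE diff_add_cancel insertCI)
    qed
  qed
  then obtain R where R: "\<And>q. q \<in> F \<Longrightarrow> 0 < R q"
    "\<And>q w. q \<in> F \<Longrightarrow> w \<in> bd q \<Longrightarrow> w \<noteq> v \<Longrightarrow> dist v w < R q \<Longrightarrow>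
      (\<exists>j. w \<in> side q j \<and> w \<noteq> q j \<and> w \<noteq> q (j + 1) \<and> (\<exists>q'\<in>F. q' \<noteq> q \<and> side q j \<in> sides q'))"
    by metis
  define r where "r = Min (R ` F)"
  have r: "0 < r" "\<And>q. q \<in> F \<Longrightarrow> r \<le> R q" using assms(1,2) R(1) by (auto simp: r_def)
  define U where "U = \<Union>(region ` F)"
  have U: "closed U" unfolding U_def using assms(1) simple region_closed_bounded by auto
  have "w \<in> interior U" if w: "w \<in> ball v r - {v}" "w \<in> U" for w
  proof -
    obtain q where q: "q \<in> F" "w \<in> region q" using w(2) by (auto simp: U_def)
    show ?thesis
    proof (cases "w \<in> open_region q")
      case True
      moreover have "open_region q \<subseteq> U" using q(1) open_region_subset by (auto simp: U_def)
      ultimately show ?thesis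
        using simple_hexagon_Jordan(1)[OF simple[OF q(1)]] interior_maximal by blast
    next
      case False
      then have "w \<in> bd q" using q(2) by (simp add: region_def)
      moreover have "dist v w < R q" "w \<noteq> v" using w(1) r(2)[OF q(1)] by auto
      ultimately obtain j q' where j: "w \<in> side q j" "w \<noteq> q j" "w \<noteq> q (j + 1)" "q' \<in> F" "q' \<noteq> q" "side q j \<in> sides q'"
        using R(2)[OF q(1)] by metis
      then obtain k where "side q j = side q' k" by (auto simp: sides_def)
      then obtain s where "0 < s" "ball w s \<subseteq> region q \<union> region q'"
        using shared_side_cover[OF simple[OF q(1)] simple[OF j(4)] disj[OF q(1) j(4)] _ j(1-3)] j(5) by metis
      moreover have "region q \<union> region q' \<subseteq> U" using q(1) j(4) by (auto simp: U_def)
      ultimately show ?thesis by (meson centre_in_ball interior_maximal open_ball order_trans subsetD)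
    qed
  qed
  then have cov: "ball v r - {v} \<subseteq> interior U \<union> - U" by blast
  have "connected (ball v r - {v})" by (rule connected_punctured_ball) simp
  moreover have "interior U \<inter> - U \<inter> (ball v r - {v}) = {}" using interior_subset by blast
  ultimately have "interior U \<inter> (ball v r - {v}) = {} \<or> - U \<inter> (ball v r - {v}) = {}"
    using connectedD[OF _ open_interior open_Compl[OF U] _ cov] by blast
  moreover have "interior U \<inter> (ball v r - {v}) \<noteq> {}"
  proof -
    obtain q where q: "q \<in> F" using assms(2) by blast
    then obtain i where i: "v = q i" using corner by blast
    then have "v \<in> bd q" using side_subset_bd[of q i] by auto
    moreover have "v \<in> closure (open_region q)"
      using corner_in_region[of q i] closure_open_region[OF simple[OF q]] i by simp
    ultimately obtain w where "w \<in> open_region q" "w \<in> ball v r" "w \<noteq> v"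
      using closure_meets_ball[OF _ r(1)] simple_hexagon_Jordan(4)[OF simple[OF q]] by blast
    moreover have "open_region q \<subseteq> interior U"
      using q simple_hexagon_Jordan(1)[OF simple[OF q]] open_region_subset
      by (intro interior_maximal) (auto simp: U_def)
    ultimately show ?thesis by blast
  qed
  ultimately have "ball v r - {v} \<subseteq> U" by blast
  moreover have "v \<in> U"
  proof -
    obtain q i where "q \<in> F" "v = q i" using assms(2) corner by blast
    then show ?thesis using corner_in_region[of q i] by (auto simp: U_def)
  qed
  ultimately have "ball v r \<subseteq> U" by blast
  with that[OF r(1)] show thesis unfolding U_def by blast
qed

section \<open>Winding numbers\<close>

abbreviation wn :: "complex \<Rightarrow> complex \<Rightarrow> complex \<Rightarrow> complex" where
  "wn a b z \<equiv> winding_number (linepath a b) z"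

lemma wn_reverse: "z \<notin> closed_segment a b \<Longrightarrow> wn b a z = - wn a b z"
  using winding_number_reversepath[of "linepath a b" z] by simp

text \<open>A sum over edges instead of the winding number of a closed path, so that edges can be
  regrouped between triangles by plain addition.\<close>

definition wn_triangle :: "complex \<Rightarrow> complex \<Rightarrow> complex \<Rightarrow> complex \<Rightarrow> complex" where
  "wn_triangle a b c z = wn a b z + wn b c z + wn c a z"

lemma wn_triangle_eq:
  assumes "z \<notin> closed_segment a b" "z \<notin> closed_segment b c" "z \<notin> closed_segment c a"
  shows "wn_triangle a b c z = winding_number (linepath a b +++ linepath b c +++ linepath c a) z"
  using assms by (simp add: wn_triangle_def winding_number_join path_image_join)

lemma wn_triangle_outside:
  assumes "z \<notin> convex hull {a, b, c}"
  shows "wn_triangle a b c z = 0"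
proof -
  have "closed_segment a b \<subseteq> convex hull {a, b, c}" "closed_segment b c \<subseteq> convex hull {a, b, c}"
    "closed_segment c a \<subseteq> convex hull {a, b, c}"
    by (auto simp: segment_convex_hull intro!: hull_mono)
  with assms have *: "z \<notin> closed_segment a b" "z \<notin> closed_segment b c" "z \<notin> closed_segment c a"
    and sub: "path_image (linepath a b +++ linepath b c +++ linepath c a) \<subseteq> convex hull {a, b, c}"
    by (auto simp: path_image_join)
  show ?thesis unfolding wn_triangle_eq[OF *]
    by (rule winding_number_zero_outside[OF _ convex_convex_hull _ assms sub]) auto
qed

text \<open>Twice the signed area of the triangle.\<close>

definition orient :: "complex \<Rightarrow> complex \<Rightarrow> complex \<Rightarrow> real" where
  "orient a b c = Im (cnj (b - a) * (c - a))"

lemma not_collinear_orient: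
  assumes "orient a b c \<noteq> 0"
  shows "\<not> collinear {a, b, c}"
proof
  assume "collinear {a, b, c}"
  then obtain u where u: "\<And>x y. x \<in> {a, b, c} \<Longrightarrow> y \<in> {a, b, c} \<Longrightarrow> \<exists>k. x - y = k *\<^sub>R u"
    unfolding collinear_def by blast
  obtain k l where "b - a = k *\<^sub>R u" "c - a = l *\<^sub>R u" using u[of b a] u[of c a] by auto
  with assms show False by (simp add: orient_def)
qed

lemma wn_triangle_inside:
  assumes "orient a b c \<noteq> 0" "0 < x" "0 < y" "0 < w" "x + y + w = 1"
    "z = of_real x * a + of_real y * b + of_real w * c"
  shows "wn_triangle a b c z = of_real (sgn (orient a b c))"
proof -
  have z: "z \<in> interior (convex hull {a, b, c})"
    unfolding interior_convex_hull_3_minimal[OF not_collinear_orient[OF assms(1)] DIM_complex]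
    by (intro CollectI exI[of _ x] exI[of _ y] exI[of _ w]) (use assms in \<open>simp add: scaleR_conv_of_real\<close>)
  then have *: "z \<notin> closed_segment a b" "z \<notin> closed_segment b c" "z \<notin> closed_segment c a"
    using interior_of_triangle[of a b c] by auto
  \<comment> \<open>The left side is the quantity whose sign decides
    \<open>winding_number_triangle\<close>; it is the barycentric weight of \<open>c\<close> times
    the orientation.\<close>
  have "Im ((b - a) * cnj (b - z)) = w * orient a b c"
  proof -
    have y: "y = 1 - x - w" using assms by simp
    have "b - z = of_real x * (b - a) + of_real w * ((b - a) - (c - a))"
      unfolding assms(6) y by (simp add: algebra_simps)
    then show ?thesis
      by (simp only:) (simp add: orient_def algebra_simps)
  qed
  then have "0 < Im ((b - a) * cnj (b - z)) \<longleftrightarrow> 0 < orient a b c" using assms by (simp add: zero_less_mult_iff)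
  then show ?thesis unfolding wn_triangle_eq[OF *] winding_number_triangle[OF z]
    using assms(1) by (auto simp: sgn_real_def)
qed

lemma winding_number_boundary_path:
  assumes "z \<notin> bd p"
  shows "winding_number (boundary_path p) z = (\<Sum>i\<in>UNIV. wn (p i) (p (i + 1)) z)"
proof -
  have *: "z \<notin> side p i" for i using assms by (auto simp: path_image_boundary_path)
  have "z \<notin> closed_segment (p 0) (p 1)" "z \<notin> closed_segment (p 1) (p 2)" "z \<notin> closed_segment (p 2) (p 3)"
    "z \<notin> closed_segment (p 3) (p 4)" "z \<notin> closed_segment (p 4) (p 5)" "z \<notin> closed_segment (p 5) (p 0)"
    using *[of 0] *[of 1] *[of 2] *[of 3] *[of 4] *[of 5] by (simp_all add: side_def)
  then show ?thesis
    unfolding boundary_path_def UNIV_6 by (simp add: winding_number_join path_image_join)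
qed

lemma primitive_cube_root:
  assumes "\<omega>\<^sup>2 + \<omega> + 1 = (0::complex)"
  shows "\<omega> ^ 3 = 1" "norm \<omega> = 1" "Im \<omega> \<noteq> 0" "Re \<omega> = - 1 / 2" "cnj \<omega> = \<omega>\<^sup>2"
proof -
  show 3: "\<omega> ^ 3 = 1" using assms by algebra
  have "norm \<omega> ^ 3 = 1" using 3 by (simp flip: norm_power)
  then show n: "norm \<omega> = 1" using power_eq_iff_eq_base[of 3 "norm \<omega>" 1] by simp
  have "Re (\<omega>\<^sup>2 + \<omega> + 1) = 0" "Im (\<omega>\<^sup>2 + \<omega> + 1) = 0" using assms by simp_all
  then have e: "(Re \<omega>)\<^sup>2 - (Im \<omega>)\<^sup>2 + Re \<omega> + 1 = 0" "Im \<omega> * (2 * Re \<omega> + 1) = 0"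
    by (simp_all add: power2_eq_square algebra_simps)
  show i: "Im \<omega> \<noteq> 0"
  proof
    assume "Im \<omega> = 0"
    then have "(Re \<omega> + 1 / 2)\<^sup>2 + 3 / 4 = 0" using e(1) by (simp add: power2_eq_square algebra_simps)
    then show False using zero_le_power2[of "Re \<omega> + 1 / 2"] by linarith
  qed
  with e(2) show "Re \<omega> = - 1 / 2" by auto
  have "\<omega> * cnj \<omega> = 1" using n by (simp add: complex_norm_square[symmetric])
  also have "1 = \<omega> * \<omega>\<^sup>2" using 3 by (simp add: power3_eq_cube power2_eq_square mult.assoc)
  finally show "cnj \<omega> = \<omega>\<^sup>2" using i by (metis mult_cancel_left zero_complex.simps(2))
qed

lemma omega_real_combination:
  assumes "\<omega>\<^sup>2 + \<omega> + 1 = (0::complex)" "of_real x + of_real y * \<omega> = 0"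
  shows "x = 0" "y = 0"
proof -
  have "Im (of_real x + of_real y * \<omega>) = 0" using assms(2) by simp
  then show "y = 0" using primitive_cube_root(3)[OF assms(1)] by simp
  then show "x = 0" using assms(2) by simp
qed

lemma cis_third: "(cis (2 / 3 * pi))\<^sup>2 + cis (2 / 3 * pi) + 1 = 0" "(cis (- (2 / 3 * pi)))\<^sup>2 + cis (- (2 / 3 *
    pi)) + 1 = 0"
  "1 + cis (2 / 3 * pi) = cis (pi / 3)"
proof -
  have c: "cos (2 * pi / 3) = - 1 / 2" "sin (2 * pi / 3) = sqrt 3 / 2" using cos_120 sin_120 by simp_all
  show "(cis (2 / 3 * pi))\<^sup>2 + cis (2 / 3 * pi) + 1 = 0" "(cis (- (2 / 3 * pi)))\<^sup>2 + cis (- (2 / 3 * pi)) + 1 = 0"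
    by (simp_all add: complex_eq_iff c power2_eq_square)
  show "1 + cis (2 / 3 * pi) = cis (pi / 3)"
    by (simp add: complex_eq_iff c cos_60 sin_60)
qed

text \<open>
  Cutting off the corner changes the curve by a triangle and leaves a curve avoiding the corner, so the
  jump of the winding number across the corner is that of the triangle.
\<close>

lemma winding_number_at_corner:
  assumes p: "simple_hexagon p" and \<omega>: "\<omega>\<^sup>2 + \<omega> + 1 = 0"
    and turn: "p (j - 1) - p j = \<omega> * (p (j + 1) - p j)"
    and sector: "has_sector p (p j) u (2 / 3 * pi)"
    and u: "(1 + \<omega>) * (p (j + 1) - p j) = of_real (norm (p (j + 1) - p j)) * u * cis (pi / 3)"
    and z: "z \<in> open_region p"
  shows "winding_number (boundary_path p) z = of_real (sgn (Im \<omega>))"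
proof -
  define a b c e where "a = p (j - 1)" and "b = p j" and "c = p (j + 1)" and "e = p (j + 1) - p j"
  have ne: "e \<noteq> 0" using simple_hexagon_corners_inj(1)[OF p] by (auto simp: e_def inj_eq)
  have a: "a = b + \<omega> * e" and c: "c = b + e" using turn by (simp_all add: a_def b_def c_def e_def algebra_simps)
  have or: "orient a b c = (norm e)\<^sup>2 * Im \<omega>"
  proof -
    have "cnj (b - a) * (c - a) = - (e * cnj e) * (cnj \<omega> - \<omega> * cnj \<omega>)" by (simp add: a c algebra_simps)
    also have "\<omega> * cnj \<omega> = 1" using primitive_cube_root(2)[OF \<omega>] by (simp add: complex_norm_square[symmetric])
    also have "e * cnj e = of_real ((norm e)\<^sup>2)" by (rule complex_norm_square[symmetric])
    finally show ?thesis by (simp add: orient_def)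
  qed
  define \<epsilon> where "\<epsilon> = winding_number (boundary_path p) z"
  have eps: "winding_number (boundary_path p) w = \<epsilon>" if "w \<in> open_region p" for w
    using simple_closed_path_winding_number_inside[of "boundary_path p"] p z that
    unfolding simple_hexagon_def \<epsilon>_def by metis
  \<comment> \<open>The closed polygon in which the two sides at \<open>b\<close> are replaced by
    the chord from \<open>a\<close> to \<open>c\<close>; subtracting \<open>wn c a\<close> traverses
    that chord in this direction. No segment of it contains \<open>b\<close>, so \<open>rest\<close>
    is continuous there and its limits from both sides along the bisector agree.\<close>
  define rest where "rest w = (\<Sum>i\<in>UNIV - {j, j - 1}. wn (p i) (p (i + 1)) w) - wn c a w" for w
  have split: "winding_number (boundary_path p) w = rest w + wn_triangle a b c w" if "w \<notin> bd p" for w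
  proof -
    have "(UNIV::6 set) = insert j (insert (j - 1) (UNIV - {j, j - 1}))" by auto
    then have "(\<Sum>i\<in>UNIV. wn (p i) (p (i + 1)) w) = (\<Sum>i\<in>insert j (insert (j - 1) (UNIV - {j, j - 1})). wn (p i) (p
        (i + 1)) w)"
      by simp
    also have "\<dots> = wn b c w + (wn a b w + (\<Sum>i\<in>UNIV - {j, j - 1}. wn (p i) (p (i + 1)) w))"
      by (simp add: a_def b_def c_def)
    finally show ?thesis using winding_number_boundary_path[OF that] by (simp add: rest_def wn_triangle_def)
  qed
  have cont: "isCont rest b"
  proof -
    have "b \<notin> closed_segment c a"
    proof
      assume "b \<in> closed_segment c a"
      then obtain x where x: "b = (1 - x) *\<^sub>R c + x *\<^sub>R a" by (auto simp: in_segment)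
      then have "(of_real (1 - x) + of_real x * \<omega>) * e = 0" by (simp add: a c scaleR_conv_of_real algebra_simps)
      then have "1 - x = 0" "x = 0" using omega_real_combination[OF \<omega>, of "1 - x" x] ne by auto
      then show False by simp
    qed
    then have 1: "isCont (\<lambda>w. wn c a w) b"
      using continuous_at_winding_number[of "linepath c a" b] by simp
    have 2: "isCont (\<lambda>w. wn (p i) (p (i + 1)) w) b" if "i \<noteq> j" "i \<noteq> j - 1" for i
    proof -
      have "b \<notin> side p i" using corner_of_side[OF p, of j i] that by (auto simp: b_def)
      then show ?thesis
        using continuous_at_winding_number[of "linepath (p i) (p (i + 1))" b] by (simp add: side_def)
    qed
    show ?thesis unfolding rest_def by (intro continuous_intros 1 2) auto
  qed
  obtain R where R: "R > 0" "region p \<inter> ball b R = sector b u (2 / 3 * pi) R"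
    "open_region p \<inter> ball b R = open_sector b u (2 / 3 * pi) R" and nu: "norm u = 1"
    using sector unfolding has_sector_def b_def by blast
  let ?l = "norm e"
  have dir: "of_real s * (1 + \<omega>) * e = of_real (s * ?l) * u * cis (pi / 3)" for s
    using u unfolding e_def[symmetric] by (simp add: mult.assoc)
  have lim: "((\<lambda>s. rest (b + of_real (k * s) * (1 + \<omega>) * e)) \<longlongrightarrow> rest b) (at_right 0)" for k
  proof -
    have "((\<lambda>s. b + of_real (k * s) * (1 + \<omega>) * e) \<longlongrightarrow> b + of_real (k * 0) * (1 + \<omega>) * e) (at_right 0)"
      by (intro tendsto_intros)
    then show ?thesis by (intro isCont_tendsto_compose[OF cont]) simp
  qed
  \<comment> \<open>For \<open>s < S\<close> the point stays in the disc of the sector, and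
    \<open>s < 1 / 2\<close> makes the barycentric weight \<open>1 - 2 * s\<close> of
    \<open>b\<close> positive.\<close>
  define S where "S = min (1 / 2) (R / ?l)"
  have S: "0 < S" "S \<le> 1 / 2" "s < S \<Longrightarrow> s * ?l < R" for s
    using R(1) ne by (auto simp: S_def field_simps)
  have ev: "eventually (\<lambda>s. 0 < s \<and> s < S) (at_right 0)"
    using S(1) by (auto simp: eventually_at_right_field)
  \<comment> \<open>\<open>e\<close> and \<open>\<omega> * e\<close> have equal length, so
    \<open>(1 + \<omega>) * e\<close> points along the bisector of the corner. Going forwards, the
    point lies inside both the hexagon and the triangle.\<close>
  have plus: "rest (b + of_real (1 * s) * (1 + \<omega>) * e) = \<epsilon> - of_real (sgn (Im \<omega>))" if s: "0 < s" "s < S" for s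
  proof -
    let ?w = "b + of_real s * (1 + \<omega>) * e"
    have sl: "0 < s * ?l" "s * ?l < R" using s S ne by auto
    have "?w \<in> open_sector b u (2 / 3 * pi) R"
      unfolding dir open_sector_def using sl pi_gt_zero by (intro CollectI exI[of _ "s * ?l"] exI[of _ "pi / 3"]) auto
    then have w: "?w \<in> open_region p" using R(3) by blast
    then have "?w \<notin> bd p" using simple_hexagon_Jordan(4)[OF p] by blast
    moreover have "wn_triangle a b c ?w = of_real (sgn (orient a b c))"
    proof (rule wn_triangle_inside)
      show "orient a b c \<noteq> 0" using or ne primitive_cube_root(3)[OF \<omega>] by simp
      show "0 < s" "0 < 1 - 2 * s" "0 < s" "s + (1 - 2 * s) + s = 1" using s S(2) by auto
      show "?w = of_real s * a + of_real (1 - 2 * s) * b + of_real s * c" by (simp add: a c algebra_simps)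
    qed
    moreover have "sgn (orient a b c) = sgn (Im \<omega>)" using ne by (simp add: or sgn_mult)
    ultimately show ?thesis using split[of ?w] eps[OF w] by simp
  qed
  \<comment> \<open>Going backwards, the direction makes the angle \<open>pi / 3 + pi\<close> with
    \<open>u\<close>, which is beyond \<open>2 / 3 * pi\<close>. The point lies outside the hexagon
    and the triangle, so both winding numbers vanish.\<close>
  have minus: "rest (b + of_real (- 1 * s) * (1 + \<omega>) * e) = 0" if s: "0 < s" "s < S" for s
  proof -
    let ?w = "b + of_real (- s) * (1 + \<omega>) * e"
    have sl: "0 < s * ?l" "s * ?l < R" using s S ne by auto
    have "?w = b - of_real s * (1 + \<omega>) * e" by simp
    also have "\<dots> = b + of_real (s * ?l) * u * cis (pi / 3 + pi)"
      unfolding dir cis_mult[of "pi / 3" pi, symmetric] by simp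
    finally have w: "?w = b + of_real (s * ?l) * u * cis (pi / 3 + pi)" .
    have "?w \<notin> sector b u (2 / 3 * pi) R"
      unfolding w by (subst mem_sector_iff) (use nu sl pi_gt_zero in auto)
    moreover have "?w \<in> ball b R" unfolding w using sl nu by (simp add: dist_norm norm_mult)
    ultimately have out: "?w \<notin> region p" using R(2) by blast
    then have nb: "?w \<notin> bd p" using bd_subset_region by blast
    have "?w \<in> outside (bd p)" using out simple_hexagon_Jordan(6)[OF p] unfolding region_def by blast
    then have "winding_number (boundary_path p) ?w = 0"
      by (intro winding_number_zero_in_outside) auto
    moreover have "?w \<notin> convex hull {a, b, c}"
    proof
      assume "?w \<in> convex hull {a, b, c}"
      then obtain x y v where x: "0 \<le> x" "x + y + v = 1" "?w = x *\<^sub>R a + y *\<^sub>R b + v *\<^sub>R c"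
        by (auto simp: convex_hull_3)
      have y: "y = 1 - x - v" using x(2) by simp
      have "(of_real (v + s) + of_real (x + s) * \<omega>) * e = 0"
        using x(3) unfolding y by (simp add: a c scaleR_conv_of_real algebra_simps)
      then have "of_real (v + s) + of_real (x + s) * \<omega> = 0" using ne by simp
      then have "x + s = 0" by (rule omega_real_combination(2)[OF \<omega>])
      then show False using x(1) s by simp
    qed
    ultimately show ?thesis using split[OF nb] wn_triangle_outside by simp
  qed
  have "((\<lambda>s. rest (b + of_real (1 * s) * (1 + \<omega>) * e)) \<longlongrightarrow> \<epsilon> - of_real (sgn (Im \<omega>))) (at_right 0)"
    by (rule tendsto_eventually) (use ev plus in \<open>auto elim!: eventually_mono\<close>)
  then have 1: "rest b = \<epsilon> - of_real (sgn (Im \<omega>))" using lim[of 1] tendsto_unique trivial_limit_at_right_real by blast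
  have "((\<lambda>s. rest (b + of_real (- 1 * s) * (1 + \<omega>) * e)) \<longlongrightarrow> 0) (at_right 0)"
    by (rule tendsto_eventually) (use ev minus in \<open>auto elim!: eventually_mono\<close>)
  then have "rest b = 0" using lim[of "- 1"] tendsto_unique trivial_limit_at_right_real by blast
  with 1 show ?thesis unfolding \<epsilon>_def by simp
qed

section \<open>The group generated by the rotations\<close>

text \<open>One and the same \<omega> serves all odd corners. The rotation by \<omega> about an odd
  corner \<open>p j\<close> carries side \<open>j\<close> to side \<open>j - 1\<close>.\<close>

definition rot_hexagon :: "complex \<Rightarrow> hexagon \<Rightarrow> bool" where
  "rot_hexagon \<omega> p \<longleftrightarrow> simple_hexagon p \<and> \<omega>\<^sup>2 + \<omega> + 1 = 0 \<and>
     (\<forall>j\<in>{1, 3, 5}. interior_angle p j = 2 / 3 * pi \<and> p (j - 1) - p j = \<omega> * (p (j + 1) - p j))"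

text \<open>The two possible roots correspond to the sector starting at side \<open>j\<close> or at
  side \<open>j - 1\<close>. In both cases \<open>1 + \<omega>\<close> points to the middle of the
  sector, at angle \<open>pi / 3\<close> from its first ray \<open>u\<close>.\<close>

lemma third_turn_sector:
  assumes "simple_hexagon p" "interior_angle p j = 2 / 3 * pi" "side_length p (j - 1) = side_length p j"
  obtains \<omega> u where "\<omega>\<^sup>2 + \<omega> + 1 = 0" "p (j - 1) - p j = \<omega> * (p (j + 1) - p j)"
    "has_sector p (p j) u (2 / 3 * pi)"
    "(1 + \<omega>) * (p (j + 1) - p j) = of_real (norm (p (j + 1) - p j)) * u * cis (pi / 3)"
    "u = sgn (p (j + 1) - p j) \<and> \<omega> = cis (2 / 3 * pi) \<or> u = sgn (p (j - 1) - p j) \<and> \<omega> = cis (- (2 / 3 * pi))"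
proof -
  obtain u \<theta> where u: "has_sector p (p j) u \<theta>"
    "u = sgn (p (j + 1) - p j) \<and> u * cis \<theta> = sgn (p (j - 1) - p j) \<or>
     u = sgn (p (j - 1) - p j) \<and> u * cis \<theta> = sgn (p (j + 1) - p j)"
    using corner_has_sector[OF assms(1), of j] .
  have th: "\<theta> = 2 / 3 * pi" using has_sector_interior_angle[OF u(1)] assms(2) by simp
  define l where "l = norm (p (j + 1) - p j)"
  have l: "norm (p (j - 1) - p j) = l" using assms(3) by (simp add: side_length_def dist_norm l_def
      norm_minus_commute)
  define d where "d = sgn (p (j + 1) - p j)"
  define d' where "d' = sgn (p (j - 1) - p j)"
  have gen: "x = of_real (norm x) * sgn x" for x :: complex
    by (cases "x = 0") (simp_all add: sgn_div_norm scaleR_conv_of_real)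
  have e: "p (j + 1) - p j = of_real l * d" "p (j - 1) - p j = of_real l * d'"
    using gen[of "p (j + 1) - p j"] gen[of "p (j - 1) - p j"] unfolding d_def d'_def l l_def[symmetric] .
  from u(2) show thesis unfolding d_def[symmetric] d'_def[symmetric]
  proof
    assume *: "u = d \<and> u * cis \<theta> = d'"
    then have d': "d' = d * cis (2 / 3 * pi)" unfolding th by blast
    show thesis
    proof (rule that[of "cis (2 / 3 * pi)" u])
      show "(cis (2 / 3 * pi))\<^sup>2 + cis (2 / 3 * pi) + 1 = 0" by (rule cis_third)
      show "p (j - 1) - p j = cis (2 / 3 * pi) * (p (j + 1) - p j)"
        unfolding e d' by (simp only: mult_ac)
      show "has_sector p (p j) u (2 / 3 * pi)" using u(1) unfolding th .
      show "(1 + cis (2 / 3 * pi)) * (p (j + 1) - p j) = of_real (norm (p (j + 1) - p j)) * u * cis (pi / 3)"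
        unfolding cis_third(3) l_def[symmetric] conjunct1[OF *] unfolding e by (simp only: mult_ac)
    qed (use * d_def in simp)
  next
    assume *: "u = d' \<and> u * cis \<theta> = d"
    have c1: "cis (- (2 / 3 * pi)) * cis (2 / 3 * pi) = 1" by (simp add: cis_mult)
    have d: "d = d' * cis (2 / 3 * pi)" using * unfolding th by blast
    have d': "d' = cis (- (2 / 3 * pi)) * d"
      unfolding d mult.left_commute[of "cis (- (2 / 3 * pi))"] c1 by simp
    show thesis
    proof (rule that[of "cis (- (2 / 3 * pi))" u])
      show "(cis (- (2 / 3 * pi)))\<^sup>2 + cis (- (2 / 3 * pi)) + 1 = 0" by (rule cis_third)
      show "p (j - 1) - p j = cis (- (2 / 3 * pi)) * (p (j + 1) - p j)"
        unfolding e d' by (simp only: mult_ac)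
      show "has_sector p (p j) u (2 / 3 * pi)" using u(1) unfolding th .
      have "1 + cis (- (2 / 3 * pi)) = cis (- (2 / 3 * pi)) * (1 + cis (2 / 3 * pi))"
        using c1 by (simp only: ring_distribs mult_1_right add.commute)
      then have c: "1 + cis (- (2 / 3 * pi)) = cis (- (2 / 3 * pi)) * cis (pi / 3)" unfolding cis_third(3) .
      show "(1 + cis (- (2 / 3 * pi))) * (p (j + 1) - p j) = of_real (norm (p (j + 1) - p j)) * u * cis (pi / 3)"
        unfolding c l_def[symmetric] conjunct1[OF *] d' unfolding e by (simp only: mult_ac)
    qed (use * d'_def in simp)
  qed
qed

lemma primitive_cube_root_cases:
  assumes "\<omega>\<^sup>2 + \<omega> + 1 = 0" "\<omega>'\<^sup>2 + \<omega>' + 1 = (0::complex)" "sgn (Im \<omega>) = sgn (Im \<omega>')"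
  shows "\<omega> = \<omega>'"
proof -
  have "(\<omega> - \<omega>') * (\<omega> + \<omega>' + 1) = 0" using assms(1,2) by algebra
  then consider "\<omega> = \<omega>'" | "\<omega> + \<omega>' + 1 = 0" by auto
  then show ?thesis
  proof cases
    case 2
    then have "Im (\<omega> + \<omega>' + 1) = 0" by simp
    then have "Im \<omega>' = - Im \<omega>" by simp
    then show ?thesis using assms(3) primitive_cube_root(3)[OF assms(1)] by (simp add: sgn_real_def split: if_splits)
  qed
qed

text \<open>Each odd corner by itself yields one of two roots. All three agree because the sign of
  each imaginary part equals the winding number of the boundary about one common inner
  point.\<close>

lemma rot_hexagonI:
  assumes "simple_hexagon p" and "\<And>j. j \<in> {1, 3, 5} \<Longrightarrow> interior_angle p j = 2 / 3 * pi \<and> side_length p (j - 1) =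
      side_length p j"
  obtains \<omega> where "rot_hexagon \<omega> p"
proof -
  obtain z where z: "z \<in> open_region p" using simple_hexagon_Jordan(2)[OF assms(1)] by blast
  have ex: "\<exists>\<omega>. \<omega>\<^sup>2 + \<omega> + 1 = 0 \<and> p (j - 1) - p j = \<omega> * (p (j + 1) - p j) \<and>
      winding_number (boundary_path p) z = of_real (sgn (Im \<omega>))" if j: "j \<in> {1, 3, 5}" for j
  proof -
    obtain \<omega> u where *: "\<omega>\<^sup>2 + \<omega> + 1 = 0" "p (j - 1) - p j = \<omega> * (p (j + 1) - p j)"
      "has_sector p (p j) u (2 / 3 * pi)"
      "(1 + \<omega>) * (p (j + 1) - p j) = of_real (norm (p (j + 1) - p j)) * u * cis (pi / 3)"
      "u = sgn (p (j + 1) - p j) \<and> \<omega> = cis (2 / 3 * pi) \<or> u = sgn (p (j - 1) - p j) \<and> \<omega> = cis (- (2 / 3 * pi))"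
      using third_turn_sector[OF assms(1) conjunct1[OF assms(2)[OF j]] conjunct2[OF assms(2)[OF j]]] .
    show ?thesis using winding_number_at_corner[OF assms(1) *(1-4) z] *(1,2) by blast
  qed
  then obtain \<omega> where \<omega>: "\<omega>\<^sup>2 + \<omega> + 1 = 0" "winding_number (boundary_path p) z = of_real (sgn (Im \<omega>))"
    by (metis insertI1)
  have "p (j - 1) - p j = \<omega> * (p (j + 1) - p j)" if j: "j \<in> {1, 3, 5}" for j
  proof -
    obtain \<omega>' where \<omega>': "\<omega>'\<^sup>2 + \<omega>' + 1 = 0" "p (j - 1) - p j = \<omega>' * (p (j + 1) - p j)"
      "winding_number (boundary_path p) z = of_real (sgn (Im \<omega>'))" using ex[OF j] by blast
    have "sgn (Im \<omega>') = sgn (Im \<omega>)" using \<omega>'(3) \<omega>(2) by (metis of_real_eq_iff)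
    then show ?thesis using primitive_cube_root_cases[OF \<omega>'(1) \<omega>(1)] \<omega>'(2) by simp
  qed
  with that assms \<omega>(1) show thesis unfolding rot_hexagon_def by blast
qed

lemma rot_hexagon_winding_number:
  assumes "rot_hexagon \<omega> p" "z \<in> open_region p"
  shows "winding_number (boundary_path p) z = of_real (sgn (Im \<omega>))"
proof -
  have p: "simple_hexagon p" "\<omega>\<^sup>2 + \<omega> + 1 = 0" "interior_angle p 1 = 2 / 3 * pi" "p (1 - 1) - p 1 = \<omega> * (p (1 + 1)
      - p 1)"
    using assms(1) unfolding rot_hexagon_def by blast+
  have "norm (p (1 - 1) - p 1) = norm (p (1 + 1) - p 1)"
    using primitive_cube_root(2)[OF p(2)] unfolding p(4) norm_mult by simp
  then have "side_length p (1 - 1) = side_length p 1" by (simp add: side_length_def dist_norm norm_minus_commute)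
  then obtain \<omega>' u where *: "\<omega>'\<^sup>2 + \<omega>' + 1 = 0" "p (1 - 1) - p 1 = \<omega>' * (p (1 + 1) - p 1)"
      "has_sector p (p 1) u (2 / 3 * pi)"
      "(1 + \<omega>') * (p (1 + 1) - p 1) = of_real (norm (p (1 + 1) - p 1)) * u * cis (pi / 3)"
      "u = sgn (p (1 + 1) - p 1) \<and> \<omega>' = cis (2 / 3 * pi) \<or> u = sgn (p (1 - 1) - p 1) \<and> \<omega>' = cis (- (2 / 3 * pi))"
    by (rule third_turn_sector[OF p(1,3)])
  have "p (1 + 1) - p 1 \<noteq> 0" using simple_hexagon_corners_inj(1)[OF p(1)] by (simp add: inj_eq)
  then have "\<omega>' = \<omega>" using *(2) p(4) by simp
  then show ?thesis using winding_number_at_corner[OF p(1) *(1-4) assms(2)] by simp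
qed

text \<open>Restricted to direct isometries, because a reflection replaces \<omega> by its
  conjugate.\<close>

lemma rot_hexagon_direct:
  assumes "rot_hexagon \<omega> p" "norm A = 1"
  shows "rot_hexagon \<omega> ((\<lambda>z. A * z + B) \<circ> p)"
proof -
  have f: "plane_isometry (\<lambda>z. A * z + B)" using plane_isometryI(1)[OF assms(2)] .
  have "(A * p (j - 1) + B) - (A * p j + B) = \<omega> * ((A * p (j + 1) + B) - (A * p j + B))"
    if "j \<in> {1, 3, 5}" for j
  proof -
    have "p (j - 1) - p j = \<omega> * (p (j + 1) - p j)" using assms(1) that unfolding rot_hexagon_def by blast
    then have "A * (p (j - 1) - p j) = \<omega> * (A * (p (j + 1) - p j))" by simp
    then show ?thesis by (simp add: algebra_simps)
  qed
  then show ?thesis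
    using assms(1) simple_hexagon_plane_isometry[OF f] interior_angle_plane_isometry[OF f]
    unfolding rot_hexagon_def comp_apply by metis
qed

section \<open>The triangular lattice of tile centres and the group elements indexed by it\<close>

definition hex_center :: "hexagon \<Rightarrow> complex" where
  "hex_center p = (p 1 + p 3 + p 5) / 3"

text \<open>For a hexagon satisfying \<open>rot_hexagon\<close>, the factor before the Eisenstein
  integer is \<open>p 1 - p 3\<close>, so these are the integer combinations of differences of odd
  corners.\<close>

definition hex_lattice :: "complex \<Rightarrow> hexagon \<Rightarrow> int \<Rightarrow> int \<Rightarrow> complex" where
  "hex_lattice \<omega> p m n = (p 1 - hex_center p) * (1 - \<omega>) * (of_int m + of_int n * \<omega>)"

text \<open>Tying the rotation part to \<open>m + n\<close> makes the indices (1, 0), (0, 1), (-1,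
  -1) the rotations about \<open>p 1\<close>, \<open>p 3\<close>, \<open>p 5\<close>, and leaves
  exactly one group element for each lattice point.\<close>

definition rot_map :: "complex \<Rightarrow> hexagon \<Rightarrow> int \<Rightarrow> int \<Rightarrow> complex \<Rightarrow> complex" where
  "rot_map \<omega> p m n z = hex_center p + \<omega> powi (m + n) * (z - hex_center p) + hex_lattice \<omega> p m n"

locale rot_hex =
  fixes \<omega> :: complex and p :: hexagon
  assumes rot: "rot_hexagon \<omega> p"
begin

abbreviation "c \<equiv> hex_center p"
abbreviation "lat \<equiv> hex_lattice \<omega> p"
abbreviation "g \<equiv> rot_map \<omega> p"

definition "a = p 1 - c"
text \<open>The regular hexagon with the same odd corners has the corner
  \<open>c - \<omega> * a\<close> in place of \<open>p 0\<close>; \<open>e\<close> is the deviation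
  from it. The turns transport \<open>e\<close> to the other even corners, so \<open>c\<close>,
  \<open>a\<close>, \<open>e\<close> describe the whole hexagon.\<close>

definition "e = p 0 - c + \<omega> * a"

lemma simple: "simple_hexagon p" and omega: "\<omega>\<^sup>2 + \<omega> + 1 = 0"
  and turns: "p 0 - p 1 = \<omega> * (p 2 - p 1)" "p 2 - p 3 = \<omega> * (p 4 - p 3)" "p 4 - p 5 = \<omega> * (p 0 - p 5)"
  using rot by (auto simp: rot_hexagon_def)

lemmas omega_facts = primitive_cube_root[OF omega]

lemma omega_neq_1: "\<omega> \<noteq> 1" "\<omega> \<noteq> 0"
  using omega_facts(3) by auto

text \<open>The rotations about \<open>p 5\<close>, \<open>p 3\<close>, \<open>p 1\<close>, applied
  in this order, carry \<open>p 0\<close> to \<open>p 4\<close>, \<open>p 2\<close> and back to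
  \<open>p 0\<close>. Their product is a translation since the cube of \<omega> is 1, hence the
  identity; its translation part is \<open>1 - \<omega>\<close> times the left side. The relation
  says that the odd corners form an equilateral triangle.\<close>

lemma odd_relation: "p 1 + \<omega> * p 3 + \<omega>\<^sup>2 * p 5 = 0"
proof -
  have "(1 - \<omega>) * (p 1 + \<omega> * p 3 + \<omega>\<^sup>2 * p 5) = 0"
    using turns omega by algebra
  then show ?thesis using omega_neq_1 by simp
qed

lemma corner_coords:
  "p 1 = c + a" "p 3 = c + \<omega> * a" "p 5 = c + \<omega>\<^sup>2 * a"
  "p 0 = c - \<omega> * a + e" "p 2 = c - \<omega>\<^sup>2 * a + \<omega>\<^sup>2 * e" "p 4 = c - a + \<omega> * e"
proof -
  have c3: "3 * c = p 1 + p 3 + p 5" by (simp add: hex_center_def)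
  show 1: "p 1 = c + a" and 0: "p 0 = c - \<omega> * a + e" by (simp_all add: a_def e_def)
  have "3 * (p 3 - (c + \<omega> * (p 1 - c))) = 0" using c3 odd_relation omega by algebra
  then show 3: "p 3 = c + \<omega> * a" unfolding mult_eq_0_iff by (simp add: a_def)
  have "3 * (p 5 - (c + \<omega>\<^sup>2 * (p 1 - c))) = 0" using c3 odd_relation omega by algebra
  then show 5: "p 5 = c + \<omega>\<^sup>2 * a" unfolding mult_eq_0_iff by (simp add: a_def)
  have "\<omega> * (p 2 - (c - \<omega>\<^sup>2 * a + \<omega>\<^sup>2 * e)) = 0" using turns(1) 0 1 omega by algebra
  then show 2: "p 2 = c - \<omega>\<^sup>2 * a + \<omega>\<^sup>2 * e" using omega_neq_1 unfolding mult_eq_0_iff by simp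
  show "p 4 = c - a + \<omega> * e" using turns(3) 0 5 omega by algebra
qed

lemma a_nonzero: "a \<noteq> 0"
proof
  assume "a = 0"
  then have "p 1 = p 3" using corner_coords(1,2) by simp
  then show False using simple_hexagon_corners_inj(1)[OF simple] by (simp add: inj_eq)
qed

lemma lat_eq: "lat m n = a * (1 - \<omega>) * (of_int m + of_int n * \<omega>)"
  by (simp add: hex_lattice_def a_def)

lemma lat_add: "lat (m + m') (n + n') = lat m n + lat m' n'"
  by (simp add: lat_eq algebra_simps)

lemma lat_inj: "lat m n = lat m' n' \<longleftrightarrow> m = m' \<and> n = n'"
proof
  assume "lat m n = lat m' n'"
  then have "of_int m + of_int n * \<omega> = of_int m' + of_int n' * \<omega>" using a_nonzero omega_neq_1 by (simp add: lat_eq)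
  then have "of_real (of_int (m - m')) + of_real (of_int (n - n')) * \<omega> = 0" by (simp add: algebra_simps)
  then have "real_of_int (m - m') = 0 \<and> real_of_int (n - n') = 0" using omega_real_combination[OF omega] by blast
  then show "m = m' \<and> n = n'" by simp
qed simp

lemma omega_powi_mod: "\<omega> powi k = \<omega> ^ nat (k mod 3)"
proof -
  have "\<omega> powi k = \<omega> powi (3 * (k div 3) + k mod 3)" by simp
  also have "\<dots> = (\<omega> powi 3) powi (k div 3) * \<omega> powi (k mod 3)"
    unfolding power_int_mult[symmetric] by (rule power_int_add) (simp add: omega_neq_1)
  also have "\<omega> powi 3 = 1" using omega_facts(1) by (simp add: power_int_def)
  finally show ?thesis by (simp add: power_int_def)
qed

lemma omega_powi_cases:
  obtains "k mod 3 = 0" "\<omega> powi k = 1" | "k mod 3 = 1" "\<omega> powi k = \<omega>" | "k mod 3 = 2" "\<omega> powi k = \<omega>\<^sup>2"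
proof -
  have "k mod 3 = 0 \<or> k mod 3 = 1 \<or> k mod 3 = 2" by presburger
  then show thesis using that omega_powi_mod[of k] by (auto simp: numeral_2_eq_2)
qed

lemma omega_powi_cong: "k mod 3 = l mod 3 \<Longrightarrow> \<omega> powi k = \<omega> powi l"
  by (simp add: omega_powi_mod)

lemma omega_powi_add: "\<omega> powi (k + l) = \<omega> powi k * \<omega> powi l"
  using omega_neq_1 by (simp add: power_int_add)

lemma norm_omega_powi: "norm (\<omega> powi k) = 1"
  by (simp add: norm_power_int omega_facts(2))

text \<open>Multiplication by \<omega> sends the index \<open>(m, n)\<close> to
  \<open>(- n, m - n)\<close>, whose sum differs from \<open>m + n\<close> by \<open>3 * n\<close>.
  That the residue is preserved makes the rotation parts fit, so the maps \<open>g m n\<close> are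
  closed under composition.\<close>

lemma omega_mult_lat:
  obtains m' n' where "\<omega> powi k * lat m n = lat m' n'" "(m' + n') mod 3 = (m + n) mod 3"
proof (cases rule: omega_powi_cases[of k])
  case 1
  then show thesis using that[of m n] by simp
next
  case 2
  have "\<omega> powi k * lat m n = lat (- n) (m - n)" unfolding 2 lat_eq of_int_diff of_int_minus using omega by algebra
  moreover have "(- n + (m - n)) mod 3 = (m + n) mod 3" by presburger
  ultimately show thesis using that by blast
next
  case 3
  have "\<omega> powi k * lat m n = lat (n - m) (- m)" unfolding 3 lat_eq of_int_diff of_int_minus using omega by algebra
  moreover have "(n - m + - m) mod 3 = (m + n) mod 3" by presburger
  ultimately show thesis using that by blast
qed

lemma g_comp_lat:
  assumes "\<omega> powi (m + n) * lat m' n' = lat m1 n1" "(m1 + n1) mod 3 = (m' + n') mod 3"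
  shows "g m n \<circ> g m' n' = g (m + m1) (n + n1)"
proof
  fix z
  have "\<omega> powi (m + m1 + (n + n1)) = \<omega> powi (m + n) * \<omega> powi (m' + n')"
    unfolding omega_powi_add[symmetric]
    using omega_powi_cong[OF mod_add_cong[OF refl[of "(m + n) mod 3"] assms(2)]] by (simp add: algebra_simps)
  then show "(g m n \<circ> g m' n') z = g (m + m1) (n + n1) z"
    using assms(1) by (simp add: rot_map_def lat_add algebra_simps)
qed

lemma g_comp: obtains m'' n'' where "g m n \<circ> g m' n' = g m'' n''"
  using omega_mult_lat[of "m + n" m' n'] g_comp_lat by metis

lemma g_0: "g 0 0 = id"
  by (simp add: rot_map_def lat_eq fun_eq_iff)

lemma g_inverse: obtains m' n' where "g m n \<circ> g m' n' = id" "g m' n' \<circ> g m n = id"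
proof -
  obtain m' n' where *: "\<omega> powi (- (m + n)) * lat (- m) (- n) = lat m' n'" "(m' + n') mod 3 = (- m + - n) mod 3"
    using omega_mult_lat by metis
  have "\<omega> powi (m + n) * lat m' n' = \<omega> powi ((m + n) + - (m + n)) * lat (- m) (- n)"
    unfolding omega_powi_add *(1)[symmetric] by simp
  then have "\<omega> powi (m + n) * lat m' n' = lat (- m) (- n)" by simp
  then have "g m n \<circ> g m' n' = g (m + - m) (n + - n)"
    by (rule g_comp_lat) (use *(2) in simp)
  then have 1: "g m n \<circ> g m' n' = id" by (simp add: g_0)
  have "\<omega> powi (m' + n') = \<omega> powi (- (m + n))" by (rule omega_powi_cong) (use *(2) in simp)
  then have "\<omega> powi (m' + n') * lat m n = - lat m' n'" using *(1) by (simp add: lat_eq algebra_simps)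
  also have "\<dots> = lat (- m') (- n')" by (simp add: lat_eq algebra_simps)
  finally have "g m' n' \<circ> g m n = g (m' + - m') (n' + - n')"
    using mod_minus_cong[OF *(2)] by (intro g_comp_lat) (simp_all add: algebra_simps)
  then show thesis using that 1 by (simp add: g_0)
qed

lemma g_affine: "g m n = (\<lambda>z. \<omega> powi (m + n) * z + (c - \<omega> powi (m + n) * c + lat m n))"
  by (simp add: rot_map_def fun_eq_iff algebra_simps)

lemma g_isometry: "plane_isometry (g m n)"
  unfolding g_affine by (rule plane_isometryI(1)[OF norm_omega_powi])

lemma rot_copy: "rot_hexagon \<omega> (g m n \<circ> p)"
  unfolding g_affine by (rule rot_hexagon_direct[OF rot norm_omega_powi])

lemma simple_copy: "simple_hexagon (g m n \<circ> p)"
  using rot_copy[of m n] unfolding rot_hexagon_def by blast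

lemma g_odd_rotations:
  "g 1 0 z = p 1 + \<omega> * (z - p 1)" "g 0 1 z = p 3 + \<omega> * (z - p 3)" "g (-1) (-1) z = p 5 + \<omega> * (z - p 5)"
proof -
  have *: "\<omega> powi (- 1 + - 1) = \<omega>"
    using omega_powi_cong[of "-1 + -1" 1] by simp
  show "g 1 0 z = p 1 + \<omega> * (z - p 1)" "g 0 1 z = p 3 + \<omega> * (z - p 3)"
    by (simp_all add: rot_map_def lat_eq corner_coords algebra_simps power2_eq_square)
  have "c + \<omega> * (z - c) + a * (1 - \<omega>) * (- 1 + - 1 * \<omega>) = c + \<omega>\<^sup>2 * a + \<omega> * (z - (c + \<omega>\<^sup>2 * a))"
    using omega by algebra
  then show "g (-1) (-1) z = p 5 + \<omega> * (z - p 5)"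
    unfolding rot_map_def lat_eq corner_coords * of_int_minus of_int_1 .
qed

end

section \<open>Counting copies by winding numbers\<close>

context rot_hex
begin

text \<open>
  Corners of the copy with index \<open>(m, n)\<close>, named by position rather than by label: \<open>V0, V1, V2\<close> span a triangle
  that does not depend on the rotational part of \<open>g m n\<close>, and \<open>E0, E1, E2\<close> lie between them.
\<close>

definition "V0 m n = c + lat m n + a"
definition "V1 m n = c + lat m n + \<omega> * a"
definition "V2 m n = c + lat m n + \<omega>\<^sup>2 * a"
definition "E0 m n = c + lat m n - \<omega>\<^sup>2 * a + \<omega>\<^sup>2 * (\<omega> powi (m + n))\<^sup>2 * e"
definition "E1 m n = c + lat m n - a + \<omega> * (\<omega> powi (m + n))\<^sup>2 * e"
definition "E2 m n = c + lat m n - \<omega> * a + (\<omega> powi (m + n))\<^sup>2 * e"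

lemmas VE_defs = V0_def V1_def V2_def E0_def E1_def E2_def

lemma omega_mult: "\<omega> * \<omega> = - 1 - \<omega>" "\<omega> * (\<omega> * x) = - x - \<omega> * x"
  using omega by algebra+

text \<open>A turn by \<omega> moves every label to the position two steps on. At a fixed position
  another even label arrives, and its own deviation combined with the rotation amounts to the
  deviation there times the inverse of the rotation factor, which is its square.\<close>

lemma copy_corners:
  shows "\<omega> powi (m + n) = 1 \<Longrightarrow> g m n (p 0) = E2 m n \<and> g m n (p 1) = V0 m n \<and> g m n (p 2) = E0 m n \<and>
      g m n (p 3) = V1 m n \<and> g m n (p 4) = E1 m n \<and> g m n (p 5) = V2 m n"
    and "\<omega> powi (m + n) = \<omega> \<Longrightarrow> g m n (p 0) = E0 m n \<and> g m n (p 1) = V1 m n \<and> g m n (p 2) = E1 m n \<and>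
      g m n (p 3) = V2 m n \<and> g m n (p 4) = E2 m n \<and> g m n (p 5) = V0 m n"
    and "\<omega> powi (m + n) = \<omega>\<^sup>2 \<Longrightarrow> g m n (p 0) = E1 m n \<and> g m n (p 1) = V2 m n \<and> g m n (p 2) = E2 m n \<and>
      g m n (p 3) = V0 m n \<and> g m n (p 4) = E0 m n \<and> g m n (p 5) = V1 m n"
proof -
  assume P: "\<omega> powi (m + n) = 1"
  show "g m n (p 0) = E2 m n \<and> g m n (p 1) = V0 m n \<and> g m n (p 2) = E0 m n \<and>
      g m n (p 3) = V1 m n \<and> g m n (p 4) = E1 m n \<and> g m n (p 5) = V2 m n"
    unfolding rot_map_def VE_defs corner_coords P by (intro conjI) (simp_all add: algebra_simps)
next
  assume P: "\<omega> powi (m + n) = \<omega>"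
  show "g m n (p 0) = E0 m n \<and> g m n (p 1) = V1 m n \<and> g m n (p 2) = E1 m n \<and>
      g m n (p 3) = V2 m n \<and> g m n (p 4) = E2 m n \<and> g m n (p 5) = V0 m n"
    unfolding rot_map_def VE_defs corner_coords P by (simp add: algebra_simps power2_eq_square omega_mult)
next
  assume P: "\<omega> powi (m + n) = \<omega>\<^sup>2"
  show "g m n (p 0) = E1 m n \<and> g m n (p 1) = V2 m n \<and> g m n (p 2) = E2 m n \<and>
      g m n (p 3) = V0 m n \<and> g m n (p 4) = E0 m n \<and> g m n (p 5) = V1 m n"
    unfolding rot_map_def VE_defs corner_coords P by (simp add: algebra_simps power2_eq_square omega_mult)
qed

lemma winding_number_copy:
  assumes "z \<notin> bd (g m n \<circ> p)"
  shows "winding_number (boundary_path (g m n \<circ> p)) z =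
    wn (V0 m n) (E0 m n) z + wn (E0 m n) (V1 m n) z + wn (V1 m n) (E1 m n) z + wn (E1 m n) (V2 m n) z +
    wn (V2 m n) (E2 m n) z + wn (E2 m n) (V0 m n) z"
  unfolding winding_number_boundary_path[OF assms] UNIV_6
  by (cases rule: omega_powi_cases[of "m + n"]) (simp_all add: copy_corners)

section \<open>Generic points and locally finite sums over the lattice\<close>

definition vertex_set :: "complex set" where
  "vertex_set = (\<Union>m n. {V0 m n, V1 m n, V2 m n, E0 m n, E1 m n, E2 m n})"

text \<open>Besides the boundaries of all copies this contains the inner cuts of the hexagons and
  the edges of the lattice triangles. A countable union of segments is negligible, so every nonempty
  open set contains a generic point.\<close>

definition bad_set :: "complex set" where
  "bad_set = (\<Union>x\<in>vertex_set. \<Union>y\<in>vertex_set. closed_segment x y)"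

lemma vertex_set_VE [simp]: "V0 m n \<in> vertex_set" "V1 m n \<in> vertex_set" "V2 m n \<in> vertex_set"
  "E0 m n \<in> vertex_set" "E1 m n \<in> vertex_set" "E2 m n \<in> vertex_set"
  unfolding vertex_set_def by blast+

lemma segment_bad: "z \<notin> bad_set \<Longrightarrow> x \<in> vertex_set \<Longrightarrow> y \<in> vertex_set \<Longrightarrow> z \<notin> closed_segment x y"
  unfolding bad_set_def by blast

lemma negligible_bad_set: "negligible bad_set"
proof -
  have "countable vertex_set" unfolding vertex_set_def by (intro countable_UN) auto
  moreover have "negligible (closed_segment x y)" for x y :: complex
    by (simp add: negligible_convex_interior interior_closed_segment_ge2)
  ultimately show ?thesis
    unfolding bad_set_def by (intro negligible_countable_Union countable_image) (auto intro!:
        negligible_countable_Union)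
qed

lemma generic_point:
  assumes "open U" "U \<noteq> {}"
  obtains z where "z \<in> U" "z \<notin> bad_set"
  using open_not_negligible[OF assms] negligible_subset[OF negligible_bad_set, of U] by blast

lemma copy_corner_vertex_set: "(g m n \<circ> p) i \<in> vertex_set"
  using exhaust_6[of i] by (cases rule: omega_powi_cases[of "m + n"]) (auto simp: copy_corners)

lemma bd_copy_subset_bad: "bd (g m n \<circ> p) \<subseteq> bad_set"
  unfolding path_image_boundary_path side_def bad_set_def using copy_corner_vertex_set by blast

text \<open>The imaginary part of the Eisenstein integer bounds \<open>n\<close>, since
  \<open>Im \<omega>\<close> has absolute value at least 1/2, and its real part
  \<open>m - n / 2\<close> then bounds \<open>m\<close>.\<close>

lemma finite_lattice_near: "finite {(m, n). norm (z - (c + lat m n)) \<le> D}"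
proof -
  define b where "b = norm (a * (1 - \<omega>))"
  have b: "b > 0" using a_nonzero omega_neq_1 by (simp add: b_def)
  define L where "L = (D + norm (z - c)) / b"
  define B where "B = \<lceil>2 * L\<rceil>"
  have "m \<in> {- B..B} \<and> n \<in> {- B..B}" if "norm (z - (c + lat m n)) \<le> D" for m n
  proof -
    let ?w = "of_int m + of_int n * \<omega>"
    have "norm (lat m n) \<le> norm (z - c) + norm (z - (c + lat m n))"
      using norm_triangle_ineq4[of "z - c" "z - (c + lat m n)"] by simp
    also have "norm (lat m n) = b * norm ?w" by (simp add: lat_eq b_def norm_mult)
    finally have w: "norm ?w \<le> L" using that b by (simp add: L_def field_simps)
    have "(Im \<omega>)\<^sup>2 = 3 / 4"
      using omega_facts(2,4) cmod_power2[of \<omega>] by (simp add: power2_eq_square)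
    then have "\<bar>Im \<omega>\<bar> \<ge> 1 / 2"
      using abs_le_square_iff[of "1 / 2" "Im \<omega>"] by (simp add: power2_eq_square)
    then have "\<bar>of_int n\<bar> * (1 / 2) \<le> \<bar>of_int n\<bar> * \<bar>Im \<omega>\<bar>" by (intro mult_left_mono) auto
    also have "\<dots> = \<bar>Im ?w\<bar>" by (simp add: abs_mult)
    also have "\<dots> \<le> L" using abs_Im_le_cmod[of ?w] w by linarith
    finally have n: "\<bar>real_of_int n\<bar> \<le> 2 * L" by simp
    have "\<bar>real_of_int m - real_of_int n / 2\<bar> = \<bar>Re ?w\<bar>" by (simp add: omega_facts(4))
    also have "\<dots> \<le> L" using abs_Re_le_cmod[of ?w] w by linarith
    finally have "\<bar>real_of_int m\<bar> \<le> 2 * L" using n by linarith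
    with n have "real_of_int \<bar>m\<bar> \<le> 2 * L" "real_of_int \<bar>n\<bar> \<le> 2 * L" by auto
    then have "\<bar>m\<bar> \<le> B" "\<bar>n\<bar> \<le> B" unfolding B_def by (metis ceiling_mono ceiling_of_int)+
    then show ?thesis by auto
  qed
  then have "{(m, n). norm (z - (c + lat m n)) \<le> D} \<subseteq> {- B..B} \<times> {- B..B}" by auto
  then show ?thesis by (rule finite_subset) auto
qed

text \<open>\<open>Sum_any\<close> is additive only over finite supports. Triangles of bounded size
  attached to the lattice points reach a given point only from finitely many of them.\<close>

lemma finite_triangle_support:
  assumes "\<And>m n. norm (x m n - (c + lat m n)) \<le> D" "\<And>m n. norm (y m n - (c + lat m n)) \<le> D"
    "\<And>m n. norm (w m n - (c + lat m n)) \<le> D"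
  shows "finite {i. (case i of (m, n) \<Rightarrow> wn_triangle (x m n) (y m n) (w m n) z) \<noteq> 0}"
proof (rule finite_subset[OF _ finite_lattice_near[of z D]], clarsimp)
  fix m n assume "wn_triangle (x m n) (y m n) (w m n) z \<noteq> 0"
  then have "z \<in> convex hull {x m n, y m n, w m n}" using wn_triangle_outside by blast
  also have "\<dots> \<subseteq> cball (c + lat m n) D"
    by (rule hull_minimal) (use assms in \<open>auto simp: dist_norm norm_minus_commute\<close>)
  finally show "norm (z - (c + lat m n)) \<le> D" by (simp add: dist_norm norm_minus_commute)
qed

text \<open>\<open>T_up\<close> is the triangle of the odd corners and \<open>T_0\<close>,
  \<open>T_1\<close>, \<open>T_2\<close> are the outer triangles. \<open>T_down\<close> completes
  \<open>T_up\<close> to a parallelogram whose fourth corner is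
  \<open>V1 (m + 1) (n + 1)\<close>.\<close>

definition "T_up z = (\<lambda>(m, n). wn_triangle (V0 m n) (V1 m n) (V2 m n) z)"
definition "T_0 z = (\<lambda>(m, n). wn_triangle (V0 m n) (E0 m n) (V1 m n) z)"
definition "T_1 z = (\<lambda>(m, n). wn_triangle (V1 m n) (E1 m n) (V2 m n) z)"
definition "T_2 z = (\<lambda>(m, n). wn_triangle (V2 m n) (E2 m n) (V0 m n) z)"
definition "T_down z = (\<lambda>(m, n). wn_triangle (V0 m n) (V1 (m + 1) (n + 1)) (V1 m n) z)"
definition "T_hex z = (\<lambda>(m, n). winding_number (boundary_path (g m n \<circ> p)) z)"

lemma finite_supports:
  "finite {x. T_up z x \<noteq> 0}" "finite {x. T_0 z x \<noteq> 0}" "finite {x. T_1 z x \<noteq> 0}" "finite {x. T_2 z x \<noteq> 0}"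
proof -
  define D where "D = norm a + norm e"
  have P: "norm ((\<omega> powi k)\<^sup>2) = 1" for k by (simp add: norm_power norm_omega_powi)
  have V: "norm (V0 m n - (c + lat m n)) \<le> D" "norm (V1 m n - (c + lat m n)) \<le> D" "norm (V2 m n - (c + lat m n)) \<le>
      D" for m n
    by (simp_all add: VE_defs D_def norm_mult omega_facts(2) norm_power)
  have "norm (E0 m n - (c + lat m n)) \<le> norm (\<omega>\<^sup>2 * (\<omega> powi (m + n))\<^sup>2 * e) + norm (\<omega>\<^sup>2 * a)"
    "norm (E1 m n - (c + lat m n)) \<le> norm (\<omega> * (\<omega> powi (m + n))\<^sup>2 * e) + norm a"
    "norm (E2 m n - (c + lat m n)) \<le> norm ((\<omega> powi (m + n))\<^sup>2 * e) + norm (\<omega> * a)" for m n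
    using norm_triangle_ineq4[of "\<omega>\<^sup>2 * (\<omega> powi (m + n))\<^sup>2 * e" "\<omega>\<^sup>2 * a"]
      norm_triangle_ineq4[of "\<omega> * (\<omega> powi (m + n))\<^sup>2 * e" a]
      norm_triangle_ineq4[of "(\<omega> powi (m + n))\<^sup>2 * e" "\<omega> * a"]
    by (simp_all add: VE_defs)
  then have E: "norm (E0 m n - (c + lat m n)) \<le> D" "norm (E1 m n - (c + lat m n)) \<le> D" "norm (E2 m n - (c + lat m
      n)) \<le> D" for m n
    by (simp_all add: D_def norm_mult omega_facts(2) norm_power norm_omega_powi add.commute)
  show "finite {x. T_up z x \<noteq> 0}" "finite {x. T_0 z x \<noteq> 0}" "finite {x. T_1 z x \<noteq> 0}" "finite {x. T_2 z x \<noteq> 0}"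
    using finite_triangle_support[of V0 D V1 V2 z] finite_triangle_support[of V0 D E0 V1 z]
      finite_triangle_support[of V1 D E1 V2 z] finite_triangle_support[of V2 D E2 V0 z] V E
    unfolding T_up_def T_0_def T_1_def T_2_def by simp_all
qed

lemma shift_sum:
  fixes f :: "int \<times> int \<Rightarrow> complex"
  assumes "finite {x. f x \<noteq> 0}"
  shows "finite {x. f (fst x + k, snd x + l) \<noteq> 0}" "Sum_any (\<lambda>x. f (fst x + k, snd x + l)) = Sum_any f"
proof -
  define h where "h = (\<lambda>x. (fst x + k, snd x + l))"
  have h: "bij h" by (rule bij_betw_byWitness[where f' = "\<lambda>x. (fst x - k, snd x - l)"]) (auto simp: h_def)
  have "finite (h -` {x. f x \<noteq> 0})" using finite_vimageI[OF assms bij_is_inj[OF h]] .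
  then show "finite {x. f (fst x + k, snd x + l) \<noteq> 0}" by (simp add: h_def vimage_def)
  show "Sum_any (\<lambda>x. f (fst x + k, snd x + l)) = Sum_any f"
    by (rule Sum_any.reindex_cong[OF h, symmetric]) (simp add: h_def comp_def)
qed

text \<open>For the \<open>E\<close> identities the change of index also changes the rotation part,
  and its square is exactly the power of \<omega> separating the deviations of \<open>E0\<close>,
  \<open>E1\<close> and \<open>E2\<close>.\<close>

lemma vertex_identities:
  "V2 (m + 1) (n + 1) = V0 m n" "V2 m (n + 1) = V1 m n" "V0 m (n + 1) = V1 (m + 1) (n + 1)"
  "E1 (m + 1) (n + 1) = E0 m n" "E2 m (n + 1) = E0 m n"
proof -
  have l: "lat (m + 1) (n + 1) = lat m n + a * (1 - \<omega>\<^sup>2)" "lat m (n + 1) = lat m n + a * (\<omega> - \<omega>\<^sup>2)"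
    by (simp_all add: lat_eq algebra_simps power2_eq_square)
  show "V2 (m + 1) (n + 1) = V0 m n" "V2 m (n + 1) = V1 m n" "V0 m (n + 1) = V1 (m + 1) (n + 1)"
    unfolding VE_defs l by (simp_all add: algebra_simps)
  have "\<omega> powi (m + 1 + (n + 1)) = \<omega>\<^sup>2 * \<omega> powi (m + n)" "\<omega> powi (m + (n + 1)) = \<omega> * \<omega> powi (m + n)"
    using omega_powi_add[of 2 "m + n"] omega_powi_add[of 1 "m + n"] by (simp_all add: algebra_simps)
  note P = this
  show "E1 (m + 1) (n + 1) = E0 m n" "E2 m (n + 1) = E0 m n"
    unfolding VE_defs l P by (simp_all add: algebra_simps power2_eq_square omega_mult)
qed

lemma hex_sum:
  assumes z: "z \<notin> bad_set"
  shows "Sum_any (T_hex z) = Sum_any (\<lambda>x. T_up z x + T_down z x)"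
proof -
  have rev: "wn y x z = - wn x y z" if "x \<in> vertex_set" "y \<in> vertex_set" for x y
    by (rule wn_reverse) (use segment_bad z that in blast)
  \<comment> \<open>The three inner edges occur once in \<open>T_up\<close> and once, reversed, in
    an outer triangle; the six sides of the copy remain.\<close>
  have hex: "T_hex z x = T_up z x + (T_0 z x + (T_1 z x + T_2 z x))" for x
  proof -
    obtain m n where x: "x = (m, n)" by (cases x)
    have "z \<notin> bd (g m n \<circ> p)" using bd_copy_subset_bad z by blast
    then show ?thesis
      unfolding x T_hex_def T_up_def T_0_def T_1_def T_2_def prod.case wn_triangle_def
      using rev[of "V0 m n" "V1 m n"] rev[of "V1 m n" "V2 m n"] rev[of "V2 m n" "V0 m n"]
      by (simp add: winding_number_copy)
  qed
  \<comment> \<open>Three outer triangles of three different copies have the common apex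
    \<open>E0 m n\<close>. The edges at the apex cancel in pairs and the three bases bound the
    downward triangle, wherever the apex lies; this is how the shape of the hexagon disappears from
    the count.\<close>
  have down: "T_down z x = T_0 z x + (T_1 z (fst x + 1, snd x + 1) + T_2 z (fst x + 0, snd x + 1))" for x
  proof -
    obtain m n where x: "x = (m, n)" by (cases x)
    show ?thesis
      unfolding x T_down_def T_0_def T_1_def T_2_def prod.case wn_triangle_def fst_conv snd_conv add_0_right
      vertex_identities[of m n]
      using rev[of "V0 m n" "E0 m n"] rev[of "E0 m n" "V1 m n"] rev[of "E0 m n" "V1 (m + 1) (n + 1)"]
      by simp
  qed
  note fin = finite_supports[of z]
  note s1 = shift_sum[OF fin(3), of 1 1] and s2 = shift_sum[OF fin(4), of 0 1]
  have add: "finite {x. h x \<noteq> 0} \<Longrightarrow> finite {x. k x \<noteq> 0} \<Longrightarrow> finite {x. h x + k x \<noteq> 0}" for h k :: "int \<times> int \<Rightarrow> complex"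
    by (rule finite_subset[of _ "{x. h x \<noteq> 0} \<union> {x. k x \<noteq> 0}"]) auto
  have "Sum_any (T_hex z) = Sum_any (T_up z) + (Sum_any (T_0 z) + (Sum_any (T_1 z) + Sum_any (T_2 z)))"
    unfolding hex using fin by (simp add: Sum_any.distrib add)
  also have "\<dots> = Sum_any (\<lambda>x. T_up z x + T_down z x)"
    unfolding down using fin s1 s2 by (simp add: Sum_any.distrib add)
  finally show ?thesis .
qed

section \<open>Counting the lattice triangles around a generic point\<close>

lemma lattice_coordinates:
  obtains X Y :: real where
    "\<And>m n. z = V2 m n + of_real (X - of_int m) * (V0 m n - V2 m n) + of_real (Y - of_int n - (X - of_int m)) * (V1
        m n - V2 m n)"
proof -
  \<comment> \<open>The position of \<open>z\<close> in units of the lattice, with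
    \<open>V2 0 0\<close> as origin; \<open>X\<close> and \<open>Y\<close> are its coefficients with
    respect to 1 and \<omega>.\<close>
  define w where "w = (z - c - \<omega>\<^sup>2 * a) / (a * (1 - \<omega>))"
  define Y where "Y = Im w / Im \<omega>"
  define X where "X = Re w - Y * Re \<omega>"
  have "w = of_real X + of_real Y * \<omega>"
    using omega_facts(3) by (simp add: complex_eq_iff X_def Y_def)
  moreover have "z = c + \<omega>\<^sup>2 * a + a * (1 - \<omega>) * w" using a_nonzero omega_neq_1 by (simp add: w_def)
  ultimately have z: "z = c + \<omega>\<^sup>2 * a + a * (1 - \<omega>) * (of_real X + of_real Y * \<omega>)" by simp
  show thesis
    by (rule that[of X Y], unfold z VE_defs lat_eq)
      (simp add: algebra_simps power2_eq_square omega_mult)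
qed

lemma coordinates_unique:
  assumes "of_real s * (V0 m n - V2 m n) + of_real t * (V1 m n - V2 m n) = of_real s' * (V0 m n - V2 m n) +
      of_real t' * (V1 m n - V2 m n)"
  shows "s = s'" "t = t'"
proof -
  have V: "V0 m n - V2 m n = a * (1 - \<omega>) * (1 + \<omega>)" "V1 m n - V2 m n = a * (1 - \<omega>) * \<omega>"
    by (simp_all add: VE_defs algebra_simps power2_eq_square)
  have "a * (1 - \<omega>) * (of_real (s - s') + of_real ((s - s') + (t - t')) * \<omega>) = 0"
    using assms unfolding V by (simp add: algebra_simps)
  then have "of_real (s - s') + of_real ((s - s') + (t - t')) * \<omega> = 0" using a_nonzero omega_neq_1 by simp
  then have "s - s' = 0" "(s - s') + (t - t') = 0" by (rule omega_real_combination[OF omega])+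
  then show "s = s'" "t = t'" by auto
qed

lemma orient_up: "orient (V0 m n) (V1 m n) (V2 m n) = (norm (a * (1 - \<omega>)))\<^sup>2 * Im \<omega>"
proof -
  have V: "V1 m n - V0 m n = - (a * (1 - \<omega>))" "V2 m n - V0 m n = - (a * (1 - \<omega>)) * (1 + \<omega>)"
    by (simp_all add: VE_defs algebra_simps power2_eq_square)
  have "cnj (- (a * (1 - \<omega>))) * (- (a * (1 - \<omega>)) * (1 + \<omega>)) = (a * (1 - \<omega>)) * cnj (a * (1 - \<omega>)) * (1 + \<omega>)"
    by (simp add: mult_ac)
  also have "(a * (1 - \<omega>)) * cnj (a * (1 - \<omega>)) = of_real ((norm (a * (1 - \<omega>)))\<^sup>2)" by (rule
      complex_norm_square[symmetric])
  finally show ?thesis unfolding orient_def V by (simp only:) simp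
qed

lemma orient_down: "orient (V0 m n) (V1 (m + 1) (n + 1)) (V1 m n) = (norm (a * (1 - \<omega>)))\<^sup>2 * Im \<omega>"
proof -
  have V: "V1 (m + 1) (n + 1) - V0 m n = a * (1 - \<omega>) * \<omega>" "V1 m n - V0 m n = - (a * (1 - \<omega>))"
    by (simp_all add: VE_defs lat_eq algebra_simps power2_eq_square omega_mult)
  have "cnj (a * (1 - \<omega>) * \<omega>) * (- (a * (1 - \<omega>))) = - ((a * (1 - \<omega>)) * cnj (a * (1 - \<omega>)) * cnj \<omega>)"
    by (simp add: mult_ac)
  also have "(a * (1 - \<omega>)) * cnj (a * (1 - \<omega>)) = of_real ((norm (a * (1 - \<omega>)))\<^sup>2)" by (rule
      complex_norm_square[symmetric])
  finally show ?thesis unfolding orient_def V by (simp only:) simp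
qed

lemma in_segmentI: "0 \<le> t \<Longrightarrow> t \<le> 1 \<Longrightarrow> z = x + of_real t * (y - x) \<Longrightarrow> z \<in> closed_segment x y" for x y z :: complex
  unfolding in_segment by (intro exI[of _ t]) (simp add: scaleR_conv_of_real algebra_simps)

lemma triangle_sum:
  assumes z: "z \<notin> bad_set"
  shows "Sum_any (\<lambda>x. T_up z x + T_down z x) = of_real (sgn (Im \<omega>))"
proof -
  obtain X Y :: real where XY:
    "\<And>m n. z = V2 m n + of_real (X - of_int m) * (V0 m n - V2 m n) + of_real (Y - of_int n - (X - of_int m)) * (V1
        m n - V2 m n)"
    using lattice_coordinates[of z] by metis
  \<comment> \<open>Integral \<open>X\<close>, \<open>Y - X\<close> or \<open>Y\<close> would put
    \<open>z\<close> on one of the three families of lines of the triangular lattice. In each case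
    the free index is a floor chosen so that \<open>z\<close> falls on a segment between two
    vertices, contradicting genericity.\<close>
  have X: "X \<noteq> of_int m" for m
  proof
    assume m: "X = of_int m"
    define n where "n = m + \<lfloor>Y - X\<rfloor>"
    have t: "0 \<le> Y - of_int n" "Y - of_int n \<le> 1" using m by (auto simp: n_def) linarith+
    have "z = V2 m n + of_real (Y - of_int n) * (V1 m n - V2 m n)" using XY[of m n] m by simp
    then have "z \<in> closed_segment (V2 m n) (V1 m n)" using in_segmentI t by blast
    then show False using segment_bad[OF z] by simp
  qed
  have YX: "Y - X \<noteq> of_int k" for k
  proof
    assume k: "Y - X = of_int k"
    define m where "m = \<lfloor>X\<rfloor>"
    define n where "n = m + k"
    have t: "0 \<le> X - of_int m" "X - of_int m \<le> 1" by (auto simp: m_def) linarith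
    have "Y - of_int n - (X - of_int m) = 0" using k by (simp add: n_def)
    then have "z = V2 m n + of_real (X - of_int m) * (V0 m n - V2 m n)" using XY[of m n] by simp
    then have "z \<in> closed_segment (V2 m n) (V0 m n)" using in_segmentI t by blast
    then show False using segment_bad[OF z] by simp
  qed
  have Y: "Y \<noteq> of_int n" for n
  proof
    assume n: "Y = of_int n"
    define m where "m = \<lfloor>X\<rfloor>"
    have t: "0 \<le> X - of_int m" "X - of_int m \<le> 1" by (auto simp: m_def) linarith
    have "z = V2 m n + of_real (X - of_int m) * (V0 m n - V1 m n)" using XY[of m n] n by (simp add: algebra_simps)
    also have "V0 m n - V1 m n = V2 (m + 1) n - V2 m n" by (simp add: VE_defs lat_eq algebra_simps)
    finally have "z \<in> closed_segment (V2 m n) (V2 (m + 1) n)" using in_segmentI t by blast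
    then show False using segment_bad[OF z] by simp
  qed
  \<comment> \<open>The index of the parallelogram that contains \<open>z\<close>. The sign of
    \<open>?s m0 + ?t m0 n0 - 1\<close> then selects the upward or the downward triangle.\<close>
  define m0 where "m0 = \<lfloor>X\<rfloor>"
  define n0 where "n0 = m0 + \<lfloor>Y - X\<rfloor>"
  let ?s = "\<lambda>m. X - of_int m" and ?t = "\<lambda>m n. Y - of_int n - (X - of_int m)"
  have idx: "m = m0 \<and> n = n0" if "0 \<le> ?s m" "?s m \<le> 1" "0 \<le> ?t m n" "?t m n \<le> 1" for m n
  proof -
    have "?s m \<noteq> 1" using X[of "m + 1"] by simp
    then have "m = m0" using that(1,2) unfolding m0_def by (intro floor_unique[symmetric]) auto
    have "?t m n \<noteq> 1" using YX[of "n - m + 1"] by (simp add: algebra_simps)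
    then have "\<lfloor>Y - X\<rfloor> = n - m" using that(3,4) by (intro floor_unique) auto
    with \<open>m = m0\<close> show ?thesis by (simp add: n0_def)
  qed
  have up: "0 \<le> ?s m \<and> 0 \<le> ?t m n \<and> ?s m + ?t m n \<le> 1" if "T_up z (m, n) \<noteq> 0" for m n
  proof -
    have "z \<in> convex hull {V0 m n, V1 m n, V2 m n}" using that wn_triangle_outside by (force simp: T_up_def)
    then obtain x y w where x: "0 \<le> x" "0 \<le> y" "0 \<le> w" "x + y + w = 1"
      "z = x *\<^sub>R V0 m n + y *\<^sub>R V1 m n + w *\<^sub>R V2 m n" by (auto simp: convex_hull_3)
    have w: "w = 1 - x - y" using x(4) by simp
    have "z = V2 m n + (of_real x * (V0 m n - V2 m n) + of_real y * (V1 m n - V2 m n))"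
      unfolding x(5) w by (simp add: scaleR_conv_of_real algebra_simps)
    then have "of_real (?s m) * (V0 m n - V2 m n) + of_real (?t m n) * (V1 m n - V2 m n) = of_real x * (V0 m n -
        V2 m n) + of_real y * (V1 m n - V2 m n)"
      using XY[of m n] by (metis add.assoc add_left_cancel)
    from coordinates_unique[OF this] show ?thesis using x by linarith
  qed
  have Yp: "V1 (m + 1) (n + 1) = V0 m n + V1 m n - V2 m n" for m n
    by (simp add: VE_defs lat_eq algebra_simps power2_eq_square omega_mult)
  have down: "?s m \<le> 1 \<and> ?t m n \<le> 1 \<and> 1 \<le> ?s m + ?t m n" if "T_down z (m, n) \<noteq> 0" for m n
  proof -
    have "z \<in> convex hull {V0 m n, V1 (m + 1) (n + 1), V1 m n}" using that wn_triangle_outside by (force simp: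
        T_down_def)
    then obtain x y w where x: "0 \<le> x" "0 \<le> y" "0 \<le> w" "x + y + w = 1"
      "z = x *\<^sub>R V0 m n + y *\<^sub>R V1 (m + 1) (n + 1) + w *\<^sub>R V1 m n" by (auto simp: convex_hull_3)
    have w: "w = 1 - x - y" using x(4) by simp
    have "z = V2 m n + (of_real (x + y) * (V0 m n - V2 m n) + of_real (1 - x) * (V1 m n - V2 m n))"
      unfolding x(5) w Yp by (simp add: scaleR_conv_of_real algebra_simps)
    then have "of_real (?s m) * (V0 m n - V2 m n) + of_real (?t m n) * (V1 m n - V2 m n) = of_real (x + y) * (V0 m
        n - V2 m n) + of_real (1 - x) * (V1 m n - V2 m n)"
      using XY[of m n] by (metis add.assoc add_left_cancel)
    from coordinates_unique[OF this] show ?thesis using x by linarith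
  qed
  have s0: "0 < ?s m0" "?s m0 < 1" "0 < ?t m0 n0" "?t m0 n0 < 1" "?s m0 + ?t m0 n0 \<noteq> 1"
  proof -
    have "of_int m0 \<le> X" "X < of_int m0 + 1" unfolding m0_def by linarith+
    then show "0 < ?s m0" "?s m0 < 1" using X[of m0] by auto
    have "of_int (n0 - m0) \<le> Y - X" "Y - X < of_int (n0 - m0) + 1" unfolding n0_def by auto
    then show "0 < ?t m0 n0" "?t m0 n0 < 1" using YX[of "n0 - m0"] by auto
    show "?s m0 + ?t m0 n0 \<noteq> 1" using Y[of "n0 + 1"] by auto
  qed
  have b: "(norm (a * (1 - \<omega>)))\<^sup>2 > 0" using a_nonzero omega_neq_1 by simp
  have sg: "orient (V0 m n) (V1 m n) (V2 m n) \<noteq> 0" "sgn (orient (V0 m n) (V1 m n) (V2 m n)) = sgn (Im \<omega>)"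
    "orient (V0 m n) (V1 (m + 1) (n + 1)) (V1 m n) \<noteq> 0" "sgn (orient (V0 m n) (V1 (m + 1) (n + 1)) (V1 m n)) = sgn
        (Im \<omega>)" for m n
    using b omega_facts(3) unfolding orient_up orient_down sgn_mult by auto
  have "T_up z (m0, n0) + T_down z (m0, n0) = of_real (sgn (Im \<omega>))"
  proof (cases "?s m0 + ?t m0 n0 < 1")
    case True
    then have "T_down z (m0, n0) = 0" using down[of m0 n0] by fastforce
    moreover have "T_up z (m0, n0) = of_real (sgn (orient (V0 m0 n0) (V1 m0 n0) (V2 m0 n0)))"
      unfolding T_up_def prod.case
    proof (rule wn_triangle_inside[OF sg(1)])
      show "0 < ?s m0" "0 < ?t m0 n0" "0 < 1 - ?s m0 - ?t m0 n0" "?s m0 + ?t m0 n0 + (1 - ?s m0 - ?t m0 n0) = 1"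
        using s0 True by auto
      show "z = of_real (?s m0) * V0 m0 n0 + of_real (?t m0 n0) * V1 m0 n0 + of_real (1 - ?s m0 - ?t m0 n0) * V2
      m0 n0"
        by (subst XY[of m0 n0]) (simp add: algebra_simps)
    qed
    ultimately show ?thesis using sg(2) by simp
  next
    case False
    then have F: "?s m0 + ?t m0 n0 > 1" using s0(5) by linarith
    then have "T_up z (m0, n0) = 0" using up[of m0 n0] by fastforce
    moreover have "T_down z (m0, n0) = of_real (sgn (orient (V0 m0 n0) (V1 (m0 + 1) (n0 + 1)) (V1 m0 n0)))"
      unfolding T_down_def prod.case
    proof (rule wn_triangle_inside[OF sg(3)])
      show "0 < 1 - ?t m0 n0" "0 < ?s m0 + ?t m0 n0 - 1" "0 < 1 - ?s m0" "1 - ?t m0 n0 + (?s m0 + ?t m0 n0 - 1) +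
      (1 - ?s m0) = 1"
        using s0 F by auto
      show "z = of_real (1 - ?t m0 n0) * V0 m0 n0 + of_real (?s m0 + ?t m0 n0 - 1) * V1 (m0 + 1) (n0 + 1) +
      of_real (1 - ?s m0) * V1 m0 n0"
        unfolding Yp by (subst XY[of m0 n0]) (simp add: algebra_simps)
    qed
    ultimately show ?thesis using sg(4) by simp
  qed
  moreover have "T_up z (m, n) + T_down z (m, n) = 0" if "(m, n) \<noteq> (m0, n0)" for m n
  proof -
    have "T_up z (m, n) = 0" using up[of m n] idx[of m n] that by force
    moreover have "T_down z (m, n) = 0" using down[of m n] idx[of m n] that by force
    ultimately show ?thesis by simp
  qed
  ultimately have eq: "(\<lambda>x. T_up z x + T_down z x) = (\<lambda>x. if x = (m0, n0) then of_real (sgn (Im \<omega>)) else 0)"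
    by (auto simp: fun_eq_iff)
  show ?thesis unfolding eq by (rule Sum_any.delta)
qed

text \<open>Every copy containing \<open>z\<close> contributes the same nonzero value to the sum,
  and every other copy contributes 0. As the total equals one such value, exactly one copy contains
  \<open>z\<close>.\<close>

lemma generic_unique:
  assumes z: "z \<notin> bad_set"
  shows "\<exists>!x. z \<in> open_region (g (fst x) (snd x) \<circ> p)"
proof -
  define \<sigma> :: complex where "\<sigma> = of_real (sgn (Im \<omega>))"
  have \<sigma>: "\<sigma> \<noteq> 0" using omega_facts(3) by (simp add: \<sigma>_def sgn_zero_iff)
  have T: "T_hex z x = (if z \<in> open_region (g (fst x) (snd x) \<circ> p) then \<sigma> else 0)" for x
  proof -
    let ?q = "g (fst x) (snd x) \<circ> p"
    have "z \<notin> bd ?q" using bd_copy_subset_bad z by blast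
    then have "z \<in> outside (bd ?q)" if "z \<notin> open_region ?q"
      using simple_hexagon_Jordan(6)[OF simple_copy[of "fst x" "snd x"]] that by blast
    then show ?thesis
      using rot_hexagon_winding_number[OF rot_copy[of "fst x" "snd x"], of z]
        winding_number_zero_in_outside[of "boundary_path ?q" z]
      by (auto simp: T_hex_def split_beta \<sigma>_def)
  qed
  let ?A = "{x. z \<in> open_region (g (fst x) (snd x) \<circ> p)}"
  have "{x. T_hex z x \<noteq> 0} = ?A" using T \<sigma> by auto
  then have "Sum_any (T_hex z) = (\<Sum>x\<in>?A. T_hex z x)" by (simp add: Sum_any.expand_set)
  also have "\<dots> = (\<Sum>x\<in>?A. \<sigma>)" by (rule sum.cong) (auto simp: T)
  also have "\<dots> = of_nat (card ?A) * \<sigma>" by simp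
  finally have "of_nat (card ?A) * \<sigma> = \<sigma>" using hex_sum[OF z] triangle_sum[OF z] by (simp add: \<sigma>_def)
  then have "card ?A = 1" using \<sigma> by simp
  then obtain y where "?A = {y}" by (auto simp: card_1_singleton_iff)
  then have "\<And>x. z \<in> open_region (g (fst x) (snd x) \<circ> p) \<longleftrightarrow> x = y" by blast
  then show ?thesis by metis
qed

end

section \<open>The copies tile the plane\<close>

definition rot_copies :: "complex \<Rightarrow> hexagon \<Rightarrow> hexagon set" where
  "rot_copies \<omega> p = {rot_map \<omega> p m n \<circ> p | m n. True}"

text \<open>Supplies the corner condition of \<open>vertex_cover\<close>: each of the three edges
  from \<open>v\<close> to \<open>x\<close>, \<open>y\<close>, \<open>w\<close> borders two of the
  hexagons.\<close>

lemma three_hexagons_at_vertex: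
  assumes ne: "A \<noteq> B" "A \<noteq> C" "B \<noteq> C"
    and i: "A i = v" "A (i + 1) = x" "A (i - 1) = y" and j: "B j = v" "B (j + 1) = y" "B (j - 1) = w"
    and k: "C k = v" "C (k + 1) = w" "C (k - 1) = x" and q: "q \<in> {A, B, C}"
  shows "\<exists>i. v = q i \<and> (\<forall>j\<in>{i, i - 1}. \<exists>q'\<in>{A, B, C}. q' \<noteq> q \<and> side q j \<in> sides q')"
proof -
  have si: "side A i = closed_segment v x" "side A (i - 1) = closed_segment v y"
    "side B j = closed_segment v y" "side B (j - 1) = closed_segment v w"
    "side C k = closed_segment v w" "side C (k - 1) = closed_segment v x"
    unfolding side_def diff_add_cancel i j k by (simp_all add: closed_segment_commute del: closed_segment_eq)
  have mem: "side q x \<in> sides q" for q x unfolding sides_def by blast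
  have s: "closed_segment v x \<in> sides A" "closed_segment v y \<in> sides A" "closed_segment v y \<in> sides B"
    "closed_segment v w \<in> sides B" "closed_segment v w \<in> sides C" "closed_segment v x \<in> sides C"
    using si mem by metis+
  have "\<exists>i. v = A i \<and> (\<forall>j\<in>{i, i - 1}. \<exists>q'\<in>{A, B, C}. q' \<noteq> A \<and> side A j \<in> sides q')"
    using i(1) si(1,2) s ne by (intro exI[of _ i]) auto
  moreover have "\<exists>i. v = B i \<and> (\<forall>j\<in>{i, i - 1}. \<exists>q'\<in>{A, B, C}. q' \<noteq> B \<and> side B j \<in> sides q')"
    using j(1) si(3,4) s ne by (intro exI[of _ j]) auto
  moreover have "\<exists>i. v = C i \<and> (\<forall>j\<in>{i, i - 1}. \<exists>q'\<in>{A, B, C}. q' \<noteq> C \<and> side C j \<in> sides q')"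
    using k(1) si(5,6) s ne by (intro exI[of _ k]) auto
  ultimately show ?thesis using q by blast
qed

context rot_hex
begin

abbreviation "tile m n \<equiv> g m n \<circ> p"

text \<open>An overlap would be a nonempty open set and would contain a generic point lying in two
  copies.\<close>

lemma tiles_disjoint:
  assumes "(m, n) \<noteq> (m', n')"
  shows "open_region (tile m n) \<inter> open_region (tile m' n') = {}"
proof (rule ccontr)
  assume "\<not> ?thesis"
  moreover have "open (open_region (tile m n) \<inter> open_region (tile m' n'))"
    using simple_hexagon_Jordan(1)[OF simple_copy] by blast
  ultimately obtain z where "z \<in> open_region (tile m n)" "z \<in> open_region (tile m' n')" "z \<notin> bad_set"
    using generic_point by blast
  then show False using generic_unique[of z] assms by (metis fst_conv snd_conv)
qed

lemma tile_inj: "tile m n = tile m' n' \<longleftrightarrow> m = m' \<and> n = n'"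
proof
  assume eq: "tile m n = tile m' n'"
  show "m = m' \<and> n = n'"
  proof (rule ccontr)
    assume "\<not> (m = m' \<and> n = n')"
    then have "open_region (tile m n) \<inter> open_region (tile m' n') = {}" by (intro tiles_disjoint) auto
    then show False using simple_hexagon_Jordan(2)[OF simple_copy[of m n]] unfolding eq by simp
  qed
qed simp

lemma copies_disjoint:
  assumes "q \<in> rot_copies \<omega> p" "q' \<in> rot_copies \<omega> p" "q \<noteq> q'"
  shows "open_region q \<inter> open_region q' = {}"
proof -
  obtain m n m' n' where "q = tile m n" "q' = tile m' n'" using assms unfolding rot_copies_def by blast
  then show ?thesis using tiles_disjoint[of m n m' n'] assms(3) by blast
qed

lemma simple_copies: "q \<in> rot_copies \<omega> p \<Longrightarrow> simple_hexagon q"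
  using simple_copy unfolding rot_copies_def by blast

lemma tile_in_copies: "tile m n \<in> rot_copies \<omega> p"
  unfolding rot_copies_def by blast

lemma g_center: "g m n c = c + lat m n"
  by (simp add: rot_map_def)

lemma tile_near:
  obtains D where "0 < D" "\<And>m n w. w \<in> region (tile m n) \<Longrightarrow> norm (w - (c + lat m n)) \<le> D"
proof -
  obtain D where D: "0 < D" "\<And>w. w \<in> region p \<Longrightarrow> dist c w \<le> D"
    using region_closed_bounded(2)[OF simple] bounded_subset_ballD[of "region p" c] by (metis less_imp_le mem_ball
        subsetD)
  have "norm (w - (c + lat m n)) \<le> D" if "w \<in> region (tile m n)" for m n w
  proof -
    obtain v where v: "v \<in> region p" "w = g m n v" using \<open>w \<in> region (tile m n)\<close> region_plane_isometry[OF
        g_isometry] by blast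
    have "norm (w - (c + lat m n)) = dist (g m n c) (g m n v)" unfolding g_center v by (simp add: dist_norm
        norm_minus_commute)
    also have "\<dots> = dist c v" using g_isometry unfolding plane_isometry_def by blast
    finally show ?thesis using D v by simp
  qed
  with D that show thesis by blast
qed

lemma tiles_locally_finite: "finite {(m, n). region (tile m n) \<inter> ball z 1 \<noteq> {}}"
proof -
  obtain D where D: "\<And>m n w. w \<in> region (tile m n) \<Longrightarrow> norm (w - (c + lat m n)) \<le> D" using tile_near by metis
  have "norm (z - (c + lat m n)) \<le> D + 1" if "w \<in> region (tile m n)" "w \<in> ball z 1" for m n w
  proof -
    have "norm (z - (c + lat m n)) \<le> norm (z - w) + norm (w - (c + lat m n))"
      using norm_triangle_ineq[of "z - w" "w - (c + lat m n)"] by (simp add: algebra_simps)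
    then show ?thesis using D[OF that(1)] that(2) by (simp add: dist_norm)
  qed
  then have "{(m, n). region (tile m n) \<inter> ball z 1 \<noteq> {}} \<subseteq> {(m, n). norm (z - (c + lat m n)) \<le> D + 1}" by blast
  then show ?thesis using finite_lattice_near finite_subset by blast
qed

text \<open>By local finiteness the uncovered part of a small ball is open, so if nonempty it
  contains a generic point, which lies in some copy.\<close>

lemma tiles_cover: "\<exists>m n. z \<in> region (tile m n)"
proof (rule ccontr)
  assume none: "\<not> ?thesis"
  define F where "F = {(m, n). region (tile m n) \<inter> ball z 1 \<noteq> {}}"
  define K where "K = (\<Union>x\<in>F. region (tile (fst x) (snd x)))"
  have "closed K" unfolding K_def F_def using tiles_locally_finite region_closed_bounded(1)[OF simple_copy] by
      (intro closed_UN) auto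
  then have "open (ball z 1 - K)" by (simp add: open_Diff)
  moreover have "z \<in> ball z 1 - K" using none unfolding K_def by auto
  ultimately obtain w where w: "w \<in> ball z 1 - K" "w \<notin> bad_set" using generic_point by blast
  then obtain m n where "w \<in> open_region (tile m n)" using generic_unique[of w] by blast
  then have "w \<in> region (tile m n)" using open_region_subset by blast
  moreover from this have "(m, n) \<in> F" using w unfolding F_def by blast
  ultimately show False using w unfolding K_def by force
qed

lemma tile_corners:
  "\<exists>i. tile m n i = V0 m n \<and> tile m n (i + 1) = E0 m n \<and> tile m n (i - 1) = E2 m n"
  "\<exists>i. tile m n i = E0 m n \<and> tile m n (i + 1) = V1 m n \<and> tile m n (i - 1) = V0 m n"
  "\<exists>i. tile m n i = V1 m n \<and> tile m n (i + 1) = E1 m n \<and> tile m n (i - 1) = E0 m n"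
  "\<exists>i. tile m n i = E1 m n \<and> tile m n (i + 1) = V2 m n \<and> tile m n (i - 1) = V1 m n"
  "\<exists>i. tile m n i = V2 m n \<and> tile m n (i + 1) = E2 m n \<and> tile m n (i - 1) = E1 m n"
  "\<exists>i. tile m n i = E2 m n \<and> tile m n (i + 1) = V0 m n \<and> tile m n (i - 1) = V2 m n"
proof -
  have ex: "(\<exists>i::6. P i) \<longleftrightarrow> P 0 \<or> P 1 \<or> P 2 \<or> P 3 \<or> P 4 \<or> P 5" for P by (metis exhaust_6)
  have minus: "- 1 = (5::6)" by simp
  show "\<exists>i. tile m n i = V0 m n \<and> tile m n (i + 1) = E0 m n \<and> tile m n (i - 1) = E2 m n"
    "\<exists>i. tile m n i = E0 m n \<and> tile m n (i + 1) = V1 m n \<and> tile m n (i - 1) = V0 m n"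
    "\<exists>i. tile m n i = V1 m n \<and> tile m n (i + 1) = E1 m n \<and> tile m n (i - 1) = E0 m n"
    "\<exists>i. tile m n i = E1 m n \<and> tile m n (i + 1) = V2 m n \<and> tile m n (i - 1) = V1 m n"
    "\<exists>i. tile m n i = V2 m n \<and> tile m n (i + 1) = E2 m n \<and> tile m n (i - 1) = E1 m n"
    "\<exists>i. tile m n i = E2 m n \<and> tile m n (i + 1) = V0 m n \<and> tile m n (i - 1) = V2 m n"
    unfolding ex by (cases rule: omega_powi_cases[of "m + n"]; simp add: copy_corners minus)+
qed

lemma corners_tile: "corners (tile m n) = {V0 m n, E0 m n, V1 m n, E1 m n, V2 m n, E2 m n}"
  unfolding corners_def UNIV_6
  by (cases rule: omega_powi_cases[of "m + n"]) (simp_all add: copy_corners insert_commute)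

lemma sides_tile: "sides (tile m n) =
  {closed_segment (V0 m n) (E0 m n), closed_segment (E0 m n) (V1 m n), closed_segment (V1 m n) (E1 m n),
   closed_segment (E1 m n) (V2 m n), closed_segment (V2 m n) (E2 m n), closed_segment (E2 m n) (V0 m n)}"
  unfolding sides_def UNIV_6 side_def
  by (cases rule: omega_powi_cases[of "m + n"]) (simp_all add: copy_corners insert_commute del: closed_segment_eq)

lemma V0_shared: "V1 (m + 1) n = V0 m n" "V2 (m + 1) (n + 1) = V0 m n"
  using vertex_identities(1)[of m n] by (auto simp: VE_defs lat_eq algebra_simps)

lemma E0_shared: "E1 (m + 1) (n + 1) = E0 m n" "E2 m (n + 1) = E0 m n"
  by (rule vertex_identities)+

lemma side_shared:
  assumes "s \<in> sides (tile m n)"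
  obtains m' n' where "(m', n') \<noteq> (m, n)" "s \<in> sides (tile m' n')"
proof -
  have V: "V0 (m - 1) n = V1 m n" "V0 (m - 1) (n - 1) = V2 m n" "V1 m (n - 1) = V2 m n"
    "V1 (m + 1) (n + 1) = V0 m (n + 1)" "V2 (m + 1) (n + 1) = V0 m n" "V2 m (n + 1) = V1 m n" "V1 (m + 1) n = V0 m n"
    using V0_shared[of "m - 1" n] V0_shared[of "m - 1" "n - 1"] V0_shared[of m n] V0_shared[of m "n + 1"]
      vertex_identities(2)[of m n]
    by simp_all
  have E: "E1 (m + 1) (n + 1) = E0 m n" "E2 m (n + 1) = E0 m n" "E0 (m - 1) (n - 1) = E1 m n" "E2 (m - 1) n = E1 m n"
    "E0 m (n - 1) = E2 m n" "E1 (m + 1) n = E2 m n"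
    using E0_shared[of m n] E0_shared[of "m - 1" "n - 1"] E0_shared[of m "n - 1"] by simp_all
  consider "s = closed_segment (V0 m n) (E0 m n)" | "s = closed_segment (E0 m n) (V1 m n)" | "s = closed_segment
      (V1 m n) (E1 m n)"
    | "s = closed_segment (E1 m n) (V2 m n)" | "s = closed_segment (V2 m n) (E2 m n)" | "s = closed_segment (E2 m
        n) (V0 m n)"
    using assms unfolding sides_tile by blast
  then show thesis
  proof cases
    case 1
    then show ?thesis by (intro that[of "m + 1" "n + 1"]) (simp_all add: sides_tile V E doubleton_eq_iff)
  next
    case 2
    then show ?thesis by (intro that[of m "n + 1"]) (simp_all add: sides_tile V E doubleton_eq_iff)
  next
    case 3
    then show ?thesis by (intro that[of "m - 1" n]) (simp_all add: sides_tile V E doubleton_eq_iff)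
  next
    case 4
    then show ?thesis by (intro that[of "m - 1" "n - 1"]) (simp_all add: sides_tile V E doubleton_eq_iff)
  next
    case 5
    then show ?thesis by (intro that[of m "n - 1"]) (simp_all add: sides_tile V E doubleton_eq_iff)
  next
    case 6
    then show ?thesis by (intro that[of "m + 1" n]) (simp_all add: sides_tile V E doubleton_eq_iff)
  qed
qed

lemma side_neighbour:
  assumes "q \<in> rot_copies \<omega> p"
  obtains q' j where "q' \<in> rot_copies \<omega> p" "q' \<noteq> q" "side q i = side q' j"
proof -
  obtain m n where q: "q = tile m n" using assms unfolding rot_copies_def by blast
  have "side q i \<in> sides (tile m n)" unfolding q sides_def by blast
  then obtain m' n' where "(m', n') \<noteq> (m, n)" "side q i \<in> sides (tile m' n')" using side_shared by blast
  then show thesis using that[of "tile m' n'"] tile_in_copies tile_inj q unfolding sides_def by auto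
qed

text \<open>\<open>q\<close> and its neighbour across the side already fill a disc around
  \<open>z\<close>. A further tile containing \<open>z\<close> would have inner points in this disc
  and overlap one of the two.\<close>

lemma open_side_cover:
  assumes q: "q \<in> rot_copies \<omega> p" and z: "z \<in> side q i" "z \<noteq> q i" "z \<noteq> q (i + 1)"
    and q': "q' \<in> rot_copies \<omega> p" "q' \<noteq> q" "z \<in> region q'"
  shows "side q i \<in> sides q'"
proof -
  obtain q1 j where q1: "q1 \<in> rot_copies \<omega> p" "q1 \<noteq> q" "side q i = side q1 j" using side_neighbour[OF q] by metis
  obtain r where r: "0 < r" "ball z r \<subseteq> region q \<union> region q1"
    using shared_side_cover[OF simple_copies[OF q] simple_copies[OF q1(1)] copies_disjoint[OF q q1(1)] q1(3) z]
        q1(2) by metis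
  have "q' = q1"
  proof (rule ccontr)
    assume "q' \<noteq> q1"
    then have "open_region q' \<inter> region q = {}" "open_region q' \<inter> region q1 = {}"
      using open_region_Int_region_empty[OF simple_copies[OF q'(1)]] simple_copies copies_disjoint q q1 q' by auto
    moreover have "open_region q' \<inter> ball z r \<noteq> {}"
      using closure_meets_ball[OF _ r(1)] closure_open_region[OF simple_copies[OF q'(1)]] q'(3) by blast
    ultimately show False using r(2) by blast
  qed
  then show ?thesis unfolding q1(3) sides_def by blast
qed

lemma copies_side_to_side: "side_to_side (rot_copies \<omega> p)"
  unfolding side_to_side_def pairwise_def
proof (intro ballI impI set_eqI iffI)
  fix q q' z assume q: "q \<in> rot_copies \<omega> p" "q' \<in> rot_copies \<omega> p" "q \<noteq> q'"
  show "z \<in> region q \<inter> region q'" if "z \<in> (corners q \<inter> corners q') \<union> \<Union>(sides q \<inter> sides q')"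
  proof -
    have "corners x \<subseteq> region x" "\<Union>(sides x) \<subseteq> region x" for x
      using corner_in_region side_subset_bd bd_subset_region unfolding corners_def sides_def by blast+
    then show ?thesis using that by blast
  qed
  assume z: "z \<in> region q \<inter> region q'"
  have bd: "z \<in> bd q" if "q \<in> rot_copies \<omega> p" "q' \<in> rot_copies \<omega> p" "q \<noteq> q'" "z \<in> region q" "z \<in> region q'" for q q'
    using open_region_Int_region_empty[OF simple_copies simple_copies copies_disjoint] that unfolding region_def
        by blast
  have "z \<in> bd q" "z \<in> bd q'" using bd[of q q'] bd[of q' q] q z by auto
  then obtain i j where i: "z \<in> side q i" and j: "z \<in> side q' j" by (auto simp: path_image_boundary_path)
  show "z \<in> (corners q \<inter> corners q') \<union> \<Union>(sides q \<inter> sides q')"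
  proof (cases "z = q i \<or> z = q (i + 1)")
    case False
    then have "side q i \<in> sides q'" using open_side_cover[OF q(1) i] q z by auto
    then show ?thesis using i unfolding sides_def by blast
  next
    case corner: True
    show ?thesis
    proof (cases "z = q' j \<or> z = q' (j + 1)")
      case False
      then have "side q' j \<in> sides q" using open_side_cover[OF q(2) j] q z by auto
      then show ?thesis using j unfolding sides_def by blast
    next
      case True
      with corner show ?thesis unfolding corners_def by blast
    qed
  qed
qed

lemma copies_region_inj: "inj_on region (rot_copies \<omega> p)"
proof (rule inj_onI)
  fix q q' assume q: "q \<in> rot_copies \<omega> p" "q' \<in> rot_copies \<omega> p" "region q = region q'"
  then have "open_region q = open_region q'" using interior_region[OF simple_copies] by metis
  then show "q = q'" using copies_disjoint[of q q'] simple_hexagon_Jordan(2)[OF simple_copies] q by blast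
qed

text \<open>Up to a change of index every vertex is some \<open>V0 m n\<close> or
  \<open>E0 m n\<close>. The three copies listed there fill a disc by \<open>vertex_cover\<close>,
  which leaves no room for a fourth.\<close>

lemma copies_degree:
  assumes v: "v \<in> vertices (rot_copies \<omega> p)"
  shows "vertex_degree (region ` rot_copies \<omega> p) v = 3"
proof -
  obtain m n where "v = V0 m n \<or> v = E0 m n"
  proof -
    obtain m n where "v \<in> corners (tile m n)" using v unfolding vertices_def rot_copies_def by blast
    then consider "v = V0 m n" | "v = E0 m n" | "v = V0 (m - 1) n" | "v = E0 (m - 1) (n - 1)" | "v = V0 (m - 1) (n
        - 1)" | "v = E0 m (n - 1)"
      using V0_shared[of "m - 1" n] V0_shared[of "m - 1" "n - 1"] E0_shared[of "m - 1" "n - 1"] E0_shared[of m "n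
      - 1"]
      unfolding corners_tile by auto
    then show thesis using that by cases auto
  qed
  then obtain F where F: "F \<subseteq> rot_copies \<omega> p" "card F = 3"
    "\<And>q. q \<in> F \<Longrightarrow> \<exists>i. v = q i \<and> (\<forall>j\<in>{i, i - 1}. \<exists>q'\<in>F. q' \<noteq> q \<and> side q j \<in> sides q')"
  proof
    assume v: "v = V0 m n"
    let ?A = "tile m n" and ?B = "tile (m + 1) n" and ?C = "tile (m + 1) (n + 1)"
    have ne: "?A \<noteq> ?B" "?A \<noteq> ?C" "?B \<noteq> ?C" by (simp_all only: tile_inj, simp_all)
    have E: "E1 (m + 1) n = E2 m n" "E2 (m + 1) (n + 1) = E0 (m + 1) n" "E1 (m + 1) (n + 1) = E0 m n"
      using E0_shared[of m n] E0_shared[of m "n - 1"] E0_shared[of "m + 1" n] by simp_all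
    obtain i where i: "?A i = v" "?A (i + 1) = E0 m n" "?A (i - 1) = E2 m n" using tile_corners(1) v by metis
    obtain j where j: "?B j = v" "?B (j + 1) = E2 m n" "?B (j - 1) = E0 (m + 1) n"
      using tile_corners(3)[of "m + 1" n] v V0_shared[of m n] E by metis
    obtain k where k: "?C k = v" "?C (k + 1) = E0 (m + 1) n" "?C (k - 1) = E0 m n"
      using tile_corners(5)[of "m + 1" "n + 1"] v V0_shared[of m n] E by metis
    show thesis
      by (rule that[of "{?A, ?B, ?C}"], use tile_in_copies in blast, use ne in simp)
        (rule three_hexagons_at_vertex[OF ne i j k])
  next
    assume v: "v = E0 m n"
    let ?A = "tile m n" and ?B = "tile (m + 1) (n + 1)" and ?C = "tile m (n + 1)"
    have ne: "?A \<noteq> ?B" "?A \<noteq> ?C" "?B \<noteq> ?C" by (simp_all only: tile_inj, simp_all)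
    have V: "V2 (m + 1) (n + 1) = V0 m n" "V1 (m + 1) (n + 1) = V0 m (n + 1)" "V2 m (n + 1) = V1 m n"
      using V0_shared[of m n] V0_shared[of m "n + 1"] vertex_identities(2)[of m n] by simp_all
    obtain i where i: "?A i = v" "?A (i + 1) = V1 m n" "?A (i - 1) = V0 m n" using tile_corners(2) v by metis
    obtain j where j: "?B j = v" "?B (j + 1) = V0 m n" "?B (j - 1) = V0 m (n + 1)"
      using tile_corners(4)[of "m + 1" "n + 1"] v E0_shared[of m n] V by metis
    obtain k where k: "?C k = v" "?C (k + 1) = V0 m (n + 1)" "?C (k - 1) = V1 m n"
      using tile_corners(6)[of m "n + 1"] v E0_shared[of m n] V by metis
    show thesis
      by (rule that[of "{?A, ?B, ?C}"], use tile_in_copies in blast, use ne in simp)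
        (rule three_hexagons_at_vertex[OF ne i j k])
  qed
  have fin: "finite F" "F \<noteq> {}" using F(2) card.infinite by fastforce+
  obtain r where r: "0 < r" "ball v r \<subseteq> \<Union>(region ` F)"
    using vertex_cover[OF fin _ _ F(3)] F(1) simple_copies copies_disjoint by (metis subsetD)
  have "{t \<in> region ` rot_copies \<omega> p. v \<in> t} = region ` F"
  proof (intro equalityI subsetI)
    fix t assume "t \<in> region ` F"
    then obtain q where q: "q \<in> F" "t = region q" by blast
    then have "v \<in> t" using F(3)[OF q(1)] corner_in_region by metis
    then show "t \<in> {t \<in> region ` rot_copies \<omega> p. v \<in> t}" using q F(1) by blast
  next
    fix t assume "t \<in> {t \<in> region ` rot_copies \<omega> p. v \<in> t}"
    then obtain q where q: "q \<in> rot_copies \<omega> p" "t = region q" "v \<in> region q" by blast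
    then obtain w where w: "w \<in> open_region q" "w \<in> ball v r"
      using closure_meets_ball[OF _ r(1)] closure_open_region[OF simple_copies[OF q(1)]] by blast
    then obtain q' where q': "q' \<in> F" "w \<in> region q'" using r(2) by blast
    have "q = q'"
      using open_region_Int_region_empty[OF simple_copies[OF q(1)] simple_copies copies_disjoint[OF q(1)]] q' F(1)
      w by blast
    then show "t \<in> region ` F" using q' q by blast
  qed
  moreover have "inj_on region F" using inj_on_subset[OF copies_region_inj F(1)] .
  ultimately show ?thesis unfolding vertex_degree_def using F(2) by (simp add: card_image)
qed

lemma copies_tiling: "tiling_by_copies p (rot_copies \<omega> p)"
  unfolding tiling_by_copies_def plane_tiling_def
proof (intro conjI ballI)
  show "congruent_copy p q" if "q \<in> rot_copies \<omega> p" for q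
    using that g_isometry unfolding rot_copies_def congruent_copy_def by blast
  show "inj_on region (rot_copies \<omega> p)" by (rule copies_region_inj)
  show "\<Union>(region ` rot_copies \<omega> p) = UNIV" using tiles_cover tile_in_copies by blast
  show "pairwise (\<lambda>t t'. interior t \<inter> interior t' = {}) (region ` rot_copies \<omega> p)"
    unfolding pairwise_def using copies_disjoint interior_region[OF simple_copies] by fastforce
qed

lemma copies_side_to_side_degree_3: "side_to_side_degree_3_tiling p (region ` rot_copies \<omega> p)"
  unfolding side_to_side_degree_3_tiling_def
  by (intro exI[of _ "rot_copies \<omega> p"] conjI ballI refl copies_tiling copies_side_to_side copies_degree)

end

section \<open>Vertices of degree three\<close>

text \<open>Three sectors pairwise sharing the rays \<open>d1\<close>, \<open>d2\<close>,
  \<open>d3\<close> could still lie on top of each other. Measuring angles from \<open>d1\<close>,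
  with \<open>d2\<close> at \<open>\<theta>a\<close> and \<open>d3\<close> at \<phi>, disjointness
  from the first tile leaves only the arrangement once around the vertex.\<close>

lemma sectors_at_vertex_sum_aux:
  assumes simple: "simple_hexagon qa" "simple_hexagon qb" "simple_hexagon qc"
    and disj: "open_region qa \<inter> open_region qb = {}" "open_region qa \<inter> open_region qc = {}"
    and sa: "has_sector qa v d1 \<theta>a" "d2 = d1 * cis \<theta>a"
    and sb: "has_sector qb v ub \<theta>b" "ub = d1 \<and> ub * cis \<theta>b = d3 \<or> ub = d3 \<and> ub * cis \<theta>b = d1"
    and sc: "has_sector qc v uc \<theta>c" "uc = d2 \<and> uc * cis \<theta>c = d3 \<or> uc = d3 \<and> uc * cis \<theta>c = d2"
    and ne: "d1 \<noteq> d3" "d2 \<noteq> d3"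
  shows "\<theta>a + \<theta>b + \<theta>c = 2 * pi"
proof -
  have a: "norm d1 = 1" "0 < \<theta>a" "\<theta>a < 2 * pi" and b: "norm ub = 1" "0 < \<theta>b" "\<theta>b < 2 * pi"
    and c: "norm uc = 1" "0 < \<theta>c" "\<theta>c < 2 * pi" using sa(1) sb(1) sc(1) unfolding has_sector_def by auto
  obtain Ra where Ra: "Ra > 0" "\<And>r. r \<le> Ra \<Longrightarrow> region qa \<inter> ball v r = sector v d1 \<theta>a r \<and> open_region qa \<inter> ball v r =
      open_sector v d1 \<theta>a r"
    using sa(1) unfolding has_sector_def by blast
  obtain Rb where Rb: "Rb > 0" "\<And>r. r \<le> Rb \<Longrightarrow> region qb \<inter> ball v r = sector v ub \<theta>b r \<and> open_region qb \<inter> ball v r =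
      open_sector v ub \<theta>b r"
    using sb(1) unfolding has_sector_def by blast
  obtain Rc where Rc: "Rc > 0" "\<And>r. r \<le> Rc \<Longrightarrow> region qc \<inter> ball v r = sector v uc \<theta>c r \<and> open_region qc \<inter> ball v r =
      open_sector v uc \<theta>c r"
    using sc(1) unfolding has_sector_def by blast
  define r where "r = min Ra (min Rb Rc)"
  have r: "0 < r" "r \<le> Ra" "r \<le> Rb" "r \<le> Rc" using Ra(1) Rb(1) Rc(1) by (auto simp: r_def)
  define s where "s = r / 2"
  have s: "0 < s" "s < r" using r(1) by (auto simp: s_def)
  \<comment> \<open>The open sector of the first tile contains no ray of the closed sectors of the
    other two; every wrong arrangement is refuted by exhibiting such a ray.\<close>
  have no: False if t: "0 < t" "t < \<theta>a" "0 \<le> t'" "t' \<le> \<theta>" "d1 * cis t = u * cis t'"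
    and q: "simple_hexagon q" "open_region qa \<inter> open_region q = {}" "region q \<inter> ball v r = sector v u \<theta> r" for t
        t' u \<theta> q
  proof -
    have "v + of_real s * d1 * cis t \<in> open_sector v d1 \<theta>a r" unfolding open_sector_def using s t by blast
    moreover have "v + of_real s * u * cis t' \<in> sector v u \<theta> r"
      unfolding sector_def using s t by (intro CollectI exI[of _ s] exI[of _ t']) auto
    moreover have "v + of_real s * d1 * cis t = v + of_real s * u * cis t'" using t(5) by (simp add: mult.assoc)
    ultimately show False using Ra(2)[OF r(2)] q(3) open_region_Int_region_empty[OF simple(1) q(1,2)] by auto
  qed
  note no_b = no[OF _ _ _ _ _ simple(2) disj(1) conjunct1[OF Rb(2)[OF r(3)]]]
  note no_c = no[OF _ _ _ _ _ simple(3) disj(2) conjunct1[OF Rc(2)[OF r(4)]]]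
  have d1: "d1 \<noteq> 0" using a by auto
  have "norm d3 = 1" using sb(2) b(1) a(1) by (metis mult.right_neutral norm_cis norm_mult)
  then obtain \<phi> where phi: "0 \<le> \<phi>" "\<phi> < 2 * pi" "d3 = d1 * cis \<phi>" using unit_polar_cases[OF a(1)] by metis
  have phi0: "\<phi> \<noteq> 0" using ne(1) phi(3) by auto
  have phia: "\<phi> \<noteq> \<theta>a" using ne(2) phi(3) sa(2) by auto
  have gt: "\<theta>a < \<phi>"
  proof (rule ccontr)
    assume "\<not> \<theta>a < \<phi>"
    then have "0 < \<phi>" "\<phi> < \<theta>a" using phi0 phia phi by auto
    then show False using sb(2) no_b[of \<phi> \<theta>b] no_b[of \<phi> 0] b phi(3) by auto
  qed
  have shift: "cis x = cis y \<Longrightarrow> 0 \<le> y \<Longrightarrow> y < 2 * pi \<Longrightarrow> 2 * pi \<le> x \<Longrightarrow> x < 4 * pi \<Longrightarrow> x = y + 2 * pi" for x y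
    using cis_inj_2pi[of "x - 2 * pi" y] cis_add_2pi[of "x - 2 * pi"] by simp
  have half: "0 < \<theta>a / 2" "\<theta>a / 2 < \<theta>a" using a by auto
  \<comment> \<open>The second tile runs from \<open>d3\<close> on to \<open>d1\<close>. If it ran
    from \<open>d1\<close> to \<open>d3\<close>, it would contain the middle ray of the first
    tile.\<close>
  have B: "\<phi> + \<theta>b = 2 * pi"
    using sb(2)
  proof
    assume *: "ub = d1 \<and> ub * cis \<theta>b = d3"
    then have "d1 * cis \<theta>b = d1 * cis \<phi>" using phi(3) by metis
    then have "cis \<theta>b = cis \<phi>" using d1 by simp
    then have "\<theta>b = \<phi>" using cis_inj_2pi b phi by simp
    then show ?thesis using no_b[of "\<theta>a / 2" "\<theta>a / 2"] half * gt by simp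
  next
    assume *: "ub = d3 \<and> ub * cis \<theta>b = d1"
    then have "d1 * cis (\<phi> + \<theta>b) = d1 * cis 0"
      using phi(3) by (metis cis_mult cis_zero mult.assoc mult.right_neutral)
    then have e: "cis (\<phi> + \<theta>b) = cis 0" using d1 by simp
    show ?thesis
    proof (cases "\<phi> + \<theta>b < 2 * pi")
      case True
      then show ?thesis using cis_inj_2pi[OF e] phi b by auto
    next
      case False
      then show ?thesis using shift[OF e] phi b by auto
    qed
  qed
  \<comment> \<open>Likewise the third tile runs from \<open>d2\<close> to \<open>d3\<close>; the
    other way round it would pass \<open>d1\<close> and contain the middle ray of the first
    tile.\<close>
  have C: "\<theta>c = \<phi> - \<theta>a"
    using sc(2)
  proof
    assume *: "uc = d2 \<and> uc * cis \<theta>c = d3"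
    then have "d1 * cis (\<theta>a + \<theta>c) = d1 * cis \<phi>"
      using sa(2) phi(3) by (metis cis_mult mult.assoc)
    then have e: "cis (\<theta>a + \<theta>c) = cis \<phi>" using d1 by simp
    show ?thesis
    proof (cases "\<theta>a + \<theta>c < 2 * pi")
      case True
      then show ?thesis using cis_inj_2pi[OF e] phi a c by auto
    next
      case False
      then have "\<theta>a + \<theta>c = \<phi> + 2 * pi" using shift[OF e] phi a c by auto
      then show ?thesis using gt c by auto
    qed
  next
    assume *: "uc = d3 \<and> uc * cis \<theta>c = d2"
    then have "d1 * cis (\<phi> + \<theta>c) = d1 * cis \<theta>a"
      using sa(2) phi(3) by (metis cis_mult mult.assoc)
    then have e: "cis (\<phi> + \<theta>c) = cis \<theta>a" using d1 by simp
    have sum: "\<phi> + \<theta>c = \<theta>a + 2 * pi"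
    proof (cases "\<phi> + \<theta>c < 2 * pi")
      case True
      then have "\<phi> + \<theta>c = \<theta>a" using cis_inj_2pi[OF e] phi a c by auto
      then show ?thesis using gt c by auto
    next
      case False
      then show ?thesis using shift[OF e] phi a c by auto
    qed
    have "d1 * cis (\<theta>a / 2) = uc * cis (\<theta>a / 2 + 2 * pi - \<phi>)"
    proof -
      have "uc * cis (\<theta>a / 2 + 2 * pi - \<phi>) = d1 * (cis \<phi> * cis (\<theta>a / 2 + 2 * pi - \<phi>))" using * phi(3) by (metis
      mult.assoc)
      also have "\<dots> = d1 * cis (\<theta>a / 2)" unfolding cis_mult using cis_add_2pi[of "\<theta>a / 2"] by simp
      finally show ?thesis by simp
    qed
    then have False using no_c[of "\<theta>a / 2" "\<theta>a / 2 + 2 * pi - \<phi>"] half sum phi by auto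
    then show ?thesis ..
  qed
  show ?thesis using B C by simp
qed

text \<open>The orientation of \<open>qa\<close> decides whether its sector starts at
  \<open>y1\<close> or at \<open>y2\<close>; exchanging the roles of \<open>qb\<close> and
  \<open>qc\<close> reduces the second case to the first.\<close>

lemma interior_angles_at_vertex:
  assumes simple: "simple_hexagon qa" "simple_hexagon qb" "simple_hexagon qc"
    and disj: "open_region qa \<inter> open_region qb = {}" "open_region qa \<inter> open_region qc = {}"
    and v: "qa ja = v" "qb jb = v" "qc jc = v"
    and nb: "{qa (ja - 1), qa (ja + 1)} = {y1, y2}" "{qb (jb - 1), qb (jb + 1)} = {y1, y3}" "{qc (jc - 1), qc (jc
        + 1)} = {y2, y3}"
  shows "interior_angle qa ja + interior_angle qb jb + interior_angle qc jc = 2 * pi"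
proof -
  have sec: "\<exists>u \<theta>. has_sector q v u \<theta> \<and> interior_angle q j = \<theta> \<and>
      (u = sgn (x - v) \<and> u * cis \<theta> = sgn (y - v) \<or> u = sgn (y - v) \<and> u * cis \<theta> = sgn (x - v)) \<and> sgn (x - v) \<noteq> sgn
      (y - v)"
    if h: "simple_hexagon q" "q j = v" "{q (j - 1), q (j + 1)} = {x, y}" for q j x y
  proof -
    obtain u \<theta> where u: "has_sector q (q j) u \<theta>" "u = sgn (q (j + 1) - q j) \<and> u * cis \<theta> = sgn (q (j - 1) - q j) \<or>
      u = sgn (q (j - 1) - q j) \<and> u * cis \<theta> = sgn (q (j + 1) - q j)" using corner_has_sector[OF h(1)] .
    have "q (j - 1) = x \<and> q (j + 1) = y \<or> q (j - 1) = y \<and> q (j + 1) = x" using h(3) by (auto simp: doubleton_eq_iff)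
    then show ?thesis
      using u has_sector_interior_angle[OF u(1)] corner_directions_distinct[OF h(1), of j] h(2) by metis
  qed
  obtain ua \<theta>a where a: "has_sector qa v ua \<theta>a" "interior_angle qa ja = \<theta>a"
    "ua = sgn (y1 - v) \<and> ua * cis \<theta>a = sgn (y2 - v) \<or> ua = sgn (y2 - v) \<and> ua * cis \<theta>a = sgn (y1 - v)"
    using sec[OF simple(1) v(1) nb(1)] by blast
  obtain ub \<theta>b where b: "has_sector qb v ub \<theta>b" "interior_angle qb jb = \<theta>b"
    "ub = sgn (y1 - v) \<and> ub * cis \<theta>b = sgn (y3 - v) \<or> ub = sgn (y3 - v) \<and> ub * cis \<theta>b = sgn (y1 - v)" "sgn (y1 -
        v) \<noteq> sgn (y3 - v)"
    using sec[OF simple(2) v(2) nb(2)] by blast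
  obtain uc \<theta>c where c: "has_sector qc v uc \<theta>c" "interior_angle qc jc = \<theta>c"
    "uc = sgn (y2 - v) \<and> uc * cis \<theta>c = sgn (y3 - v) \<or> uc = sgn (y3 - v) \<and> uc * cis \<theta>c = sgn (y2 - v)" "sgn (y2 -
        v) \<noteq> sgn (y3 - v)"
    using sec[OF simple(3) v(3) nb(3)] by blast
  from a(3) have "\<theta>a + \<theta>b + \<theta>c = 2 * pi"
  proof
    assume *: "ua = sgn (y1 - v) \<and> ua * cis \<theta>a = sgn (y2 - v)"
    then have "has_sector qa v (sgn (y1 - v)) \<theta>a" "sgn (y2 - v) = sgn (y1 - v) * cis \<theta>a" using a(1) by auto
    from sectors_at_vertex_sum_aux[OF simple disj this b(1,3) c(1,3) b(4) c(4)] show ?thesis .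
  next
    assume *: "ua = sgn (y2 - v) \<and> ua * cis \<theta>a = sgn (y1 - v)"
    then have "has_sector qa v (sgn (y2 - v)) \<theta>a" "sgn (y1 - v) = sgn (y2 - v) * cis \<theta>a" using a(1) by auto
    from sectors_at_vertex_sum_aux[OF simple(1,3,2) disj(2,1) this c(1,3) b(1,3) c(4) b(4)] show ?thesis by simp
  qed
  then show ?thesis using a b c by simp
qed

lemma sides_at_corner:
  assumes "simple_hexagon q" "closed_segment (q j) y \<in> sides q" "y \<noteq> q j"
  shows "y = q (j - 1) \<or> y = q (j + 1)"
proof -
  obtain k where k: "closed_segment (q j) y = side q k" using assms(2) unfolding sides_def by blast
  then have "q j \<in> side q k" by (metis ends_in_segment(1))
  then have "k = j \<or> k + 1 = j" using corner_of_side[OF assms(1)] by blast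
  moreover have "{q j, y} = {q k, q (k + 1)}" using k by (simp add: side_def)
  ultimately show ?thesis using assms(3) by (auto simp: doubleton_eq_iff)
qed

section \<open>Local structure of an arbitrary tiling with three tiles at each vertex\<close>

lemma congruent_copyE:
  assumes "congruent_copy p q"
  obtains f where "plane_isometry f" "q = f \<circ> p"
  using assms unfolding congruent_copy_def by blast

locale deg3_tiling =
  fixes p :: hexagon and Q :: "hexagon set"
  assumes simple_p: "simple_hexagon p" and tiling: "tiling_by_copies p Q" and s2s: "side_to_side Q"
    and deg: "\<And>v. v \<in> vertices Q \<Longrightarrow> vertex_degree (region ` Q) v = 3"
begin

lemma copy: "q \<in> Q \<Longrightarrow> congruent_copy p q"
  using tiling unfolding tiling_by_copies_def by blast

lemma simpleQ: "q \<in> Q \<Longrightarrow> simple_hexagon q"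
  using congruent_copyE[OF copy] simple_hexagon_plane_isometry simple_p by metis

lemma angleQ: "q \<in> Q \<Longrightarrow> interior_angle q i = interior_angle p i"
  using congruent_copyE[OF copy] interior_angle_plane_isometry simple_p by metis

lemma lengthQ: "q \<in> Q \<Longrightarrow> side_length q i = side_length p i"
  using congruent_copyE[OF copy] side_length_plane_isometry by metis

lemma injQ: "q \<in> Q \<Longrightarrow> q' \<in> Q \<Longrightarrow> region q = region q' \<Longrightarrow> q = q'"
  using tiling unfolding tiling_by_copies_def inj_on_def by blast

lemma disjointQ:
  assumes "q \<in> Q" "q' \<in> Q" "q \<noteq> q'"
  shows "open_region q \<inter> open_region q' = {}"
proof -
  have "region q \<noteq> region q'" using injQ assms by blast
  then have "interior (region q) \<inter> interior (region q') = {}"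
    using tiling assms unfolding tiling_by_copies_def plane_tiling_def pairwise_def by blast
  then show ?thesis using interior_region simpleQ assms by metis
qed

lemma coverQ: "\<exists>q\<in>Q. z \<in> region q"
  using tiling unfolding tiling_by_copies_def plane_tiling_def by blast

text \<open>Every tile contains a disc of a fixed radius \<open>d\<close> around a centre within
  bounded distance of all its points. Centres of distinct tiles are at least \<open>d\<close> apart,
  so a bounded set holds only finitely many of them.\<close>

lemma locally_finiteQ: "finite {q \<in> Q. region q \<inter> ball z 1 \<noteq> {}}"
proof -
  obtain z0 where z0: "z0 \<in> open_region p" using simple_hexagon_Jordan(2)[OF simple_p] by blast
  obtain d where d: "d > 0" "ball z0 d \<subseteq> open_region p" using openE[OF simple_hexagon_Jordan(1)[OF simple_p] z0]
      by blast
  obtain D where D: "\<And>w. w \<in> region p \<Longrightarrow> dist z0 w \<le> D"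
    using region_closed_bounded(2)[OF simple_p] bounded_subset_ballD[of "region p" z0] by (metis less_imp_le
        mem_ball subsetD)
  have ex: "\<exists>x. ball x d \<subseteq> open_region q \<and> (\<forall>w\<in>region q. dist x w \<le> D)" if "q \<in> Q" for q
  proof -
    obtain f where f: "plane_isometry f" "q = f \<circ> p" using congruent_copyE[OF copy[OF \<open>q \<in> Q\<close>]] by blast
    have "ball (f z0) d \<subseteq> open_region q"
      using d(2) unfolding f(2) path_image_plane_isometry[OF f(1)] inside_plane_isometry[OF f(1)]
      plane_isometry_image_ball[OF f(1), symmetric] by blast
    moreover have "dist (f z0) w \<le> D" if "w \<in> region q" for w
    proof -
      obtain u where "u \<in> region p" "w = f u" using \<open>w \<in> region q\<close> unfolding f(2) region_plane_isometry[OF f(1)]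
      by blast
      then show ?thesis using D f(1) unfolding plane_isometry_def by metis
    qed
    ultimately show ?thesis by blast
  qed
  then obtain x where x: "\<And>q. q \<in> Q \<Longrightarrow> ball (x q) d \<subseteq> open_region q" "\<And>q w. q \<in> Q \<Longrightarrow> w \<in> region q \<Longrightarrow> dist (x q) w \<le> D"
    by metis
  define S where "S = {q \<in> Q. region q \<inter> ball z 1 \<noteq> {}}"
  have far: "q = q'" if "q \<in> Q" "q' \<in> Q" "dist (x q) (x q') < d" for q q'
  proof (rule ccontr)
    assume "q \<noteq> q'"
    moreover have "x q' \<in> open_region q" "x q' \<in> open_region q'"
      using x(1)[OF that(1)] x(1)[OF that(2)] that(3) d(1) by auto
    ultimately show False using disjointQ that by blast
  qed
  have inj: "inj_on x S" using far d(1) unfolding S_def by (intro inj_onI) auto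
  have sub: "x ` S \<subseteq> cball z (D + 1)"
  proof
    fix y assume "y \<in> x ` S"
    then obtain q w where "q \<in> Q" "y = x q" "w \<in> region q" "w \<in> ball z 1" unfolding S_def by blast
    then show "y \<in> cball z (D + 1)" using x(2)[of q w] dist_triangle[of z "x q" w] by (auto simp: dist_commute)
  qed
  have "finite (x ` S)"
  proof (rule ccontr)
    assume "infinite (x ` S)"
    then obtain l where l: "l islimpt (x ` S)"
      using compact_cball[of z "D + 1"] sub unfolding compact_eq_Bolzano_Weierstrass by blast
    obtain y1 where y1: "y1 \<in> x ` S" "y1 \<noteq> l" "dist y1 l < d / 2" using l d(1) unfolding islimpt_approachable by
        (metis half_gt_zero)
    obtain y2 where y2: "y2 \<in> x ` S" "y2 \<noteq> l" "dist y2 l < min (d / 2) (dist y1 l)"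
      using l d(1) y1(2) unfolding islimpt_approachable by (metis half_gt_zero min_less_iff_conj zero_less_dist_iff)
    have "dist y1 y2 < d" using y1(3) y2(3) dist_triangle[of y1 y2 l] by (simp add: dist_commute)
    moreover obtain q1 q2 where "q1 \<in> Q" "y1 = x q1" "q2 \<in> Q" "y2 = x q2" using y1(1) y2(1) unfolding S_def by blast
    ultimately have "y1 = y2" using far by metis
    then show False using y2(3) by simp
  qed
  then show ?thesis using finite_imageD[OF _ inj] unfolding S_def by blast
qed

lemma corner_in_tile:
  assumes "q \<in> Q" "q' \<in> Q" "q i \<in> region q'"
  shows "\<exists>j. q' j = q i"
proof (cases "q = q'")
  case False
  then have "q i \<in> (corners q \<inter> corners q') \<union> \<Union>(sides q \<inter> sides q')"
    using s2s assms corner_in_region[of q i] unfolding side_to_side_def pairwise_def by blast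
  then consider "q i \<in> corners q'" | s where "s \<in> sides q" "s \<in> sides q'" "q i \<in> s" by blast
  then show ?thesis
  proof cases
    case 1
    then show ?thesis unfolding corners_def by force
  next
    case 2
    then obtain k l where k: "s = side q k" "s = side q' l" unfolding sides_def by blast
    then have "q i = q k \<or> q i = q (k + 1)" using corner_of_side[OF simpleQ[OF assms(1)]] 2(3) by blast
    moreover have "{q k, q (k + 1)} = {q' l, q' (l + 1)}" using k unfolding side_def by simp
    ultimately show ?thesis by (metis insertCI insertE singletonD)
  qed
qed blast

lemma midpoint_of_side:
  assumes "q \<in> Q"
  obtains z where "z \<in> side q i" "z \<noteq> q i" "z \<noteq> q (i + 1)"
proof -
  have "q i \<noteq> q (i + 1)" using simple_hexagon_corners_inj(1)[OF simpleQ[OF assms]] by (simp add: inj_eq)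
  then show thesis using that[of "midpoint (q i) (q (i + 1))"] midpoint_in_closed_segment
    by (metis midpoint_eq_endpoint side_def)
qed

text \<open>If no other tile contained an inner point of the side, local finiteness would make that
  point interior to \<open>q\<close>. The side-to-side condition turns the second tile's contact
  there into a whole common side.\<close>

lemma neighbour_exists:
  assumes q: "q \<in> Q"
  obtains q' where "q' \<in> Q" "q' \<noteq> q" "side q i \<in> sides q'"
proof -
  obtain z where z: "z \<in> side q i" "z \<noteq> q i" "z \<noteq> q (i + 1)" using midpoint_of_side[OF q] .
  define F where "F = {q' \<in> Q. region q' \<inter> ball z 1 \<noteq> {}} - {q}"
  have "finite F" using locally_finiteQ unfolding F_def by simp
  then have cl: "closed (\<Union>(region ` F))" using region_closed_bounded(1)[OF simpleQ] unfolding F_def by (intro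
      closed_Union) auto
  have "z \<in> \<Union>(region ` F)"
  proof (rule ccontr)
    assume "z \<notin> \<Union>(region ` F)"
    then have "open (ball z 1 - \<Union>(region ` F))" "z \<in> ball z 1 - \<Union>(region ` F)" using cl by auto
    moreover have "ball z 1 - \<Union>(region ` F) \<subseteq> region q"
    proof
      fix w assume w: "w \<in> ball z 1 - \<Union>(region ` F)"
      obtain q' where "q' \<in> Q" "w \<in> region q'" using coverQ by blast
      then show "w \<in> region q" using w unfolding F_def by blast
    qed
    ultimately have "z \<in> interior (region q)" using interior_maximal by blast
    then have "z \<in> open_region q" using interior_region[OF simpleQ[OF q]] by simp
    then show False using z(1) side_subset_bd[of q i] simple_hexagon_Jordan(4)[OF simpleQ[OF q]] by blast
  qed
  then obtain q' where q': "q' \<in> Q" "q' \<noteq> q" "z \<in> region q'" unfolding F_def by blast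
  have "z \<in> region q" using z(1) side_subset_bd bd_subset_region by blast
  then have "z \<in> (corners q \<inter> corners q') \<union> \<Union>(sides q \<inter> sides q')"
    using s2s q q' unfolding side_to_side_def pairwise_def by blast
  moreover have "z \<notin> corners q"
  proof
    assume "z \<in> corners q"
    then obtain k where k: "z = q k" unfolding corners_def by blast
    then have "i = k \<or> i + 1 = k" using corner_of_side[OF simpleQ[OF q], of k i] z(1) by blast
    then show False using z k by auto
  qed
  ultimately obtain k where k: "side q k \<in> sides q'" "z \<in> side q k" unfolding sides_def by blast
  then have "k = i" using open_side_unique[OF simpleQ[OF q] z] by blast
  then show thesis using that q' k by blast
qed

lemma neighbour_unique:
  assumes q: "q \<in> Q" "q' \<in> Q" "q' \<noteq> q" "side q i \<in> sides q'" "q'' \<in> Q" "q'' \<noteq> q" "side q i \<in> sides q''"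
  shows "q' = q''"
proof (rule ccontr)
  assume ne: "q' \<noteq> q''"
  obtain z where z: "z \<in> side q i" "z \<noteq> q i" "z \<noteq> q (i + 1)" using midpoint_of_side[OF q(1)] .
  obtain j where j: "side q i = side q' j" using q(4) unfolding sides_def by blast
  obtain r where r: "0 < r" "ball z r \<subseteq> region q \<union> region q'"
    using shared_side_cover[OF simpleQ[OF q(1)] simpleQ[OF q(2)] disjointQ[OF q(1,2)] j z] q(3) by metis
  have "z \<in> region q''" using q(7) z(1) side_subset_bd bd_subset_region unfolding sides_def by blast
  then have "open_region q'' \<inter> ball z r \<noteq> {}"
    using closure_meets_ball[OF _ r(1)] closure_open_region[OF simpleQ[OF q(5)]] by blast
  moreover have "open_region q'' \<inter> region q = {}" "open_region q'' \<inter> region q' = {}"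
    using open_region_Int_region_empty[OF simpleQ[OF q(5)] simpleQ disjointQ[OF q(5)]] q ne by auto
  ultimately show False using r(2) by blast
qed

end

context deg3_tiling
begin

lemma side_as_segment: "side q (i - 1) = closed_segment (q i) (q (i - 1))" "side q i = closed_segment (q i) (q (i
    + 1))"
  unfolding side_def by (simp_all add: closed_segment_commute del: closed_segment_eq)

lemma side_in_sides: "side q i \<in> sides q"
  unfolding sides_def by blast

lemma side_end_region: "closed_segment v y \<in> sides q \<Longrightarrow> v \<in> region q"
  unfolding sides_def using side_subset_bd bd_subset_region by (metis ends_in_segment(1) imageE subsetD)

text \<open>Describes the three tiles around the corner \<open>q i\<close>: \<open>q2\<close> lies
  across side \<open>i - 1\<close>, \<open>q3\<close> across side \<open>i\<close>, and
  \<open>x\<close> is the far end of the edge separating \<open>q2\<close> from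
  \<open>q3\<close>.\<close>

lemma vertex_structure:
  assumes q: "q \<in> Q"
  obtains q2 q3 j k x where "q2 \<in> Q" "q3 \<in> Q" "q2 \<noteq> q" "q3 \<noteq> q" "q2 \<noteq> q3" "q2 j = q i" "q3 k = q i"
    "side q (i - 1) \<in> sides q2" "side q i \<in> sides q3"
    "{q2 (j - 1), q2 (j + 1)} = {q (i - 1), x}" "{q3 (k - 1), q3 (k + 1)} = {q (i + 1), x}"
    "x \<noteq> q (i - 1)" "x \<noteq> q (i + 1)"
proof -
  define v where "v = q i"
  define S where "S = {q' \<in> Q. v \<in> region q'}"
  have inj: "q' a = q' b \<longleftrightarrow> a = b" if "q' \<in> Q" for q' a b
    using simple_hexagon_corners_inj(1)[OF simpleQ[OF that]] by (simp add: inj_eq)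
  have card: "card S = 3"
  proof -
    have "v \<in> vertices Q" using q unfolding v_def vertices_def corners_def by blast
    then have "card {t \<in> region ` Q. v \<in> t} = 3" using deg unfolding vertex_degree_def by blast
    moreover have "{t \<in> region ` Q. v \<in> t} = region ` S" unfolding S_def by blast
    moreover have "inj_on region S" using injQ unfolding S_def by (intro inj_onI) blast
    ultimately show ?thesis by (simp add: card_image)
  qed
  then have fin: "finite S" using card.infinite by fastforce
  have qS: "q \<in> S" using q corner_in_region unfolding S_def v_def by blast
  obtain q2 where q2: "q2 \<in> Q" "q2 \<noteq> q" "side q (i - 1) \<in> sides q2" using neighbour_exists[OF q] by metis
  obtain q3 where q3: "q3 \<in> Q" "q3 \<noteq> q" "side q i \<in> sides q3" using neighbour_exists[OF q] by metis
  have e2: "closed_segment v (q (i - 1)) \<in> sides q2" and e3: "closed_segment v (q (i + 1)) \<in> sides q3"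
    using q2(3) q3(3) unfolding side_as_segment[of q i] v_def .
  have S23: "q2 \<in> S" "q3 \<in> S" using q2(1) q3(1) side_end_region[OF e2] side_end_region[OF e3] unfolding S_def by auto
  obtain j where j: "q2 j = v" using corner_in_tile[OF q q2(1), of i] S23(1) unfolding S_def v_def by blast
  obtain k where k: "q3 k = v" using corner_in_tile[OF q q3(1), of i] S23(2) unfolding S_def v_def by blast
  have nev: "q (i - 1) \<noteq> v" "q (i + 1) \<noteq> v" "q (i - 1) \<noteq> q (i + 1)" unfolding v_def inj[OF q] by simp_all
  have c2: "q (i - 1) = q2 (j - 1) \<or> q (i - 1) = q2 (j + 1)"
    using sides_at_corner[OF simpleQ[OF q2(1)], of j "q (i - 1)"] e2 nev j by simp
  have c3: "q (i + 1) = q3 (k - 1) \<or> q (i + 1) = q3 (k + 1)"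
    using sides_at_corner[OF simpleQ[OF q3(1)], of k "q (i + 1)"] e3 nev k by simp
  \<comment> \<open>If one tile lay across both sides, it would fill a disc around \<open>v\<close>
    together with \<open>q\<close>, contradicting the third tile required by the degree.\<close>
  have ne23: "q2 \<noteq> q3"
  proof
    assume eq: "q2 = q3"
    then have "k = j" using j k inj[OF q2(1)] by auto
    then have nb: "{q2 (j - 1), q2 (j + 1)} = {q (i - 1), q (i + 1)}" using c2 c3 nev(3) eq by auto
    obtain r where r: "0 < r" "ball v r \<subseteq> \<Union>(region ` {q, q2})"
    proof (rule vertex_cover[of "{q, q2}" v])
      show "\<exists>i. v = q' i \<and> (\<forall>j\<in>{i, i - 1}. \<exists>q''\<in>{q, q2}. q'' \<noteq> q' \<and> side q' j \<in> sides q'')" if "q' \<in> {q, q2}" for q'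
      proof (cases "q' = q")
        case True
        then show ?thesis using q2 q3(3) eq v_def by (intro exI[of _ i]) auto
      next
        case False
        then have q': "q' = q2" using that by blast
        have "side q2 j \<in> sides q" "side q2 (j - 1) \<in> sides q"
          unfolding side_as_segment[of q2 j] j using nb side_in_sides[of q i] side_in_sides[of q "i - 1"]
          unfolding side_as_segment[of q i] v_def[symmetric] by (metis doubleton_eq_iff)+
        then show ?thesis using q' j q2(2) by (intro exI[of _ j]) auto
      qed
    next
      show "simple_hexagon q'" if "q' \<in> {q, q2}" for q' using that simpleQ q q2(1) by blast
      show "open_region q' \<inter> open_region q'' = {}" if "q' \<in> {q, q2}" "q'' \<in> {q, q2}" "q' \<noteq> q''" for q' q''
        using that disjointQ[of q' q''] q q2(1) by blast
    qed auto
    have "card {q, q2} \<le> 2" by (simp add: card_insert_if)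
    then have "\<not> S \<subseteq> {q, q2}" using card card_mono[of "{q, q2}" S] by auto
    then obtain t where t: "t \<in> S" "t \<noteq> q" "t \<noteq> q2" by blast
    then have tQ: "t \<in> Q" "v \<in> region t" unfolding S_def by auto
    then have "open_region t \<inter> ball v r \<noteq> {}"
      using closure_meets_ball[OF _ r(1)] closure_open_region[OF simpleQ[OF tQ(1)]] by blast
    moreover have "open_region t \<inter> region q = {}" "open_region t \<inter> region q2 = {}"
      using open_region_Int_region_empty[OF simpleQ[OF tQ(1)] simpleQ disjointQ[OF tQ(1)]] q q2(1) t by auto
    ultimately show False using r(2) by blast
  qed
  have S: "S = {q, q2, q3}"
  proof (rule card_subset_eq[OF fin, symmetric])
    show "{q, q2, q3} \<subseteq> S" using qS S23 by blast
    show "card {q, q2, q3} = card S" using card ne23 q2(2) q3(2) by simp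
  qed
  obtain x where x: "{q2 (j - 1), q2 (j + 1)} = {q (i - 1), x}"
  proof -
    from c2 show thesis using that[of "q2 (j + 1)"] that[of "q2 (j - 1)"] by (auto simp: insert_commute)
  qed
  then have x': "x = q2 (j - 1) \<or> x = q2 (j + 1)" by (auto simp: doubleton_eq_iff)
  have xne: "x \<noteq> q (i - 1)"
  proof
    assume "x = q (i - 1)"
    then have "q2 (j - 1) = q2 (j + 1)" using x by auto
    then show False unfolding inj[OF q2(1)] by simp
  qed
  have xv: "x \<noteq> v" using x' inj[OF q2(1)] unfolding j[symmetric] by auto
  obtain l where l: "side q2 l = closed_segment v x"
  proof -
    from x' show thesis
      using that[of "j - 1"] that[of j] side_as_segment[of q2 j] unfolding j by blast
  qed
  have xne': "x \<noteq> q (i + 1)"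
  proof
    assume "x = q (i + 1)"
    then have "side q i \<in> sides q2" using l side_in_sides[of q2 l] side_as_segment(2)[of q i] unfolding v_def by simp
    then show False using neighbour_unique[OF q q2(1,2) _ q3] ne23 by blast
  qed
  \<comment> \<open>The tile across the remaining edge of \<open>q2\<close> also contains
    \<open>v\<close>; as it is neither \<open>q2\<close> nor \<open>q\<close>, it must be
    \<open>q3\<close>.\<close>
  obtain q4 where q4: "q4 \<in> Q" "q4 \<noteq> q2" "side q2 l \<in> sides q4" using neighbour_exists[OF q2(1)] by metis
  have e4: "closed_segment v x \<in> sides q4" using q4(3) l by simp
  then have "q4 \<in> S" using q4(1) side_end_region unfolding S_def by blast
  moreover have "q4 \<noteq> q"
    using sides_at_corner[OF simpleQ[OF q], of i x] e4 xv xne xne' unfolding v_def by blast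
  ultimately have "q4 = q3" using S q4(2) by blast
  then have "x = q3 (k - 1) \<or> x = q3 (k + 1)"
    using sides_at_corner[OF simpleQ[OF q3(1)], of k x] e4 xv k by simp
  then have "{q3 (k - 1), q3 (k + 1)} = {q (i + 1), x}" using c3 xne' by auto
  then show thesis
    using that[OF q2(1) q3(1) q2(2) q3(2) ne23 _ _ q2(3) q3(3) x _ xne xne'] j k unfolding v_def by blast
qed

end

text \<open>Here \<open>l\<close> is the length of the edge between the second and the third tile.
  At an odd corner both other corners need a side of the length found at \<open>i\<close> and
  another of length \<open>l\<close>, so \<open>j = k\<close>, and an even \<open>j\<close> would
  have the angle \<tau>. At an even corner the lengths permit 0, 2, 4 together, or an odd corner
  with \<open>i\<close> repeated, which the angle sum excludes.\<close>

lemma vertex_types: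
  fixes L \<alpha> :: "6 \<Rightarrow> real"
  assumes L: "L 0 = L 1" "L 2 = L 3" "L 4 = L 5" "L 0 \<noteq> L 2" "L 2 \<noteq> L 4" "L 0 \<noteq> L 4"
    and \<alpha>: "\<alpha> 1 = \<tau>" "\<alpha> 3 = \<tau>" "\<alpha> 5 = \<tau>" "\<alpha> 0 \<noteq> \<tau>" "\<alpha> 2 \<noteq> \<tau>" "\<alpha> 4 \<noteq> \<tau>"
    and sum: "\<alpha> i + \<alpha> j + \<alpha> k = 3 * \<tau>"
    and j: "L (j - 1) = L (i - 1) \<and> L j = l \<or> L (j - 1) = l \<and> L j = L (i - 1)"
    and k: "L (k - 1) = L i \<and> L k = l \<or> L (k - 1) = l \<and> L k = L i"
  shows "i \<in> {1, 3, 5} \<Longrightarrow> j = i \<and> k = i" "i \<in> {0, 2, 4} \<Longrightarrow> j \<noteq> i \<and> k \<noteq> i"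
proof -
  define A B C where "A = L 1" and "B = L 3" and "C = L 5"
  have L': "L 0 = A" "L 1 = A" "L 2 = B" "L 3 = B" "L 4 = C" "L 5 = C" and ne: "A \<noteq> B" "B \<noteq> C" "A \<noteq> C"
    using L by (simp_all add: A_def B_def C_def)
  have m: "- 1 = (5::6)" by simp
  \<comment> \<open>All corners having a side of length \<open>A\<close>, with the length of their
    other side; similarly for \<open>B\<close> and \<open>C\<close>.\<close>
  have pA: "x = 0 \<and> y = C \<or> x = 1 \<and> y = A \<or> x = 2 \<and> y = B" if "L (x - 1) = A \<and> L x = y \<or> L (x - 1) = y \<and> L x = A"
      for x y
    using that exhaust_6[of x] ne by (elim disjE) (simp_all add: L' m)
  have pB: "x = 2 \<and> y = A \<or> x = 3 \<and> y = B \<or> x = 4 \<and> y = C" if "L (x - 1) = B \<and> L x = y \<or> L (x - 1) = y \<and> L x = B"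
      for x y
    using that exhaust_6[of x] ne by (elim disjE) (simp_all add: L' m)
  have pC: "x = 4 \<and> y = B \<or> x = 5 \<and> y = C \<or> x = 0 \<and> y = A" if "L (x - 1) = C \<and> L x = y \<or> L (x - 1) = y \<and> L x = C"
      for x y
    using that exhaust_6[of x] ne by (elim disjE) (simp_all add: L' m)
  have "(i \<in> {1, 3, 5} \<longrightarrow> j = i \<and> k = i) \<and> (i \<in> {0, 2, 4} \<longrightarrow> j \<noteq> i \<and> k \<noteq> i)"
    using exhaust_6[of i]
  proof (elim disjE)
    assume i: "i = 0"
    have "L (j - 1) = C \<and> L j = l \<or> L (j - 1) = l \<and> L j = C" "L (k - 1) = A \<and> L k = l \<or> L (k - 1) = l \<and> L k = A"
      using j k by (simp_all add: i L' m)
    from pC[OF this(1)] pA[OF this(2)] show ?thesis using sum ne \<alpha> unfolding i by (elim disjE) auto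
  next
    assume i: "i = 1"
    have "L (j - 1) = A \<and> L j = l \<or> L (j - 1) = l \<and> L j = A" "L (k - 1) = A \<and> L k = l \<or> L (k - 1) = l \<and> L k = A"
      using j k by (simp_all add: i L' m)
    from pA[OF this(1)] pA[OF this(2)] show ?thesis using sum ne \<alpha> unfolding i by (elim disjE) auto
  next
    assume i: "i = 2"
    have "L (j - 1) = A \<and> L j = l \<or> L (j - 1) = l \<and> L j = A" "L (k - 1) = B \<and> L k = l \<or> L (k - 1) = l \<and> L k = B"
      using j k by (simp_all add: i L' m)
    from pA[OF this(1)] pB[OF this(2)] show ?thesis using sum ne \<alpha> unfolding i by (elim disjE) auto
  next
    assume i: "i = 3"
    have "L (j - 1) = B \<and> L j = l \<or> L (j - 1) = l \<and> L j = B" "L (k - 1) = B \<and> L k = l \<or> L (k - 1) = l \<and> L k = B"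
      using j k by (simp_all add: i L' m)
    from pB[OF this(1)] pB[OF this(2)] show ?thesis using sum ne \<alpha> unfolding i by (elim disjE) auto
  next
    assume i: "i = 4"
    have "L (j - 1) = B \<and> L j = l \<or> L (j - 1) = l \<and> L j = B" "L (k - 1) = C \<and> L k = l \<or> L (k - 1) = l \<and> L k = C"
      using j k by (simp_all add: i L' m)
    from pB[OF this(1)] pC[OF this(2)] show ?thesis using sum ne \<alpha> unfolding i by (elim disjE) auto
  next
    assume i: "i = 5"
    have "L (j - 1) = C \<and> L j = l \<or> L (j - 1) = l \<and> L j = C" "L (k - 1) = C \<and> L k = l \<or> L (k - 1) = l \<and> L k = C"
      using j k by (simp_all add: i L' m)
    from pC[OF this(1)] pC[OF this(2)] show ?thesis using sum ne \<alpha> unfolding i by (elim disjE) auto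
  qed
  then show "i \<in> {1, 3, 5} \<Longrightarrow> j = i \<and> k = i" "i \<in> {0, 2, 4} \<Longrightarrow> j \<noteq> i \<and> k \<noteq> i" by blast+
qed

section \<open>The neighbours of a tile in a tiling by the given hexagon\<close>

definition p3_hexagon :: "hexagon \<Rightarrow> bool" where
  "p3_hexagon p \<longleftrightarrow> simple_hexagon p \<and>
     (\<forall>j\<in>{1, 3, 5}. interior_angle p j = 2 / 3 * pi \<and> side_length p (j - 1) = side_length p j) \<and>
     side_length p 0 \<noteq> side_length p 2 \<and> side_length p 2 \<noteq> side_length p 4 \<and> side_length p 0 \<noteq> side_length p 4 \<and>
     (\<forall>j\<in>{0, 2, 4}. interior_angle p j \<noteq> 2 / 3 * pi)"

lemma p3_hexagon_plane_isometry:
  assumes "plane_isometry f" "p3_hexagon p"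
  shows "p3_hexagon (f \<circ> p)"
  using assms(2) simple_hexagon_plane_isometry[OF assms(1)] interior_angle_plane_isometry[OF assms(1)]
    side_length_plane_isometry[OF assms(1)]
  unfolding p3_hexagon_def by metis

locale p3_tiling = deg3_tiling +
  assumes p3: "p3_hexagon p"
begin

lemma vertex_corner_types:
  assumes q: "q \<in> Q" and q2: "q2 \<in> Q" "q2 \<noteq> q" "q2 j = q i" and q3: "q3 \<in> Q" "q3 \<noteq> q" "q3 k = q i"
    and nb: "{q2 (j - 1), q2 (j + 1)} = {q (i - 1), x}" "{q3 (k - 1), q3 (k + 1)} = {q (i + 1), x}"
  shows "i \<in> {1, 3, 5} \<Longrightarrow> j = i \<and> k = i" "i \<in> {0, 2, 4} \<Longrightarrow> j \<noteq> i \<and> k \<noteq> i"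
proof -
  have len: "dist (q' i) (q' (i + 1)) = side_length p i" "dist (q' i) (q' (i - 1)) = side_length p (i - 1)" if "q'
      \<in> Q" for q' i
    using lengthQ[OF that, of i] lengthQ[OF that, of "i - 1"] by (simp_all add: side_length_def dist_commute)
  have sum: "interior_angle p i + interior_angle p j + interior_angle p k = 3 * (2 / 3 * pi)"
    using interior_angles_at_vertex[OF simpleQ[OF q] simpleQ[OF q2(1)] simpleQ[OF q3(1)] disjointQ[OF q q2(1)
        q2(2)[symmetric]] disjointQ[OF q q3(1) q3(2)[symmetric]]
        refl q2(3) q3(3) refl nb] angleQ q q2(1) q3(1) by simp
  have j: "side_length p (j - 1) = side_length p (i - 1) \<and> side_length p j = dist (q i) x \<or>
      side_length p (j - 1) = dist (q i) x \<and> side_length p j = side_length p (i - 1)"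
    using nb(1) len[OF q2(1), of j] len[OF q, of i] unfolding q2(3) by (auto simp: doubleton_eq_iff)
  have k: "side_length p (k - 1) = side_length p i \<and> side_length p k = dist (q i) x \<or>
      side_length p (k - 1) = dist (q i) x \<and> side_length p k = side_length p i"
    using nb(2) len[OF q3(1), of k] len[OF q, of i] unfolding q3(3) by (auto simp: doubleton_eq_iff)
  have L: "side_length p 0 = side_length p 1" "side_length p 2 = side_length p 3" "side_length p 4 = side_length p 5"
    "side_length p 0 \<noteq> side_length p 2" "side_length p 2 \<noteq> side_length p 4" "side_length p 0 \<noteq> side_length p 4"
    and \<alpha>: "interior_angle p 1 = 2 / 3 * pi" "interior_angle p 3 = 2 / 3 * pi" "interior_angle p 5 = 2 / 3 * pi"
    "interior_angle p 0 \<noteq> 2 / 3 * pi" "interior_angle p 2 \<noteq> 2 / 3 * pi" "interior_angle p 4 \<noteq> 2 / 3 * pi"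
    using p3 unfolding p3_hexagon_def by auto
  show "i \<in> {1, 3, 5} \<Longrightarrow> j = i \<and> k = i" "i \<in> {0, 2, 4} \<Longrightarrow> j \<noteq> i \<and> k \<noteq> i"
    using vertex_types[of "side_length p" "interior_angle p", OF L \<alpha> sum j k] by blast+
qed

text \<open>The tile across side \<open>j - 1\<close> fixes \<open>q j\<close>, and the vertex types
  at both ends of that side determine its placement. It remains to separate the rotation from the
  reflection in the bisector of the corner.\<close>

lemma neighbour_rotation:
  assumes q: "q \<in> Q" and j: "j \<in> {1, 3, 5}" and \<omega>: "norm \<omega> = 1"
    and turn: "q (j - 1) - q j = \<omega> * (q (j + 1) - q j)"
  shows "(\<lambda>z. q j + \<omega> * (z - q j)) \<circ> q \<in> Q"
proof -
  have inj: "q' a = q' b \<longleftrightarrow> a = b" if "q' \<in> Q" for q' a b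
    using simple_hexagon_corners_inj(1)[OF simpleQ[OF that]] by (simp add: inj_eq)
  obtain q2 q3 j2 k x where s: "q2 \<in> Q" "q3 \<in> Q" "q2 \<noteq> q" "q3 \<noteq> q" "q2 \<noteq> q3" "q2 j2 = q j" "q3 k = q j"
    "side q (j - 1) \<in> sides q2" "side q j \<in> sides q3"
    "{q2 (j2 - 1), q2 (j2 + 1)} = {q (j - 1), x}" "{q3 (k - 1), q3 (k + 1)} = {q (j + 1), x}"
    "x \<noteq> q (j - 1)" "x \<noteq> q (j + 1)" using vertex_structure[OF q, of j] .
  have "j2 = j" using vertex_corner_types(1)[OF q s(1,3,6) s(2,4,7) s(10,11) j] by blast
  note s' = s(6,10)[unfolded this]
  obtain r2 r3 l2 l3 y where t: "r2 \<in> Q" "r3 \<in> Q" "r2 \<noteq> q" "r3 \<noteq> q" "r2 \<noteq> r3" "r2 l2 = q (j - 1)" "r3 l3 = q (j - 1)"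
    "side q (j - 1 - 1) \<in> sides r2" "side q (j - 1) \<in> sides r3"
    "{r2 (l2 - 1), r2 (l2 + 1)} = {q (j - 1 - 1), y}" "{r3 (l3 - 1), r3 (l3 + 1)} = {q (j - 1 + 1), y}"
    "y \<noteq> q (j - 1 - 1)" "y \<noteq> q (j - 1 + 1)" using vertex_structure[OF q, of "j - 1"] .
  have r3: "r3 = q2" using neighbour_unique[OF q t(2,4,9) s(1,3,8)] .
  \<comment> \<open>Seen from the other, even end of the common side, \<open>q2\<close> cannot meet
    \<open>q\<close> with the same label. This rules out
    \<open>q2 (j - 1) = q (j - 1)\<close>.\<close>
  have "j - 1 \<in> {0, 2, 4}" using j by auto
  then have "l3 \<noteq> j - 1" using vertex_corner_types(2)[OF q t(1,3,6) t(2,4,7) t(10,11)] by blast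
  then have "q2 (j - 1) \<noteq> q (j - 1)" using t(7) inj[OF s(1)] unfolding r3 by metis
  then have h1: "q2 (j + 1) = q (j - 1)" "q2 (j - 1) = x" using s'(2) by (auto simp: doubleton_eq_iff)
  obtain f where f: "plane_isometry f" "q = f \<circ> p" using congruent_copyE[OF copy[OF q]] .
  obtain f2 where f2: "plane_isometry f2" "q2 = f2 \<circ> p" using congruent_copyE[OF copy[OF s(1)]] .
  define h where "h = f2 \<circ> inv f"
  have h: "plane_isometry h" unfolding h_def by (intro plane_isometry_comp plane_isometry_inv f f2)
  have "inv f (f z) = z" for z using plane_isometry_bij[OF f(1)] by (simp add: bij_is_inj)
  then have q2h: "q2 = h \<circ> q" unfolding f f2 h_def by (simp add: fun_eq_iff)
  define u where "u = q (j + 1) - q j"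
  have u: "u \<noteq> 0" unfolding u_def using inj[OF q] by simp
  have qj: "q (j + 1) = q j + u" "q (j - 1) = q j + \<omega> * u" using turn by (simp_all add: u_def algebra_simps)
  have hv: "h (q j) = q j" "h (q (j + 1)) = q (j - 1)" "h (q (j - 1)) \<noteq> q (j + 1)"
    using s'(1) h1 s(13) unfolding q2h by auto
  from h have "h = (\<lambda>z. q j + \<omega> * (z - q j))"
  proof (cases rule: plane_isometry_cases)
    case (1 A B)
    have "A * u = h (q (j + 1)) - h (q j)" unfolding 1(2) qj by (simp add: algebra_simps)
    also have "\<dots> = \<omega> * u" using hv(1,2) qj(2) by simp
    finally have "A * u = \<omega> * u" .
    then have "A = \<omega>" using u by simp
    then show ?thesis using hv(1) unfolding 1(2) by (simp add: fun_eq_iff algebra_simps)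
  next
    \<comment> \<open>The reflection exchanges \<open>q (j + 1)\<close> and
      \<open>q (j - 1)\<close>. It would make the third edge at the vertex end at
      \<open>q (j + 1)\<close>, contrary to the choice of \<open>x\<close>.\<close>
    case (2 A B)
    have "A * cnj u = h (q (j + 1)) - h (q j)" unfolding 2(2) qj by (simp add: algebra_simps)
    also have "\<dots> = \<omega> * u" using hv(1,2) qj(2) by simp
    finally have Au: "A * cnj u = \<omega> * u" .
    have "h (q (j - 1)) - h (q j) = A * cnj (\<omega> * u)" unfolding 2(2) qj by (simp add: algebra_simps)
    also have "\<dots> = (A * cnj u) * cnj \<omega>" by (simp add: mult_ac)
    also have "\<dots> = (\<omega> * cnj \<omega>) * u" unfolding Au by (simp add: mult_ac)
    also have "\<omega> * cnj \<omega> = 1" using \<omega> by (simp add: complex_norm_square[symmetric])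
    finally have "h (q (j - 1)) = q (j + 1)" using hv(1) unfolding qj by (simp add: diff_eq_eq add.commute)
    then show ?thesis using hv(3) by blast
  qed
  then show ?thesis using s(1) q2h by simp
qed

end

section \<open>Symmetries, periods and uniqueness\<close>

context rot_hex
begin

text \<open>Being direct, \<open>g m n\<close> conjugates the rotation about \<open>p j\<close> into
  the rotation about the corresponding corner of the tile, so the three neighbours are obtained by
  composing with the generators on the right.\<close>

lemma tile_neighbours:
  assumes "p3_tiling p' Q" "tile m n \<in> Q"
  shows "tile (m + 1) n \<in> Q" "tile m (n + 1) \<in> Q" "tile (m - 1) (n - 1) \<in> Q"
proof -
  interpret p3_tiling p' Q by (rule assms(1))
  have turn: "tile m n (j - 1) - tile m n j = \<omega> * (tile m n (j + 1) - tile m n j)" if "j \<in> {1, 3, 5}" for j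
    using rot_copy[of m n] that unfolding rot_hexagon_def by blast
  have "(\<lambda>z. tile m n j + \<omega> * (z - tile m n j)) \<circ> tile m n = g m n \<circ> (\<lambda>z. p j + \<omega> * (z - p j)) \<circ> p" for j
    by (simp add: fun_eq_iff rot_map_def algebra_simps)
  then have "g m n \<circ> (\<lambda>z. p j + \<omega> * (z - p j)) \<circ> p \<in> Q" if "j \<in> {1, 3, 5}" for j
    using neighbour_rotation[OF assms(2) that omega_facts(2) turn[OF that]] by metis
  from this[of 1] this[of 3] this[of 5]
  have Q: "g m n \<circ> g 1 0 \<circ> p \<in> Q" "g m n \<circ> g 0 1 \<circ> p \<in> Q" "g m n \<circ> g (-1) (-1) \<circ> p \<in> Q"
    unfolding g_odd_rotations[abs_def] by simp_all
  \<comment> \<open>The rotation part of \<open>g m n\<close> permutes the three generator indices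
    cyclically, so the three neighbours agree with the three shifted indices only as sets.\<close>
  have l: "\<omega> * lat 1 0 = lat 0 1" "\<omega> * lat 0 1 = lat (-1) (-1)" "\<omega> * lat (-1) (-1) = lat 1 0"
    "\<omega>\<^sup>2 * lat 1 0 = lat (-1) (-1)" "\<omega>\<^sup>2 * lat 0 1 = lat 1 0" "\<omega>\<^sup>2 * lat (-1) (-1) = lat 0 1"
    by (simp_all add: lat_eq algebra_simps power2_eq_square omega_mult)
  have "{g m n \<circ> g 1 0, g m n \<circ> g 0 1, g m n \<circ> g (-1) (-1)} = {g (m + 1) n, g m (n + 1), g (m - 1) (n - 1)}"
  proof (cases rule: omega_powi_cases[of "m + n"])
    case 1
    show ?thesis
      using g_comp_lat[of m n 1 0 1 0] g_comp_lat[of m n 0 1 0 1] g_comp_lat[of m n "-1" "-1" "-1" "-1"] unfolding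
      1 by simp
  next
    case 2
    show ?thesis
      using g_comp_lat[of m n 1 0 0 1] g_comp_lat[of m n 0 1 "-1" "-1"] g_comp_lat[of m n "-1" "-1" 1 0] l
      unfolding 2 by (simp add: insert_commute)
  next
    case 3
    show ?thesis
      using g_comp_lat[of m n 1 0 "-1" "-1"] g_comp_lat[of m n 0 1 1 0] g_comp_lat[of m n "-1" "-1" 0 1] l
      unfolding 3 by (simp add: insert_commute)
  qed
  then have "h \<in> {g m n \<circ> g 1 0, g m n \<circ> g 0 1, g m n \<circ> g (-1) (-1)}" if "h \<in> {g (m + 1) n, g m (n + 1), g (m - 1)
      (n - 1)}" for h
    using that by simp
  then show "tile (m + 1) n \<in> Q" "tile m (n + 1) \<in> Q" "tile (m - 1) (n - 1) \<in> Q" using Q by (metis insertE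
      insertCI singletonD)+
qed

text \<open>The base tile \<open>p\<close> may be any tile and is kept apart from the prototile
  \<open>p'\<close>. Closure under neighbours puts all copies into \<open>Q\<close>; since they
  already cover the plane, \<open>Q\<close> has no other tile.\<close>

lemma p3_tiling_eq_copies:
  assumes "p3_tiling p' Q" "p \<in> Q"
  shows "Q = rot_copies \<omega> p"
proof -
  interpret p3_tiling p' Q by (rule assms(1))
  note step = tile_neighbours[OF assms(1)]
  have "tile 0 0 \<in> Q" using assms(2) by (simp add: g_0)
  then have diag: "tile (- int k) (- int k) \<in> Q" for k
  proof (induction k)
    case (Suc k)
    have "- int (Suc k) = - int k - 1" by simp
    then show ?case using step(3)[OF Suc.IH[OF Suc.prems]] by (simp only:)
  qed simp
  have right: "tile (m + int i) n \<in> Q" if "tile m n \<in> Q" for m n i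
  proof (induction i)
    case (Suc i)
    have "m + int (Suc i) = m + int i + 1" by simp
    then show ?case using step(1)[OF Suc] by (simp only:)
  qed (use that in \<open>simp only: of_nat_0 add_0_right\<close>)
  have up: "tile m (n + int i) \<in> Q" if "tile m n \<in> Q" for m n i
  proof (induction i)
    case (Suc i)
    have "n + int (Suc i) = n + int i + 1" by simp
    then show ?case using step(2)[OF Suc] by (simp only:)
  qed (use that in \<open>simp only: of_nat_0 add_0_right\<close>)
  have all: "tile m n \<in> Q" for m n
  proof -
    define k where "k = nat \<bar>m\<bar> + nat \<bar>n\<bar>"
    have "m = - int k + int (nat (m + int k))" "n = - int k + int (nat (n + int k))" by (auto simp: k_def)
    then show ?thesis using up[OF right[OF diag[of k], of "nat (m + int k)"], of "nat (n + int k)"] by metis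
  qed
  show ?thesis
  proof
    show "rot_copies \<omega> p \<subseteq> Q" using all unfolding rot_copies_def by blast
    show "Q \<subseteq> rot_copies \<omega> p"
    proof
      fix q assume q: "q \<in> Q"
      then obtain w where w: "w \<in> open_region q" using simple_hexagon_Jordan(2)[OF simpleQ] by blast
      obtain m n where mn: "w \<in> region (tile m n)" using tiles_cover by blast
      have "q = tile m n"
      proof (rule ccontr)
        assume "q \<noteq> tile m n"
        then show False
          using open_region_Int_region_empty[OF simpleQ[OF q] simple_copy disjointQ[OF q all]] w mn by blast
      qed
      then show "q \<in> rot_copies \<omega> p" using tile_in_copies by simp
    qed
  qed
qed

section \<open>Symmetries, translations and the torus quotient of the constructed tiling\<close>

lemma g_symmetry: "g m n \<in> symmetries (region ` rot_copies \<omega> p)"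
proof -
  let ?T = "region ` rot_copies \<omega> p"
  have sub: "move_tiling (g m n) ?T \<subseteq> ?T" for m n
  proof
    fix t assume "t \<in> move_tiling (g m n) ?T"
    then obtain k l where "t = g m n ` region (tile k l)" unfolding move_tiling_def rot_copies_def by blast
    then have t: "t = region (g m n \<circ> tile k l)" using region_plane_isometry[OF g_isometry] by metis
    obtain m' n' where "g m n \<circ> g k l = g m' n'" using g_comp by metis
    then have "t = region (tile m' n')" using t by (metis comp_assoc)
    then show "t \<in> ?T" using tile_in_copies by blast
  qed
  moreover have "?T \<subseteq> move_tiling (g m n) ?T"
  proof
    fix t assume t: "t \<in> ?T"
    obtain m' n' where inv: "g m n \<circ> g m' n' = id" using g_inverse by metis
    have "g m' n' ` t \<in> ?T" using sub[of m' n'] t unfolding move_tiling_def by blast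
    moreover have "t = g m n ` (g m' n' ` t)" using inv by (metis image_comp image_id id_apply)
    ultimately show "t \<in> move_tiling (g m n) ?T" unfolding move_tiling_def by blast
  qed
  ultimately show ?thesis using g_isometry unfolding symmetries_def by blast
qed

lemma copies_isohedral: "isohedral (region ` rot_copies \<omega> p)"
  unfolding isohedral_def
proof (intro ballI)
  fix t t' assume "t \<in> region ` rot_copies \<omega> p" "t' \<in> region ` rot_copies \<omega> p"
  then obtain m n m' n' where t: "t = region (tile m n)" "t' = region (tile m' n')" unfolding rot_copies_def by blast
  obtain k l where inv: "g k l \<circ> g m n = id" using g_inverse by metis
  obtain i j where ij: "g m' n' \<circ> g k l = g i j" using g_comp by metis
  have "g i j \<circ> tile m n = g m' n' \<circ> (g k l \<circ> g m n) \<circ> p" unfolding ij[symmetric] by (simp add: comp_assoc)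
  then have "g i j ` t = t'" unfolding t inv using region_plane_isometry[OF g_isometry] by (metis comp_id)
  then show "\<exists>f\<in>symmetries (region ` rot_copies \<omega> p). f ` t = t'" using g_symmetry by blast
qed

text \<open>The indices whose rotation part is trivial, that is, the translations of the group. They
  have index 3 in the lattice of all \<open>lat m n\<close>.\<close>

definition "period_lattice = {lat m n | m n. 3 dvd m + n}"

lemma g_translate:
  assumes "3 dvd m + n"
  shows "g (m' + m) (n' + n) z = g m' n' z + lat m n"
proof -
  obtain k where "m + n = 3 * k" using assms by blast
  then have "m' + m + (n' + n) = m' + n' + 3 * k" by simp
  then have "(m' + m + (n' + n)) mod 3 = (m' + n') mod 3" by (simp only: mod_mult_self2)
  then have "\<omega> powi (m' + m + (n' + n)) = \<omega> powi (m' + n')" by (rule omega_powi_cong)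
  then show ?thesis by (simp add: rot_map_def lat_add)
qed

lemma period_invariant: "w \<in> period_lattice \<Longrightarrow> translation_invariant (region ` rot_copies \<omega> p) w"
proof -
  assume "w \<in> period_lattice"
  then obtain m n where w: "w = lat m n" "3 dvd m + n" unfolding period_lattice_def by blast
  have "g m n = (\<lambda>z. z + w)" using g_translate[OF w(2), of 0 0] by (simp add: g_0 w fun_eq_iff)
  then show ?thesis using g_symmetry[of m n] unfolding symmetries_def translation_invariant_def by simp
qed

lemma lat_independent: "lat 3 0 \<noteq> lat (-1) 1" "independent {lat 3 0, lat (-1) 1}"
proof -
  show ne: "lat 3 0 \<noteq> lat (-1) 1" unfolding lat_inj by simp
  have nz: "lat (-1) 1 \<noteq> 0" using lat_inj[of "-1" 1 0 0] by (simp add: lat_eq[of 0 0])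
  have "lat 3 0 \<notin> span {lat (-1) 1}"
  proof
    assume "lat 3 0 \<in> span {lat (-1) 1}"
    then obtain k where "lat 3 0 = k *\<^sub>R lat (-1) 1" by (auto simp: span_singleton)
    then have "a * (1 - \<omega>) * (of_real (3 + k) + of_real (- k) * \<omega>) = 0"
      by (simp add: lat_eq scaleR_conv_of_real algebra_simps)
    then have "of_real (3 + k) + of_real (- k) * \<omega> = 0" using a_nonzero omega_neq_1 by simp
    then have "3 + k = 0" "- k = 0" by (rule omega_real_combination[OF omega])+
    then show False by simp
  qed
  then show "independent {lat 3 0, lat (-1) 1}" using nz ne by (simp add: independent_insert)
qed

lemma period_lattice_eq: "period_lattice = {of_int i * lat 3 0 + of_int j * lat (-1) 1 | i j. True}"
proof -
  have *: "of_int i * lat 3 0 + of_int j * lat (-1) 1 = lat (3 * i - j) j" for i j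
    by (simp add: lat_eq algebra_simps)
  have "\<exists>i j. lat m n = lat (3 * i - j) j" if "3 dvd m + n" for m n
    using that by (intro exI[of _ "(m + n) div 3"] exI[of _ n]) (auto simp: lat_inj)
  moreover have "3 dvd 3 * i - j + j" for i j :: int by simp
  ultimately show ?thesis unfolding period_lattice_def * by blast
qed

lemma plane_lattice_period: "plane_lattice period_lattice"
  unfolding plane_lattice_def using lat_independent period_lattice_eq by blast

lemma copies_periodic: "periodic (region ` rot_copies \<omega> p)"
proof -
  have "lat 3 0 \<in> period_lattice" "lat (-1) 1 \<in> period_lattice" unfolding period_lattice_def by force+
  then show ?thesis unfolding periodic_def using lat_independent period_invariant by blast
qed

text \<open>Modulo \<open>period_lattice\<close> a tile is determined by \<open>m + n\<close> modulo
  3; the tiles \<open>(0, 0)\<close>, \<open>(1, 0)\<close>, \<open>(2, 0)\<close> represent the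
  three classes.\<close>

lemma torus_tiles_card: "card (torus_tiles (period_lattice, region ` rot_copies \<omega> p)) = 3"
proof -
  define \<tau> where "\<tau> k = torus_proj period_lattice ` region (tile k 0)" for k
  have zero: "0 \<in> period_lattice" unfolding period_lattice_def using lat_eq[of 0 0] by force
  have add: "x + y \<in> period_lattice" if xy: "x \<in> period_lattice" "y \<in> period_lattice" for x y
  proof -
    obtain m n m' n' where *: "x = lat m n" "y = lat m' n'" "3 dvd m + n" "3 dvd m' + n'"
      using xy unfolding period_lattice_def by blast
    have "3 dvd m + m' + (n + n')" using dvd_add[OF *(3,4)] by (simp add: algebra_simps)
    then show ?thesis unfolding * lat_add[symmetric] period_lattice_def by blast
  qed
  have neg: "- x \<in> period_lattice" if x: "x \<in> period_lattice" for x
  proof -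
    obtain m n where *: "x = lat m n" "3 dvd m + n" using x unfolding period_lattice_def by blast
    have "3 dvd - m + - n" using *(2) by (metis dvd_minus_iff minus_add_distrib)
    moreover have "- x = lat (- m) (- n)" by (simp add: * lat_eq algebra_simps)
    ultimately show ?thesis unfolding period_lattice_def by blast
  qed
  have proj: "torus_proj period_lattice (z + l) = torus_proj period_lattice z" if l: "l \<in> period_lattice" for z l
  proof -
    have "(+) l ` period_lattice = period_lattice"
    proof (intro equalityI subsetI)
      fix x assume "x \<in> period_lattice"
      then have "- l + x \<in> period_lattice" using add neg l by blast
      then have "l + (- l + x) \<in> (+) l ` period_lattice" by blast
      then show "x \<in> (+) l ` period_lattice" by simp
    qed (use add l in auto)
    then have "(+) z ` period_lattice = (+) z ` (+) l ` period_lattice" by simp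
    also have "\<dots> = (+) (z + l) ` period_lattice" by (simp add: image_image add.assoc)
    finally show ?thesis unfolding torus_proj_def by simp
  qed
  have shift: "region (tile (m' + m) (n' + n)) = (\<lambda>z. z + lat m n) ` region (tile m' n')" if "3 dvd m + n" for m n
      m' n'
    using region_plane_isometry[OF g_isometry, of "m' + m" "n' + n" p] region_plane_isometry[OF g_isometry, of m'
        n' p]
    unfolding g_translate[OF that] by (simp add: image_image)
  have cls: "torus_proj period_lattice ` region (tile m n) = \<tau> ((m + n) mod 3)" for m n
  proof -
    define k where "k = (m + n) mod 3"
    have "3 dvd m - k + n" using dvd_minus_mod[of 3 "m + n"] unfolding k_def by (simp add: algebra_simps)
    then have "region (tile (k + (m - k)) (0 + n)) = (\<lambda>z. z + lat (m - k) n) ` region (tile k 0)" "lat (m - k) n \<in>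
        period_lattice"
      using shift period_lattice_def by blast+
    then show ?thesis unfolding \<tau>_def k_def[symmetric] by (simp add: image_image proj)
  qed
  have "torus_tiles (period_lattice, region ` rot_copies \<omega> p) = \<tau> ` {0, 1, 2}"
  proof (intro equalityI subsetI)
    fix t assume "t \<in> torus_tiles (period_lattice, region ` rot_copies \<omega> p)"
    then obtain m n where "t = torus_proj period_lattice ` region (tile m n)" unfolding torus_tiles_def
        rot_copies_def by auto
    then have t: "t = \<tau> ((m + n) mod 3)" unfolding cls .
    have "k mod 3 \<in> {0, 1, 2}" for k :: int
    proof -
      have "k mod 3 = 0 \<or> k mod 3 = 1 \<or> k mod 3 = 2" by presburger
      then show ?thesis by (simp only: insert_iff empty_iff simp_thms)
    qed
    then show "t \<in> \<tau> ` {0, 1, 2}" unfolding t by (rule imageI)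
  next
    fix t assume "t \<in> \<tau> ` {0, 1, 2}"
    then obtain k where "t = torus_proj period_lattice ` region (tile k 0)" unfolding \<tau>_def by blast
    then show "t \<in> torus_tiles (period_lattice, region ` rot_copies \<omega> p)"
      unfolding torus_tiles_def using tile_in_copies by auto
  qed
  moreover have "inj_on \<tau> {0, 1, 2}"
  proof (rule inj_onI)
    fix k l :: int assume kl: "k \<in> {0, 1, 2}" "l \<in> {0, 1, 2}" "\<tau> k = \<tau> l"
    \<comment> \<open>If two representatives had the same image on the torus, an inner point of one
      would lie in a translate of the other. Distinct copies do not meet in inner points, so the
      indices agree modulo 3.\<close>
    obtain w where w: "w \<in> open_region (tile k 0)" using simple_hexagon_Jordan(2)[OF simple_copy] by blast
    then have "w \<in> region (tile k 0)" using open_region_subset by blast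
    then obtain w' where w': "w' \<in> region (tile l 0)" "torus_proj period_lattice w = torus_proj period_lattice w'"
      using kl(3) unfolding \<tau>_def by blast
    have "w \<in> torus_proj period_lattice w" unfolding torus_proj_def using zero by force
    then obtain x where "x \<in> period_lattice" "w = w' + x" unfolding w'(2) unfolding torus_proj_def by blast
    then obtain m n where mn: "w = w' + lat m n" "3 dvd m + n" unfolding period_lattice_def by blast
    have "w \<in> region (tile (l + m) (0 + n))" unfolding shift[OF mn(2)] using w'(1) mn(1) by blast
    then have "tile k 0 = tile (l + m) (0 + n)"
      using open_region_Int_region_empty[OF simple_copy simple_copy copies_disjoint[OF tile_in_copies
      tile_in_copies]] w by blast
    then have "k = l + m" "n = 0" unfolding tile_inj by auto
    then have "3 dvd k - l" using mn(2) by simp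
    then show "k = l" using kl(1,2) by auto
  qed
  ultimately show ?thesis by (simp add: card_image)
qed

end

text \<open>A direct isometry keeps \<omega> and a reflection conjugates it. In both cases the
  lattice is carried along, so that conjugation preserves the index \<open>(m, n)\<close>.\<close>

lemma rot_map_conjugate:
  assumes "plane_isometry f" "rot_hexagon \<omega> p" "rot_hexagon \<omega>' (f \<circ> p)"
  shows "rot_map \<omega>' (f \<circ> p) m n \<circ> f = f \<circ> rot_map \<omega> p m n"
proof -
  have t: "p 0 - p 1 = \<omega> * (p 2 - p 1)" "f (p 0) - f (p 1) = \<omega>' * (f (p 2) - f (p 1))" and simple: "simple_hexagon p"
    using assms(2,3) unfolding rot_hexagon_def by auto
  have ne: "p 2 \<noteq> p 1" using simple_hexagon_corners_inj(1)[OF simple] by (simp add: inj_eq)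
  from assms(1) show ?thesis
  proof (cases rule: plane_isometry_cases)
    case (1 A B)
    have A: "A \<noteq> 0" using 1(1) by auto
    have "A * (\<omega> * (p 2 - p 1)) = A * (\<omega>' * (p 2 - p 1))" using t unfolding 1(2) t(1)[symmetric] by (simp add:
        algebra_simps)
    then have \<omega>: "\<omega>' = \<omega>" using A ne by simp
    have c: "hex_center (f \<circ> p) = A * hex_center p + B" unfolding 1(2) hex_center_def by (simp add: field_simps)
    show ?thesis
      unfolding fun_eq_iff comp_apply rot_map_def hex_lattice_def c \<omega> unfolding 1(2) by (simp add: algebra_simps)
  next
    case (2 A B)
    have A: "A \<noteq> 0" using 2(1) by auto
    have "A * (cnj \<omega> * cnj (p 2 - p 1)) = A * (\<omega>' * cnj (p 2 - p 1))"
      using t unfolding 2(2) complex_cnj_mult[symmetric] t(1)[symmetric] by (simp add: algebra_simps)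
    then have \<omega>: "\<omega>' = cnj \<omega>" using A ne by simp
    have c: "hex_center (f \<circ> p) = A * cnj (hex_center p) + B" unfolding 2(2) hex_center_def by (simp add: field_simps)
    show ?thesis
      unfolding fun_eq_iff comp_apply rot_map_def hex_lattice_def c \<omega> unfolding 2(2) by (simp add: algebra_simps)
  qed
qed

lemma rot_copies_move:
  assumes "plane_isometry f" "rot_hexagon \<omega> p" "rot_hexagon \<omega>' (f \<circ> p)"
  shows "region ` rot_copies \<omega>' (f \<circ> p) = move_tiling f (region ` rot_copies \<omega> p)"
proof -
  have "region (rot_map \<omega>' (f \<circ> p) m n \<circ> (f \<circ> p)) = f ` region (rot_map \<omega> p m n \<circ> p)" for m n
    using rot_map_conjugate[OF assms, of m n] region_plane_isometry[OF assms(1)] by (metis comp_assoc)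
  then show ?thesis unfolding rot_copies_def move_tiling_def by blast
qed

section \<open>Absence of further translations\<close>

lemma bounded_translation_invariant:
  fixes d :: complex
  assumes "bounded S" "S \<noteq> {}" "(\<lambda>z. z + d) ` S = S"
  shows "d = 0"
proof (rule ccontr)
  assume "d \<noteq> 0"
  obtain z where z: "z \<in> S" using assms(2) by blast
  have S: "z + of_nat n * d \<in> S" for n
  proof (induction n)
    case (Suc n)
    then have "(z + of_nat n * d) + d \<in> S" using assms(3) by blast
    then show ?case by (simp add: algebra_simps)
  qed (use z in simp)
  obtain B where B: "\<And>x. x \<in> S \<Longrightarrow> norm x \<le> B" using assms(1) unfolding bounded_iff by blast
  obtain n where n: "2 * B < real n * norm d" using reals_Archimedean3[of "norm d"] \<open>d \<noteq> 0\<close> by auto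
  have "norm (of_nat n * d) \<le> norm (z + of_nat n * d) + norm z"
    using norm_triangle_ineq4[of "z + of_nat n * d" z] by simp
  then have "real n * norm d \<le> 2 * B" using B[OF S[of n]] B[OF z] by (simp add: norm_mult)
  with n show False by simp
qed

lemma sector_neq_ball:
  assumes "norm u = 1" "0 < \<theta>" "\<theta> < 2 * pi" "0 < r"
  shows "sector z u \<theta> r \<noteq> ball z r"
proof
  assume eq: "sector z u \<theta> r = ball z r"
  define t where "t = (\<theta> + 2 * pi) / 2"
  have t: "0 \<le> t" "t < 2 * pi" "\<theta> < t" using assms by (auto simp: t_def)
  have "z + of_real (r / 2) * u * cis t \<in> ball z r" using assms by (simp add: dist_norm norm_mult)
  moreover have "z + of_real (r / 2) * u * cis t \<notin> sector z u \<theta> r"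
    using mem_sector_iff[of u "r / 2" r t \<theta> z] assms t by simp
  ultimately show False using eq by blast
qed

text \<open>An inner point has a full disc, an inner point of a side a half disc, and an even corner
  another angle. So the odd corners are visible in the region as a point set, although its corners
  in general need not be.\<close>

lemma third_angle_points:
  assumes p: "p3_hexagon p" and u: "norm u = 1" "0 < r" "region p \<inter> ball z r = sector z u (2 / 3 * pi) r"
  obtains i where "i \<in> {1, 3, 5}" "z = p i" "\<And>u' \<theta>. has_sector p (p i) u' \<theta> \<Longrightarrow> u' = u"
proof -
  have simple: "simple_hexagon p" using p by (simp add: p3_hexagon_def)
  have th: "0 < 2 / 3 * pi" "2 / 3 * pi < 2 * pi" by auto
  have "z \<in> sector z u (2 / 3 * pi) r" unfolding sector_def using u(2) by (intro CollectI exI[of _ 0]) auto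
  then have z: "z \<in> region p" using u(3) by blast
  have "z \<notin> open_region p"
  proof
    assume "z \<in> open_region p"
    then obtain e where e: "e > 0" "ball z e \<subseteq> open_region p" using openE[OF simple_hexagon_Jordan(1)[OF simple]]
        by blast
    define s where "s = min e r"
    have s: "0 < s" "s \<le> r" "s \<le> e" using e u(2) by (auto simp: s_def)
    have "ball z s \<subseteq> region p" using e(2) subset_ball[OF s(3)] open_region_subset[of p] by blast
    then have "ball z s = region p \<inter> ball z r \<inter> ball z s" using subset_ball[OF s(2), of z] by blast
    also have "\<dots> = sector z u (2 / 3 * pi) s" unfolding u(3) using sector_Int_ball[OF u(1) s(2)] .
    finally show False using sector_neq_ball[OF u(1) th s(1), of z] by simp
  qed
  then have "z \<in> bd p" using z unfolding region_def by blast
  then obtain k where k: "z \<in> side p k" by (auto simp: path_image_boundary_path)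
  have "z = p k \<or> z = p (k + 1)"
  proof (rule ccontr)
    assume "\<not> ?thesis"
    then obtain v where "has_sector p z v pi" using edge_has_sector[OF simple k] by metis
    then have "pi = 2 / 3 * pi" using has_sector_unique(2)[OF _ u(1) th u(2,3)] by blast
    then show False by simp
  qed
  then obtain i where i: "z = p i" by blast
  have uniq: "u' = u \<and> \<theta> = 2 / 3 * pi" if "has_sector p (p i) u' \<theta>" for u' \<theta>
    using has_sector_unique[OF that u(1) th u(2)] u(3) i by blast
  obtain v \<theta> where v: "has_sector p (p i) v \<theta>" using corner_has_sector[OF simple] by metis
  then have "interior_angle p i = 2 / 3 * pi" using uniq has_sector_interior_angle by blast
  then have "i \<notin> {0, 2, 4}" using p unfolding p3_hexagon_def by blast
  then have "i \<in> {1, 3, 5}" using exhaust_6[of i] by blast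
  then show thesis using that i uniq by blast
qed

context rot_hex
begin

text \<open>The first ray of the sector lies along side \<open>j\<close> or along side
  \<open>j - 1\<close>, depending on the orientation. The factor \<open>\<kappa>\<close> is 1 or
  \<omega> accordingly, and it is the same at all three odd corners.\<close>

lemma odd_corner_sectors:
  obtains \<kappa> where "\<kappa> \<noteq> 0" "\<And>j. j \<in> {1, 3, 5} \<Longrightarrow> has_sector p (p j) (\<kappa> * sgn (p (j + 1) - p j)) (2 / 3 * pi)"
proof -
  define \<kappa> where "\<kappa> = (if \<omega> = cis (2 / 3 * pi) then 1 else \<omega>)"
  have sg: "sgn \<omega> = \<omega>" using omega_facts(2) by (simp add: sgn_div_norm)
  have "has_sector p (p j) (\<kappa> * sgn (p (j + 1) - p j)) (2 / 3 * pi)" if j: "j \<in> {1, 3, 5}" for j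
  proof -
    have h: "interior_angle p j = 2 / 3 * pi" "p (j - 1) - p j = \<omega> * (p (j + 1) - p j)"
      using rot j unfolding rot_hexagon_def by blast+
    have "norm (p (j - 1) - p j) = norm (p (j + 1) - p j)" unfolding h(2) norm_mult omega_facts(2) by simp
    then have "side_length p (j - 1) = side_length p j" by (simp add: side_length_def dist_norm norm_minus_commute)
    then obtain \<omega>' u where u: "\<omega>'\<^sup>2 + \<omega>' + 1 = 0" "p (j - 1) - p j = \<omega>' * (p (j + 1) - p j)"
      "has_sector p (p j) u (2 / 3 * pi)"
      "(1 + \<omega>') * (p (j + 1) - p j) = of_real (norm (p (j + 1) - p j)) * u * cis (pi / 3)"
      "u = sgn (p (j + 1) - p j) \<and> \<omega>' = cis (2 / 3 * pi) \<or> u = sgn (p (j - 1) - p j) \<and> \<omega>' = cis (- (2 / 3 * pi))"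
      by (rule third_turn_sector[OF simple h(1)])
    have ne: "p (j + 1) - p j \<noteq> 0" using simple_hexagon_corners_inj(1)[OF simple] by (simp add: inj_eq)
    then have \<omega>': "\<omega>' = \<omega>" using u(2) h(2) by simp
    have "cis (2 / 3 * pi) \<noteq> cis (- (2 / 3 * pi))"
    proof
      assume "cis (2 / 3 * pi) = cis (- (2 / 3 * pi))"
      then have "Im (cis (2 / 3 * pi)) = Im (cis (- (2 / 3 * pi)))" by simp
      then have "Im (cis (2 / 3 * pi)) = 0" by simp
      then show False using primitive_cube_root(3)[OF cis_third(1)] by blast
    qed
    moreover have "sgn (p (j - 1) - p j) = \<omega> * sgn (p (j + 1) - p j)" unfolding h(2) sgn_mult sg ..
    ultimately have "u = \<kappa> * sgn (p (j + 1) - p j)" using u(5) unfolding \<omega>' \<kappa>_def by auto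
    then show ?thesis using u(3) by simp
  qed
  moreover have "\<kappa> \<noteq> 0" using omega_neq_1 by (simp add: \<kappa>_def)
  ultimately show thesis using that by blast
qed

text \<open>The map permutes the odd corners and multiplies the direction \<open>s\<close> of the
  side leaving each of them by \<omega>. Once the permutation is known to be cyclic, comparing the
  edges of the equilateral triangle yields equal side lengths.\<close>

lemma no_rotation_symmetry:
  assumes p3: "p3_hexagon p" and h: "(\<lambda>z. \<omega> * z + B) ` region p = region p"
  shows False
proof -
  obtain \<kappa> where \<kappa>: "\<kappa> \<noteq> 0" "\<And>j. j \<in> {1, 3, 5} \<Longrightarrow> has_sector p (p j) (\<kappa> * sgn (p (j + 1) - p j)) (2 / 3 * pi)"
    using odd_corner_sectors by metis
  have iso: "plane_isometry (\<lambda>z. \<omega> * z + B)" by (rule plane_isometryI(1)[OF omega_facts(2)])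
  have inj: "inj (\<lambda>z. \<omega> * z + B)" using plane_isometry_bij[OF iso] by (simp add: bij_def)
  define s where "s j = sgn (p (j + 1) - p j)" for j
  have step: "\<exists>i\<in>{1, 3, 5}. \<omega> * p j + B = p i \<and> s i = \<omega> * s j" if j: "j \<in> {1, 3, 5}" for j
  proof -
    obtain R where R: "R > 0" "region p \<inter> ball (p j) R = sector (p j) (\<kappa> * s j) (2 / 3 * pi) R" and nu: "norm (\<kappa> *
        s j) = 1"
      using \<kappa>(2)[OF j] unfolding has_sector_def s_def by blast
    have "region p \<inter> ball (\<omega> * p j + B) R = (\<lambda>z. \<omega> * z + B) ` (region p \<inter> ball (p j) R)"
      unfolding image_Int[OF inj] h plane_isometry_image_ball[OF iso] ..
    also have "\<dots> = sector (\<omega> * p j + B) (\<omega> * (\<kappa> * s j)) (2 / 3 * pi) R" unfolding R(2) sector_image_direct ..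
    finally have sec: "region p \<inter> ball (\<omega> * p j + B) R = sector (\<omega> * p j + B) (\<omega> * (\<kappa> * s j)) (2 / 3 * pi) R" .
    have "norm (\<omega> * (\<kappa> * s j)) = 1" using nu omega_facts(2) by (simp add: norm_mult)
    then obtain i where i: "i \<in> {1, 3, 5}" "\<omega> * p j + B = p i" "\<And>u' \<theta>. has_sector p (p i) u' \<theta> \<Longrightarrow> u' = \<omega> * (\<kappa> * s j)"
      using third_angle_points[OF p3 _ R(1) sec] by blast
    have "\<kappa> * s i = \<kappa> * (\<omega> * s j)" using i(3)[OF \<kappa>(2)[OF i(1)]] unfolding s_def by (simp add: mult_ac)
    then have "s i = \<omega> * s j" using \<kappa>(1) by simp
    with i show ?thesis by blast
  qed
  have s_nz: "s j \<noteq> 0" for j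
    using simple_hexagon_corners_inj(1)[OF simple] by (simp add: s_def sgn_zero_iff inj_eq)
  \<comment> \<open>No odd corner is fixed, since its direction would have to be \<omega> times
    itself.\<close>
  have fpf: "\<omega> * s j \<noteq> s j" for j using s_nz[of j] omega_neq_1 by simp
  have d: "(\<omega> * p 1 + B) - (\<omega> * p 3 + B) = p 3 - p 5" "(\<omega> * p 3 + B) - (\<omega> * p 5 + B) = p 5 - p 1"
    unfolding corner_coords by (simp_all add: algebra_simps power2_eq_square omega_mult)
  have ne: "p 1 \<noteq> p 3" "p 1 \<noteq> p 5" "p 3 \<noteq> p 5" using simple_hexagon_corners_inj(1)[OF simple] by (simp_all add:
      inj_eq)
  have s1: "\<omega> * p 1 + B = p 3 \<and> s 3 = \<omega> * s 1 \<or> \<omega> * p 1 + B = p 5 \<and> s 5 = \<omega> * s 1" using step[of 1] fpf[of 1] by auto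
  have s3: "\<omega> * p 3 + B = p 1 \<and> s 1 = \<omega> * s 3 \<or> \<omega> * p 3 + B = p 5 \<and> s 5 = \<omega> * s 3" using step[of 3] fpf[of 3] by auto
  \<comment> \<open>The image of one odd corner determines the others. Sending \<open>p 1\<close> to
    \<open>p 5\<close> would send \<open>p 3\<close> to \<open>2 * p 5 - p 3\<close>, which is
    neither \<open>p 5\<close> nor \<open>p 1\<close>: the latter would make \<open>p 5\<close> the
    centre of the triangle.\<close>
  have h1: "\<omega> * p 1 + B = p 3 \<and> s 3 = \<omega> * s 1"
  proof (rule ccontr)
    assume "\<not> ?thesis"
    then have h1: "\<omega> * p 1 + B = p 5" using s1 by blast
    then have h3: "\<omega> * p 3 + B = 2 * p 5 - p 3" using d(1) by (simp add: algebra_simps)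
    have "\<omega> * p 3 + B \<noteq> p 5"
    proof
      assume "\<omega> * p 3 + B = p 5"
      with h3 have "p 5 = 2 * p 5 - p 3" by (simp only:)
      then show False using ne(3) by (simp add: algebra_simps)
    qed
    then have "2 * p 5 - p 3 = p 1" using s3 h3 by auto
    then have "p 1 = 2 * p 5 - p 3" by simp
    then have "c = p 5" by (simp add: hex_center_def)
    then show False using corner_coords(3) a_nonzero omega_neq_1 by simp
  qed
  then have h3: "\<omega> * p 3 + B = p 5" using d(1) by (simp add: algebra_simps)
  then have h3': "s 5 = \<omega> * s 3" using s3 ne(2) by auto
  define \<epsilon> where "\<epsilon> = s 1"
  have s: "s 1 = \<epsilon>" "s 3 = \<omega> * \<epsilon>" "s 5 = \<omega> * (\<omega> * \<epsilon>)" using h1 h3' by (auto simp: \<epsilon>_def)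
  have pol: "p (j + 1) - p j = of_real (side_length p j) * s j" for j
    unfolding s_def side_length_def
    by (cases "p (j + 1) = p j") (simp_all add: sgn_div_norm scaleR_conv_of_real dist_norm norm_minus_commute)
  define x y z where "x = side_length p 1" and "y = side_length p 3" and "z = side_length p 5"
  have P: "p 2 - p 1 = of_real x * \<epsilon>" "p 4 - p 3 = of_real y * (\<omega> * \<epsilon>)" "p 0 - p 5 = of_real z * (\<omega> * (\<omega> * \<epsilon>))"
    using pol[of 1] pol[of 3] pol[of 5] unfolding s x_def y_def z_def by simp_all
  \<comment> \<open>Two edges of the triangle are expressed by the side lengths and the direction of
    the first side. One is \<omega> times the other, and comparing coefficients of \<omega> gives
    \<open>x = y\<close>.\<close>
  have "p 3 - p 1 = (p 2 - p 1) - (p 2 - p 3)" by simp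
  then have 1: "p 3 - p 1 = of_real x * \<epsilon> - \<omega> * (of_real y * (\<omega> * \<epsilon>))" unfolding turns(2) P .
  have "p 5 - p 3 = (p 4 - p 3) - (p 4 - p 5)" by simp
  then have 2: "p 5 - p 3 = of_real y * (\<omega> * \<epsilon>) - \<omega> * (of_real z * (\<omega> * (\<omega> * \<epsilon>)))" unfolding turns(3) P .
  have "p 5 - p 3 = \<omega> * (p 3 - p 1)" unfolding corner_coords by (simp add: algebra_simps power2_eq_square)
  then have "(of_real (y - z) + of_real (y - x) * \<omega>) * \<epsilon> = 0"
    unfolding 1 2 by (simp add: algebra_simps omega_mult)
  then have "of_real (y - z) + of_real (y - x) * \<omega> = 0" using s_nz[of 1] by (simp add: \<epsilon>_def)
  then have "y - x = 0" by (rule omega_real_combination(2)[OF omega])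
  moreover have "side_length p 0 = side_length p 1" "side_length p 2 = side_length p 3" "side_length p 0 \<noteq>
      side_length p 2"
    using p3 unfolding p3_hexagon_def by auto
  ultimately show False by (simp add: x_def y_def)
qed

text \<open>The translation carries \<open>region p\<close> to the region of some copy. Undoing it
  after \<open>g m n\<close> leaves a symmetry of \<open>region p\<close> with linear part a power
  of \<omega>, and only the trivial power is possible.\<close>

lemma translation_invariant_period:
  assumes p3: "p3_hexagon p" and w: "translation_invariant (region ` rot_copies \<omega> p) w"
  shows "w \<in> period_lattice"
proof -
  have "region p \<in> region ` rot_copies \<omega> p" using tile_in_copies[of 0 0] by (simp add: g_0)
  then have "(\<lambda>z. z + w) ` region p \<in> region ` rot_copies \<omega> p" using w unfolding translation_invariant_def
      move_tiling_def by blast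
  then obtain m n where "(\<lambda>z. z + w) ` region p = region (tile m n)" unfolding rot_copies_def by blast
  then have eq: "(\<lambda>z. z + w) ` region p = g m n ` region p" unfolding region_plane_isometry[OF g_isometry] .
  define K where "K = c - \<omega> powi (m + n) * c + lat m n - w"
  have "(\<lambda>z. z + - w) ` (\<lambda>z. z + w) ` region p = (\<lambda>z. z + - w) ` g m n ` region p" unfolding eq ..
  then have K: "(\<lambda>z. \<omega> powi (m + n) * z + K) ` region p = region p"
    unfolding g_affine K_def image_image by (simp add: algebra_simps)
  show ?thesis
  proof (cases rule: omega_powi_cases[of "m + n"])
    case 1
    have "region p \<noteq> {}" using corner_in_region by blast
    moreover have "(\<lambda>z. z + K) ` region p = region p" using K unfolding 1 by simp
    ultimately have "K = 0" using bounded_translation_invariant[OF region_closed_bounded(2)[OF simple]] by metis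
    then have "w = lat m n" unfolding K_def 1 by simp
    then show ?thesis unfolding period_lattice_def using mod_0_imp_dvd[OF 1(1)] by blast
  next
    case 2
    then show ?thesis using no_rotation_symmetry[OF p3] K by (metis (no_types))
  next
    \<comment> \<open>Applying the symmetry twice gives the linear part \<omega>, which reduces this
      case to the previous one.\<close>
    case 3
    have "(\<lambda>z. \<omega>\<^sup>2 * z + K) ` (\<lambda>z. \<omega>\<^sup>2 * z + K) ` region p = region p" using K unfolding 3 by simp
    moreover have "\<omega>\<^sup>2 * (\<omega>\<^sup>2 * z + K) + K = \<omega> * z + (\<omega>\<^sup>2 * K + K)" for z
      by (simp add: algebra_simps power2_eq_square omega_mult)
    ultimately have "(\<lambda>z. \<omega> * z + (\<omega>\<^sup>2 * K + K)) ` region p = region p" unfolding image_image by simp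
    then show ?thesis using no_rotation_symmetry[OF p3] by blast
  qed
qed

lemma minimal_torus:
  assumes p3: "p3_hexagon p"
  shows "plane_covers (region ` rot_copies \<omega> p) (period_lattice, region ` rot_copies \<omega> p)"
    and "minimal_torus_tiling (period_lattice, region ` rot_copies \<omega> p)"
proof -
  let ?T = "region ` rot_copies \<omega> p"
  have torus: "is_torus_tiling (period_lattice, ?T)"
    using plane_lattice_period copies_tiling period_invariant unfolding is_torus_tiling_def tiling_by_copies_def
        by simp
  then show "plane_covers ?T (period_lattice, ?T)" unfolding plane_covers_def by simp
  show "minimal_torus_tiling (period_lattice, ?T)"
    unfolding minimal_torus_tiling_def
  proof (intro conjI allI impI torus)
    fix Y assume Y: "torus_covers (period_lattice, ?T) Y"
    obtain L U where LU: "Y = (L, U)" by (cases Y)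
    have "U = ?T" "period_lattice \<subseteq> L" "\<forall>w\<in>L. translation_invariant U w"
      using Y unfolding LU torus_covers_def is_torus_tiling_def by simp_all
    then show "(period_lattice, ?T) = Y" using translation_invariant_period[OF p3] unfolding LU by blast
  qed
qed

end

theorem theorem2p3:
  fixes p :: hexagon
  assumes "simple_hexagon p"
    and "interior_angle p 1 = 2 / 3 * pi"
    and "interior_angle p 3 = 2 / 3 * pi"
    and "interior_angle p 5 = 2 / 3 * pi"
    and "side_length p 0 = side_length p 1"
    and "side_length p 2 = side_length p 3"
    and "side_length p 4 = side_length p 5"
    and "side_length p 0 \<noteq> side_length p 2"
    and "side_length p 2 \<noteq> side_length p 4"
    and "side_length p 0 \<noteq> side_length p 4"
    and "interior_angle p 0 \<noteq> 2 / 3 * pi"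
    and "interior_angle p 2 \<noteq> 2 / 3 * pi"
    and "interior_angle p 4 \<noteq> 2 / 3 * pi"
  shows "\<exists>T. side_to_side_degree_3_tiling p T \<and>
           (\<forall>T'. side_to_side_degree_3_tiling p T' \<longrightarrow>
              (\<exists>f. plane_isometry f \<and> T' = move_tiling f T)) \<and>
           isohedral T \<and> periodic T \<and>
           (\<exists>X. plane_covers T X \<and> minimal_torus_tiling X \<and> card (torus_tiles X) = 3)"
proof -
  have p3: "p3_hexagon p" using assms unfolding p3_hexagon_def by auto
  have ex_rot: "\<exists>\<omega>. rot_hexagon \<omega> q" if "p3_hexagon q" for q
    using rot_hexagonI[of q] that unfolding p3_hexagon_def by metis
  obtain \<omega> where rot: "rot_hexagon \<omega> p" using ex_rot[OF p3] by blast
  interpret rot_hex \<omega> p by unfold_locales (rule rot)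
  let ?T = "region ` rot_copies \<omega> p"
  have "\<exists>f. plane_isometry f \<and> T' = move_tiling f ?T" if T': "side_to_side_degree_3_tiling p T'" for T'
  proof -
    obtain Q where Q: "T' = region ` Q" "tiling_by_copies p Q" "side_to_side Q" "\<forall>v\<in>vertices Q. vertex_degree T' v
        = 3"
      using T' unfolding side_to_side_degree_3_tiling_def by blast
    interpret Q: p3_tiling p Q by unfold_locales (use assms(1) Q p3 in auto)
    \<comment> \<open>Any tile of the other tiling can serve as base: the tiling consists of the
      copies generated from this tile, and the isometry that carries \<open>p\<close> to it carries
      one system of copies to the other.\<close>
    obtain q where q: "q \<in> Q" using Q.coverQ by blast
    obtain f where f: "plane_isometry f" "q = f \<circ> p" using congruent_copyE[OF Q.copy[OF q]] .
    obtain \<omega>' where rot': "rot_hexagon \<omega>' q" using ex_rot p3_hexagon_plane_isometry[OF f(1) p3] f(2) by metis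
    then interpret q: rot_hex \<omega>' q by unfold_locales
    have "Q = rot_copies \<omega>' q" using q.p3_tiling_eq_copies[OF Q.p3_tiling_axioms q] .
    then have "T' = move_tiling f ?T" using rot_copies_move[OF f(1) rot] rot' unfolding Q(1) f(2) by simp
    with f(1) show ?thesis by blast
  qed
  then show ?thesis
    using copies_side_to_side_degree_3 copies_isohedral copies_periodic minimal_torus[OF p3] torus_tiles_card
    by (intro exI[of _ ?T]) blast
qed

end
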